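(* There is a constant $C>0$, depending only on the shape of $\Omega$, with the following property. Let $\nu,\alpha>0$, $h\in H$, let $\mathcal A_1\subset V$ be the global attractor of the semigroup $S(t):V\to V$ generated by the 3D Navier-Stokes-Voight problem $$v_t+\nu Av+\alpha^2Av_t+B(v,v)=h,\qquad v(0)=v_0,$$ and let $m$ be such that $$\lambda_{m+1}\ge C\,\frac{\|h\|_{-1}^4}{\alpha^4\nu^8d_1^2},\qquad d_1=\tfrac12\min\{\alpha^{-2},\lambda_1\}.$$ Let $v(t)$ and $u(t)$, $t\in\mathbb R$, be two solutions of this equation lying on the attractor, i.e. $v(t),u(t)\in\mathcal A_1$ for all $t\in\mathbb R$. If $P_mu(t)=P_mv(t)$ for all $t\in\mathbb R$, then $v(t)=u(t)$ for all $t\in\mathbb R$.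
   Context: $\Omega\subset\mathbb R^3$ is a bounded domain with sufficiently smooth boundary. $\mathcal V=\{v\in (C_0^\infty(\Omega))^3:\nabla\cdot v=0\}$; $H$ is the closure of $\mathcal V$ in $(L^2(\Omega))^3$, with norm $\|\cdot\|$; $P$ is the orthogonal (Helmholtz-Leray) projection of $(L^2(\Omega))^3$ onto $H$; $A=-P\Delta$ is the Stokes operator with homogeneous Dirichlet boundary condition, with orthonormal (in $H$) eigenfunctions $\{w_j\}$ and corresponding eigenvalues $0<\lambda_1\le\lambda_2\le\cdots$ repeated according to multiplicity. $P_m$ is the orthogonal projection of $H$ onto $\mathrm{span}\{w_1,\dots,w_m\}$. $\|v\|_s=\|A^{s/2}v\|$ is the norm of $V_s=D(A^{s/2})$, $s\in\mathbb R$ (for $s<0$, defined as the completion); $V=V_1=(H_0^1(\Omega))^3\cap H$ with $\|v\|_1=\|\nabla v\|$, and $V'=V_{-1}$. $B(u,v)=P((u\cdot\nabla)v)$, extended to a continuous bilinear map $V\times V\to V'$. For time-independent $h\in H$ and every $v_0\in V$ the problem has a unique global solution $v\in C([0,\infty);V)$ (equation understood in $V'$), and $S(t)v_0=v(t)$ is a continuous semigroup on $V$. It has a global attractor $\mathcal A_1$: the compact set in $V$ with $S(t)\mathcal A_1=\mathcal A_1$ for all $t\ge0$ that attracts every bounded subset of $V$ in the norm of $V$. "Depending only on the shape of $\Omega$" means: independent of $\nu,\alpha,h,m$ and of the solutions, and unchanged when $\Omega$ is rescaled. *)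

theory Defs
  imports "HOL-Analysis.Analysis"
begin

(* Elements of L^2(D) and of its subspaces are represented by functions on all of R^3,
   and two functions represent the same element iff they agree a.e. on D. *)

type_synonym vfield = "real^3 \<Rightarrow> real^3"

definition ae_eq :: "(real^3) set \<Rightarrow> (real^3 \<Rightarrow> 'b) \<Rightarrow> (real^3 \<Rightarrow> 'b) \<Rightarrow> bool" where
  "ae_eq D f g \<longleftrightarrow> (AE x in lebesgue_on D. f x = g x)"

definition L2 :: "(real^3) set \<Rightarrow> (real^3 \<Rightarrow> 'b::euclidean_space) set" where
  "L2 D = {f. f \<in> borel_measurable (lebesgue_on D) \<and> integrable (lebesgue_on D) (\<lambda>x. (norm (f x))\<^sup>2)}"

(* For matrix-valued f, g the inner product below is the Frobenius one. *)
definition l2_inner :: "(real^3) set \<Rightarrow> (real^3 \<Rightarrow> 'b::euclidean_space) \<Rightarrow> (real^3 \<Rightarrow> 'b) \<Rightarrow> real" where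
  "l2_inner D f g = (LINT x|lebesgue_on D. f x \<bullet> g x)"

definition l2_norm :: "(real^3) set \<Rightarrow> (real^3 \<Rightarrow> 'b::euclidean_space) \<Rightarrow> real" where
  "l2_norm D f = sqrt (l2_inner D f f)"

(* Orthogonal projection of u onto a subspace M of L^2(D), determined up to a.e. equality. *)
definition orth_proj :: "(real^3) set \<Rightarrow> (real^3 \<Rightarrow> 'b::euclidean_space) set \<Rightarrow> (real^3 \<Rightarrow> 'b) \<Rightarrow> (real^3 \<Rightarrow> 'b)" where
  "orth_proj D M u = (SOME p. p \<in> M \<and> (\<forall>z\<in>M. l2_inner D (\<lambda>x. u x - p x) z = 0))"

definition pd :: "3 \<Rightarrow> (real^3 \<Rightarrow> real) \<Rightarrow> real^3 \<Rightarrow> real" where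
  "pd j f x = frechet_derivative f (at x) (axis j 1)"

(* C^k on an open set S *)
primrec Ck_on :: "nat \<Rightarrow> (real^3) set \<Rightarrow> (real^3 \<Rightarrow> real) \<Rightarrow> bool" where
  "Ck_on 0 S f \<longleftrightarrow> continuous_on S f"
| "Ck_on (Suc k) S f \<longleftrightarrow> f differentiable_on S \<and> (\<forall>j. Ck_on k S (pd j f))"

(* Bounded domain whose boundary is locally a regular level set of a C^k function,
   the domain lying on one side of it. *)
definition bounded_Ck_domain :: "nat \<Rightarrow> (real^3) set \<Rightarrow> bool" where
  "bounded_Ck_domain k D \<longleftrightarrow> D \<noteq> {} \<and> open D \<and> connected D \<and> bounded D \<and>
     (\<forall>p\<in>frontier D. \<exists>U \<rho>. open U \<and> p \<in> U \<and> Ck_on k U \<rho> \<and> (\<exists>j. pd j \<rho> p \<noteq> 0) \<and>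
        D \<inter> U = {x\<in>U. \<rho> x < 0})"

definition test_functions :: "(real^3) set \<Rightarrow> (real^3 \<Rightarrow> real) set" where
  "test_functions D = {\<phi>. (\<forall>k. Ck_on k UNIV \<phi>) \<and>
     compact (closure {x. \<phi> x \<noteq> 0}) \<and> closure {x. \<phi> x \<noteq> 0} \<subseteq> D}"

definition solenoidal_test_fields :: "(real^3) set \<Rightarrow> vfield set" where
  "solenoidal_test_fields D = {v. (\<forall>i. (\<lambda>x. v x $ i) \<in> test_functions D) \<and>
     (\<forall>x. (\<Sum>i\<in>UNIV. pd i (\<lambda>y. v y $ i) x) = 0)}"

definition H_space :: "(real^3) set \<Rightarrow> vfield set" where
  "H_space D = {u \<in> L2 D. \<exists>\<phi>. (\<forall>n::nat. \<phi> n \<in> solenoidal_test_fields D) \<and>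
     (\<lambda>n. l2_norm D (\<lambda>x. \<phi> n x - u x)) \<longlonglongrightarrow> 0}"

abbreviation leray :: "(real^3) set \<Rightarrow> vfield \<Rightarrow> vfield" where
  "leray D \<equiv> orth_proj D (H_space D)"

definition weak_partial :: "(real^3) set \<Rightarrow> 3 \<Rightarrow> (real^3 \<Rightarrow> real) \<Rightarrow> (real^3 \<Rightarrow> real) \<Rightarrow> bool" where
  "weak_partial D j f g \<longleftrightarrow> f \<in> L2 D \<and> g \<in> L2 D \<and>
     (\<forall>\<phi>\<in>test_functions D. l2_inner D f (pd j \<phi>) = - l2_inner D g \<phi>)"

definition wpd :: "(real^3) set \<Rightarrow> 3 \<Rightarrow> (real^3 \<Rightarrow> real) \<Rightarrow> (real^3 \<Rightarrow> real)" where
  "wpd D j f = (SOME g. weak_partial D j f g)"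

(* The Sobolev space H^k(D) = W^{k,2}(D) *)
primrec sobolev :: "nat \<Rightarrow> (real^3) set \<Rightarrow> (real^3 \<Rightarrow> real) set" where
  "sobolev 0 D = L2 D"
| "sobolev (Suc k) D = {f \<in> L2 D. \<forall>j. \<exists>g\<in>sobolev k D. weak_partial D j f g}"

(* H_0^1(D): the closure of the test functions in H^1(D) *)
definition sobolev0 :: "(real^3) set \<Rightarrow> (real^3 \<Rightarrow> real) set" where
  "sobolev0 D = {f \<in> sobolev 1 D. \<exists>\<phi>. (\<forall>n::nat. \<phi> n \<in> test_functions D) \<and>
     (\<lambda>n. l2_norm D (\<lambda>x. \<phi> n x - f x)) \<longlonglongrightarrow> 0 \<and>
     (\<forall>j. (\<lambda>n. l2_norm D (\<lambda>x. pd j (\<phi> n) x - wpd D j f x)) \<longlonglongrightarrow> 0)}"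

(* Jacobian convention: the (i,j) entry is the j-th derivative of the i-th component. *)
definition wgrad :: "(real^3) set \<Rightarrow> vfield \<Rightarrow> real^3 \<Rightarrow> real^3^3" where
  "wgrad D u x = (\<chi> i j. wpd D j (\<lambda>y. u y $ i) x)"

definition wlaplacian :: "(real^3) set \<Rightarrow> vfield \<Rightarrow> vfield" where
  "wlaplacian D u x = (\<chi> i. \<Sum>j\<in>UNIV. wpd D j (wpd D j (\<lambda>y. u y $ i)) x)"

definition V_space :: "(real^3) set \<Rightarrow> vfield set" where
  "V_space D = {u \<in> H_space D. \<forall>i. (\<lambda>x. u x $ i) \<in> sobolev0 D}"

definition V_norm :: "(real^3) set \<Rightarrow> vfield \<Rightarrow> real" where
  "V_norm D u = l2_norm D (wgrad D u)"

(* The norm topology of V; as V_norm separates points only up to a.e. equality,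
   it does not distinguish representatives of the same element. *)
definition V_topology :: "(real^3) set \<Rightarrow> vfield topology" where
  "V_topology D = topology_generated_by
     {{z \<in> V_space D. V_norm D (\<lambda>x. z x - u x) < e} | u e. u \<in> V_space D \<and> 0 < e}"

definition stokes_domain :: "(real^3) set \<Rightarrow> vfield set" where
  "stokes_domain D = {u \<in> V_space D. \<forall>i. (\<lambda>x. u x $ i) \<in> sobolev 2 D}"

definition stokes :: "(real^3) set \<Rightarrow> vfield \<Rightarrow> vfield" where
  "stokes D u = (\<lambda>x. - leray D (wlaplacian D u) x)"

(* w 1, w 2, ... is an orthonormal basis of H consisting of eigenfunctions of the Stokes
   operator, enumerated in nondecreasing order of the eigenvalues lam 1, lam 2, ...;
   completeness in H makes every eigenvalue occur according to its multiplicity.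
   The values w 0 and lam 0 play no role. *)
definition stokes_eigensystem :: "(real^3) set \<Rightarrow> (nat \<Rightarrow> vfield) \<Rightarrow> (nat \<Rightarrow> real) \<Rightarrow> bool" where
  "stokes_eigensystem D w lam \<longleftrightarrow>
     (\<forall>j\<ge>1. w j \<in> stokes_domain D \<and> ae_eq D (stokes D (w j)) (\<lambda>x. lam j *\<^sub>R w j x)) \<and>
     (\<forall>j\<ge>1. \<forall>k\<ge>1. l2_inner D (w j) (w k) = (if j = k then 1 else 0)) \<and>
     (\<forall>u\<in>H_space D. (\<forall>j\<ge>1. l2_inner D u (w j) = 0) \<longrightarrow> ae_eq D u (\<lambda>x. 0)) \<and>
     0 < lam 1 \<and> (\<forall>j\<ge>1. lam j \<le> lam (Suc j))"

(* A^s v for v in H, by the functional calculus: the element of H whose j-th coefficient is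
   lam j powr s times that of v.  It exists for every v in H if s is nonpositive, and exactly
   for v in D(A^s) if s is positive. *)
definition stokes_power ::
  "(real^3) set \<Rightarrow> (nat \<Rightarrow> vfield) \<Rightarrow> (nat \<Rightarrow> real) \<Rightarrow> real \<Rightarrow> vfield \<Rightarrow> vfield" where
  "stokes_power D w lam s v =
     (SOME g. g \<in> H_space D \<and> (\<forall>j\<ge>1. l2_inner D g (w j) = lam j powr s * l2_inner D v (w j)))"

definition stokes_norm ::
  "(real^3) set \<Rightarrow> (nat \<Rightarrow> vfield) \<Rightarrow> (nat \<Rightarrow> real) \<Rightarrow> real \<Rightarrow> vfield \<Rightarrow> real" where
  "stokes_norm D w lam s v = l2_norm D (stokes_power D w lam (s / 2) v)"

definition mode_proj :: "(real^3) set \<Rightarrow> (nat \<Rightarrow> vfield) \<Rightarrow> nat \<Rightarrow> vfield \<Rightarrow> vfield" where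
  "mode_proj D w m = orth_proj D {\<lambda>x. \<Sum>j=1..m. c j *\<^sub>R w j x | c. True}"

(* Elements of V' are given by their values on elements \<phi> of V; an element z of H acts as
   l2_inner D z \<phi>.  The next two definitions are the extensions A : V -> V' and
   B : V x V -> V' of the operators A = -P Laplace and B(u,v) = P((u . grad) v)
   (P drops out against \<phi> in H); (u . grad) v is the Jacobian of v applied to u. *)
definition stokes_dual :: "(real^3) set \<Rightarrow> vfield \<Rightarrow> vfield \<Rightarrow> real" where
  "stokes_dual D v \<phi> = l2_inner D (wgrad D v) (wgrad D \<phi>)"

definition B_dual :: "(real^3) set \<Rightarrow> vfield \<Rightarrow> vfield \<Rightarrow> vfield \<Rightarrow> real" where
  "B_dual D u v \<phi> = l2_inner D (\<lambda>x. wgrad D v x *v u x) \<phi>"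

definition V_has_derivative ::
  "(real^3) set \<Rightarrow> real set \<Rightarrow> (real \<Rightarrow> vfield) \<Rightarrow> real \<Rightarrow> vfield \<Rightarrow> bool" where
  "V_has_derivative D I v t v' \<longleftrightarrow> v' \<in> V_space D \<and>
     ((\<lambda>s. V_norm D (\<lambda>x. (v s x - v t x) /\<^sub>R (s - t) - v' x)) \<longlongrightarrow> 0) (at t within I)"

(* v in C(I;V) solves v_t + nu A v + alpha^2 A v_t + B(v,v) = h, an identity in V'.
   The term A v_t lies in V' only if v_t lies in V. *)
definition nsv_solution ::
  "(real^3) set \<Rightarrow> real \<Rightarrow> real \<Rightarrow> vfield \<Rightarrow> real set \<Rightarrow> (real \<Rightarrow> vfield) \<Rightarrow> bool" where
  "nsv_solution D \<nu> \<alpha> h I v \<longleftrightarrow>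
     continuous_map (top_of_set I) (V_topology D) v \<and>
     (\<exists>v'. \<forall>t\<in>I. V_has_derivative D I v t (v' t) \<and>
       (\<forall>\<phi>\<in>V_space D.
          l2_inner D (v' t) \<phi> + \<nu> * stokes_dual D (v t) \<phi> + \<alpha>\<^sup>2 * stokes_dual D (v' t) \<phi>
            + B_dual D (v t) (v t) \<phi> = l2_inner D h \<phi>))"

definition nsv_semigroup ::
  "(real^3) set \<Rightarrow> real \<Rightarrow> real \<Rightarrow> vfield \<Rightarrow> real \<Rightarrow> vfield \<Rightarrow> vfield" where
  "nsv_semigroup D \<nu> \<alpha> h t v0 = (SOME v. nsv_solution D \<nu> \<alpha> h {0..} v \<and> ae_eq D (v 0) v0) t"

(* Subsets of V are represented by sets of functions saturated under a.e. equality, so the image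
   S(t) A is saturated before it is compared with A. *)
definition nsv_global_attractor ::
  "(real^3) set \<Rightarrow> real \<Rightarrow> real \<Rightarrow> vfield \<Rightarrow> vfield set \<Rightarrow> bool" where
  "nsv_global_attractor D \<nu> \<alpha> h \<A> \<longleftrightarrow>
     compactin (V_topology D) \<A> \<and>
     (\<forall>t\<ge>0. {z \<in> V_space D. \<exists>a\<in>\<A>. ae_eq D z (nsv_semigroup D \<nu> \<alpha> h t a)} = \<A>) \<and>
     (\<forall>\<B>. \<B> \<subseteq> V_space D \<and> (\<exists>R. \<forall>b\<in>\<B>. V_norm D b \<le> R) \<longrightarrow>
        (\<forall>e>0. \<exists>T\<ge>0. \<forall>t\<ge>T. \<forall>b\<in>\<B>. \<exists>a\<in>\<A>.
           V_norm D (\<lambda>x. nsv_semigroup D \<nu> \<alpha> h t b x - a x) < e))"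

end

(* Testing the equation with v gives E' <= -nu d1 (E - M) for E = |v|^2 + alpha^2 |grad v|^2, and a
   bounded function on the whole line with this property is at most M; on the attractor this
   bounds |grad v| by |h|_{-1} / (alpha nu sqrt d1). The difference z = v - u satisfies the energy
   identity with right-hand side -b(z,v,z), because b(u,z,z) = 0. Since the first m modes of z vanish,
   lam_{m+1} |z|^2 <= |grad z|^2, and the Ladyzhenskaya inequality
   b(z,v,z)^2 <= 36 |grad v|^2 |z| |grad z|^3 lets the viscous term absorb b(z,v,z); the energy of z
   then decays exponentially while being bounded on the whole line, hence vanishes.
   All constants are absolute. *)

theory Submission
  imports Defs
begin

section \<open>The space of square-integrable functions\<close>

text \<open>The constants are absolute because test functions extend by zero: Ladyzhenskaya's
  inequality is proved for them on the whole space by line integrals and reaches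
  \<open>V_space\<close> by density. Weak derivatives, projections and Stokes powers are all chosen
  by \<open>SOME\<close>, so each has to be shown to exist before anything can be said about it, and
  identities between gradients hold only almost everywhere. Uniqueness of weak derivatives rests on
  the fundamental lemma of the calculus of variations; Leray projections and the negative Stokes
  power come from the Riesz-Fischer theorem for the eigenfunctions. Solutions take values in V and
  have time derivatives in V, so they may be tested with themselves and their energies are
  differentiable. Both uses of the differential inequality require boundedness as time tends to
  minus infinity, which compactness of the attractor in V supplies. The constant 20736 is the square
  of 144 = 4 * 36: absorbing b(z,v,z) into half of the viscous term requires 36 |grad v|^2 <= (nu^2
  / 4) sqrt(lam_{m+1}).\<close>

lemma ae_eq_sym: "ae_eq D f g \<Longrightarrow> ae_eq D g f"
  unfolding ae_eq_def by (auto elim: eventually_mono)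

lemma L2_measurable: "f \<in> L2 D \<Longrightarrow> f \<in> borel_measurable (lebesgue_on D)"
  by (simp add: L2_def)

lemma integrable_inner_L2:
  assumes "f \<in> L2 D" "g \<in> L2 D"
  shows "integrable (lebesgue_on D) (\<lambda>x. f x \<bullet> g x)"
proof (rule Bochner_Integration.integrable_bound)
  show "integrable (lebesgue_on D) (\<lambda>x. (norm (f x))\<^sup>2 + (norm (g x))\<^sup>2)"
    using assms by (auto simp: L2_def)
  show "(\<lambda>x. f x \<bullet> g x) \<in> borel_measurable (lebesgue_on D)"
    using assms by (auto simp: L2_def)
  have "\<bar>a \<bullet> b\<bar> \<le> (norm a)\<^sup>2 + (norm b)\<^sup>2" for a b :: 'a
  proof -
    have "\<bar>a \<bullet> b\<bar> \<le> norm a * norm b" by (rule Cauchy_Schwarz_ineq2)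
    also have "\<dots> \<le> (norm a)\<^sup>2 + (norm b)\<^sup>2"
      using sum_squares_bound[of "norm a" "norm b"]
        mult_nonneg_nonneg[OF norm_ge_zero[of a] norm_ge_zero[of b]]
      by (simp only: mult.assoc)
    finally show ?thesis .
  qed
  then show "AE x in lebesgue_on D. norm (f x \<bullet> g x) \<le> norm ((norm (f x))\<^sup>2 + (norm (g x))\<^sup>2)"
    by (intro AE_I2) (simp add: abs_of_nonneg)
qed

lemma L2_add:
  assumes "f \<in> L2 D" "g \<in> L2 D"
  shows "(\<lambda>x. f x + g x) \<in> L2 D"
proof -
  have "(norm (f x + g x))\<^sup>2 = (norm (f x))\<^sup>2 + 2 * (f x \<bullet> g x) + (norm (g x))\<^sup>2" for x
    by (simp add: power2_norm_eq_inner inner_add_left inner_add_right inner_commute)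
  then show ?thesis
    using assms integrable_inner_L2[OF assms] by (auto simp: L2_def)
qed

lemma L2_scaleR: "f \<in> L2 D \<Longrightarrow> (\<lambda>x. c *\<^sub>R f x) \<in> L2 D"
  by (auto simp: L2_def power_mult_distrib)

lemma L2_uminus: "f \<in> L2 D \<Longrightarrow> (\<lambda>x. - f x) \<in> L2 D"
  using L2_scaleR[of f D "-1"] by simp

lemma L2_diff: "f \<in> L2 D \<Longrightarrow> g \<in> L2 D \<Longrightarrow> (\<lambda>x. f x - g x) \<in> L2 D"
  using L2_add[OF _ L2_uminus, of f D g] by simp

lemma L2_zero: "(\<lambda>x. 0) \<in> L2 D"
  by (simp add: L2_def)

lemma L2_sum: "(\<And>i. i \<in> I \<Longrightarrow> f i \<in> L2 D) \<Longrightarrow> (\<lambda>x. \<Sum>i\<in>I. f i x) \<in> L2 D"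
  by (induction I rule: infinite_finite_induct) (auto simp: L2_zero intro: L2_add)

lemmas L2_intros = L2_add L2_diff L2_scaleR L2_zero L2_sum L2_uminus

lemma L2_bounded_linear:
  assumes "bounded_linear T" "f \<in> L2 D"
  shows "(\<lambda>x. T (f x)) \<in> L2 D"
proof -
  obtain K where K: "K > 0" "\<And>y. norm (T y) \<le> norm y * K"
    using bounded_linear.pos_bounded[OF assms(1)] by blast
  have [measurable]: "f \<in> borel_measurable (lebesgue_on D)" "T \<in> borel_measurable borel"
    using assms by (auto simp: L2_def borel_measurable_continuous_onI linear_continuous_on)
  have m: "(\<lambda>x. T (f x)) \<in> borel_measurable (lebesgue_on D)"
    by measurable
  moreover have "integrable (lebesgue_on D) (\<lambda>x. (norm (T (f x)))\<^sup>2)"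
  proof (rule Bochner_Integration.integrable_bound)
    show "integrable (lebesgue_on D) (\<lambda>x. K\<^sup>2 * (norm (f x))\<^sup>2)"
      using assms by (auto simp: L2_def)
    show "(\<lambda>x. (norm (T (f x)))\<^sup>2) \<in> borel_measurable (lebesgue_on D)"
      using m by measurable
    have "(norm (T y))\<^sup>2 \<le> K\<^sup>2 * (norm y)\<^sup>2" for y
      using power_mono[OF K(2), of y 2] by (simp add: power_mult_distrib mult.commute)
    then show "AE x in lebesgue_on D. norm ((norm (T (f x)))\<^sup>2) \<le> norm (K\<^sup>2 * (norm (f x))\<^sup>2)"
      by (intro AE_I2) simp
  qed
  ultimately show ?thesis by (simp add: L2_def)
qed

lemma L2_component: "f \<in> L2 D \<Longrightarrow> (\<lambda>x. f x $ i) \<in> L2 D"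
  for f :: "real^3 \<Rightarrow> ('b::euclidean_space)^'n::finite"
  using L2_bounded_linear[OF bounded_linear_vec_nth] .

lemma L2_vec:
  fixes f :: "real^3 \<Rightarrow> ('b::euclidean_space)^'n::finite"
  assumes "\<And>i. (\<lambda>x. f x $ i) \<in> L2 D"
  shows "f \<in> L2 D"
proof -
  have eq: "f = (\<lambda>x. \<Sum>i\<in>UNIV. axis i (f x $ i))"
    by (auto simp: vec_eq_iff axis_def if_distrib[of "\<lambda>z. z $ _"] cong: if_cong)
  have "bounded_linear (axis i :: 'b \<Rightarrow> 'b^'n)" for i
    by (intro linear_conv_bounded_linear[THEN iffD1] linearI) (auto simp: vec_eq_iff axis_def)
  then show ?thesis
    by (subst eq) (intro L2_sum L2_bounded_linear[where T = "axis _"] assms)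
qed

lemma l2_inner_commute: "l2_inner D f g = l2_inner D g f"
  by (simp add: l2_inner_def inner_commute)

lemma l2_inner_add_left:
  "f \<in> L2 D \<Longrightarrow> g \<in> L2 D \<Longrightarrow> h \<in> L2 D \<Longrightarrow>
    l2_inner D (\<lambda>x. f x + g x) h = l2_inner D f h + l2_inner D g h"
  by (simp add: l2_inner_def inner_add_left integrable_inner_L2)

lemma l2_inner_diff_left:
  "f \<in> L2 D \<Longrightarrow> g \<in> L2 D \<Longrightarrow> h \<in> L2 D \<Longrightarrow>
    l2_inner D (\<lambda>x. f x - g x) h = l2_inner D f h - l2_inner D g h"
  by (simp add: l2_inner_def inner_diff_left integrable_inner_L2)

lemma l2_inner_scaleR_left: "l2_inner D (\<lambda>x. c *\<^sub>R f x) h = c * l2_inner D f h"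
  by (simp add: l2_inner_def)

lemma l2_inner_uminus_left: "l2_inner D (\<lambda>x. - f x) h = - l2_inner D f h"
  by (simp add: l2_inner_def)

lemma l2_inner_sum_left:
  assumes "\<And>i. i \<in> I \<Longrightarrow> f i \<in> L2 D" "h \<in> L2 D"
  shows "l2_inner D (\<lambda>x. \<Sum>i\<in>I. f i x) h = (\<Sum>i\<in>I. l2_inner D (f i) h)"
  unfolding l2_inner_def inner_sum_left
  by (rule Bochner_Integration.integral_sum) (use assms in \<open>auto intro: integrable_inner_L2\<close>)

lemma l2_inner_add_right:
  "f \<in> L2 D \<Longrightarrow> g \<in> L2 D \<Longrightarrow> h \<in> L2 D \<Longrightarrow>
    l2_inner D h (\<lambda>x. f x + g x) = l2_inner D h f + l2_inner D h g"
  by (simp add: l2_inner_commute[of D h] l2_inner_add_left)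

lemma l2_inner_diff_right:
  "f \<in> L2 D \<Longrightarrow> g \<in> L2 D \<Longrightarrow> h \<in> L2 D \<Longrightarrow>
    l2_inner D h (\<lambda>x. f x - g x) = l2_inner D h f - l2_inner D h g"
  by (simp add: l2_inner_commute[of D h] l2_inner_diff_left)

lemma l2_inner_scaleR_right: "l2_inner D h (\<lambda>x. c *\<^sub>R f x) = c * l2_inner D h f"
  by (simp add: l2_inner_def)

lemmas l2_inner_simps = l2_inner_add_left l2_inner_diff_left l2_inner_scaleR_left
  l2_inner_add_right l2_inner_diff_right l2_inner_scaleR_right

lemma l2_inner_cong:
  assumes "ae_eq D f f'" "ae_eq D g g'" "f \<in> L2 D" "f' \<in> L2 D" "g \<in> L2 D" "g' \<in> L2 D"
  shows "l2_inner D f g = l2_inner D f' g'"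
  unfolding l2_inner_def
  using assms by (intro integral_cong_AE)
    (auto simp: ae_eq_def L2_def elim: eventually_elim2)

lemma l2_inner_cong_left:
  "ae_eq D f f' \<Longrightarrow> f \<in> L2 D \<Longrightarrow> f' \<in> L2 D \<Longrightarrow> g \<in> L2 D \<Longrightarrow> l2_inner D f g = l2_inner D f' g"
  by (rule l2_inner_cong) (auto simp: ae_eq_def)

lemma l2_norm_cong:
  "ae_eq D f f' \<Longrightarrow> f \<in> L2 D \<Longrightarrow> f' \<in> L2 D \<Longrightarrow> l2_norm D f = l2_norm D f'"
  unfolding l2_norm_def by (subst l2_inner_cong[of D f f' f f']) auto

lemma l2_inner_self_nonneg: "0 \<le> l2_inner D f f"
  by (simp add: l2_inner_def)

lemma l2_norm_nonneg [simp]: "0 \<le> l2_norm D f"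
  by (simp add: l2_norm_def l2_inner_self_nonneg)

lemma l2_norm_power2: "(l2_norm D f)\<^sup>2 = l2_inner D f f"
  by (simp add: l2_norm_def l2_inner_self_nonneg)

lemma l2_norm_zero [simp]: "l2_norm D (\<lambda>x. 0) = 0"
  by (simp add: l2_norm_def l2_inner_def)

lemma l2_norm_scaleR: "l2_norm D (\<lambda>x. c *\<^sub>R f x) = \<bar>c\<bar> * l2_norm D f"
  unfolding l2_norm_def l2_inner_scaleR_left l2_inner_scaleR_right mult.assoc[symmetric]
  by (simp add: real_sqrt_mult)

lemma l2_norm_minus_commute: "l2_norm D (\<lambda>x. f x - g x) = l2_norm D (\<lambda>x. g x - f x)"
proof -
  have "(\<lambda>x. f x - g x) = (\<lambda>x. (-1) *\<^sub>R (g x - f x))"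
    by auto
  then show ?thesis
    by (simp only: l2_norm_scaleR abs_minus_cancel abs_one mult_1)
qed

lemma l2_norm_eq_0_imp_ae:
  assumes "f \<in> L2 D" "l2_norm D f = 0"
  shows "ae_eq D f (\<lambda>x. 0)"
proof -
  have "(LINT x|lebesgue_on D. (norm (f x))\<^sup>2) = 0"
    using assms(2) by (simp add: l2_norm_def l2_inner_def power2_norm_eq_inner)
  moreover have "integrable (lebesgue_on D) (\<lambda>x. (norm (f x))\<^sup>2)"
    using assms(1) by (simp add: L2_def)
  ultimately show ?thesis
    by (subst (asm) integral_nonneg_eq_0_iff_AE) (auto simp: ae_eq_def)
qed

lemma l2_Cauchy_Schwarz:
  assumes "f \<in> L2 D" "g \<in> L2 D"
  shows "\<bar>l2_inner D f g\<bar> \<le> l2_norm D f * l2_norm D g"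
proof -
  define a b c where "a = l2_inner D f f" "b = l2_inner D f g" "c = l2_inner D g g"
  have q: "0 \<le> a - 2 * t * b + t\<^sup>2 * c" for t
  proof -
    have "0 \<le> l2_inner D (\<lambda>x. f x - t *\<^sub>R g x) (\<lambda>x. f x - t *\<^sub>R g x)"
      by (rule l2_inner_self_nonneg)
    also have "\<dots> = a - 2 * t * b + t\<^sup>2 * c"
      using assms by (simp add: l2_inner_simps L2_intros a_b_c_def l2_inner_commute[of D g f]
          power2_eq_square algebra_simps)
    finally show ?thesis .
  qed
  have "b\<^sup>2 \<le> a * c"
  proof (cases "c = 0")
    case True
    have "b = 0"
    proof (rule ccontr)
      assume "b \<noteq> 0"
      \<comment> \<open>For c = 0 the quadratic is affine in t, and this t gives it the value a - (a
        + 1) = -1.\<close>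
      then show False using q[of "(a + 1) / (2 * b)"] True by simp
    qed
    then show ?thesis using True by simp
  next
    case False
    then have "c > 0" using l2_inner_self_nonneg[of D g] by (simp add: a_b_c_def)
    then show ?thesis using q[of "b / c"]
      by (simp add: field_simps power2_eq_square)
  qed
  then have "\<bar>b\<bar> \<le> sqrt (a * c)"
    by (rule real_le_rsqrt[of "\<bar>b\<bar>", simplified])
  then show ?thesis by (simp add: a_b_c_def l2_norm_def real_sqrt_mult)
qed

lemma l2_norm_triangle:
  assumes "f \<in> L2 D" "g \<in> L2 D"
  shows "l2_norm D (\<lambda>x. f x + g x) \<le> l2_norm D f + l2_norm D g"
proof (rule power2_le_imp_le)
  have "(l2_norm D (\<lambda>x. f x + g x))\<^sup>2 = (l2_norm D f)\<^sup>2 + 2 * l2_inner D f g + (l2_norm D g)\<^sup>2"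
    using assms by (simp add: l2_norm_power2 l2_inner_simps L2_intros l2_inner_commute[of D g f])
  also have "\<dots> \<le> (l2_norm D f + l2_norm D g)\<^sup>2"
    using l2_Cauchy_Schwarz[OF assms] by (simp add: power2_sum)
  finally show "(l2_norm D (\<lambda>x. f x + g x))\<^sup>2 \<le> (l2_norm D f + l2_norm D g)\<^sup>2" .
qed simp

lemma l2_norm_triangle_diff:
  assumes "f \<in> L2 D" "g \<in> L2 D" "h \<in> L2 D"
  shows "l2_norm D (\<lambda>x. f x - h x) \<le> l2_norm D (\<lambda>x. f x - g x) + l2_norm D (\<lambda>x. g x - h x)"
  using l2_norm_triangle[OF L2_diff[OF assms(1,2)] L2_diff[OF assms(2,3)]] by simp

lemma nn_integral_norm_L2:
  assumes "f \<in> L2 D"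
  shows "(\<integral>\<^sup>+x. ennreal ((norm (f x))\<^sup>2) \<partial>lebesgue_on D) = ennreal ((l2_norm D f)\<^sup>2)"
  using assms by (simp add: nn_integral_eq_integral L2_def l2_norm_power2 l2_inner_def power2_norm_eq_inner)

lemma L2I_nn_integral:
  assumes "f \<in> borel_measurable (lebesgue_on D)"
    and "(\<integral>\<^sup>+x. ennreal ((norm (f x))\<^sup>2) \<partial>lebesgue_on D) \<le> ennreal K"
  shows "f \<in> L2 D"
proof -
  have "(\<integral>\<^sup>+x. ennreal ((norm (f x))\<^sup>2) \<partial>lebesgue_on D) < \<infinity>"
    using assms(2) ennreal_less_top le_less_trans by fastforce
  then show ?thesis
    using assms(1) by (simp add: L2_def integrable_iff_bounded)
qed

lemma l2_inner_tendsto: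
  assumes f: "\<And>n. f n \<in> L2 D" "f' \<in> L2 D" "((\<lambda>n. l2_norm D (\<lambda>x. f n x - f' x)) \<longlongrightarrow> 0) F"
    and g: "\<And>n. g n \<in> L2 D" "g' \<in> L2 D" "((\<lambda>n. l2_norm D (\<lambda>x. g n x - g' x)) \<longlongrightarrow> 0) F"
  shows "((\<lambda>n. l2_inner D (f n) (g n)) \<longlongrightarrow> l2_inner D f' g') F"
proof (rule Lim_null[THEN iffD2], rule Lim_null_comparison)
  let ?a = "\<lambda>n. l2_norm D (\<lambda>x. f n x - f' x)" and ?b = "\<lambda>n. l2_norm D (\<lambda>x. g n x - g' x)"
  have "\<bar>l2_inner D (f n) (g n) - l2_inner D f' g'\<bar> \<le> ?a n * ?b n + ?a n * l2_norm D g' + l2_norm D f' * ?b n" for n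
  proof -
    have "l2_inner D (f n) (g n) - l2_inner D f' g' =
       l2_inner D (\<lambda>x. f n x - f' x) (\<lambda>x. g n x - g' x) + l2_inner D (\<lambda>x. f n x - f' x) g'
         + l2_inner D f' (\<lambda>x. g n x - g' x)"
      using f(1,2) g(1,2) by (simp add: l2_inner_simps L2_intros)
    then show ?thesis
      using l2_Cauchy_Schwarz[OF L2_diff[OF f(1)[of n] f(2)] L2_diff[OF g(1)[of n] g(2)]]
        l2_Cauchy_Schwarz[OF L2_diff[OF f(1)[of n] f(2)] g(2)]
        l2_Cauchy_Schwarz[OF f(2) L2_diff[OF g(1)[of n] g(2)]]
      by linarith
  qed
  then show "\<forall>\<^sub>F n in F. norm (l2_inner D (f n) (g n) - l2_inner D f' g')
      \<le> ?a n * ?b n + ?a n * l2_norm D g' + l2_norm D f' * ?b n"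
    by simp
  show "((\<lambda>n. ?a n * ?b n + ?a n * l2_norm D g' + l2_norm D f' * ?b n) \<longlongrightarrow> 0) F"
    by (auto intro!: tendsto_eq_intros f(3) g(3))
qed

lemma l2_inner_tendsto_left:
  assumes "\<And>n. f n \<in> L2 D" "f' \<in> L2 D" "((\<lambda>n. l2_norm D (\<lambda>x. f n x - f' x)) \<longlongrightarrow> 0) F" "g \<in> L2 D"
  shows "((\<lambda>n. l2_inner D (f n) g) \<longlongrightarrow> l2_inner D f' g) F"
  using l2_inner_tendsto[OF assms(1-3), of "\<lambda>_. g" g] assms(4) by simp

lemma l2_norm_tendsto:
  assumes "\<And>n. f n \<in> L2 D" "f' \<in> L2 D" "((\<lambda>n. l2_norm D (\<lambda>x. f n x - f' x)) \<longlongrightarrow> 0) F"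
  shows "((\<lambda>n. l2_norm D (f n)) \<longlongrightarrow> l2_norm D f') F"
  unfolding l2_norm_def by (intro tendsto_real_sqrt l2_inner_tendsto assms)

text \<open>The squared distances tend to zero in L^1, which yields a subsequence along which they
  tend to zero almost everywhere; the square root carries this back.\<close>

lemma l2_convergent_AE_subseq:
  assumes f: "\<And>n. f n \<in> L2 D" "f' \<in> L2 D" "(\<lambda>n. l2_norm D (\<lambda>x. f n x - f' x)) \<longlonglongrightarrow> 0"
  obtains r :: "nat \<Rightarrow> nat" where "strict_mono r" "AE x in lebesgue_on D. (\<lambda>n. f (r n) x) \<longlonglongrightarrow> f' x"
proof -
  let ?u = "\<lambda>n x. (norm (f n x - f' x))\<^sup>2"
  have eq: "(\<lambda>n. LINT x|lebesgue_on D. norm (?u n x)) = (\<lambda>n. (l2_norm D (\<lambda>x. f n x - f' x))\<^sup>2)"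
    by (simp add: l2_norm_power2 l2_inner_def power2_norm_eq_inner)
  have "integrable (lebesgue_on D) (?u n)" for n
    using L2_diff[OF f(1)[of n] f(2)] by (simp add: L2_def)
  moreover have "(\<lambda>n. LINT x|lebesgue_on D. norm (?u n x)) \<longlonglongrightarrow> 0"
    unfolding eq using tendsto_power[OF f(3), of 2] by simp
  ultimately obtain r where r: "strict_mono r" "AE x in lebesgue_on D. (\<lambda>n. ?u (r n) x) \<longlonglongrightarrow> 0"
    using tendsto_L1_AE_subseq[of "lebesgue_on D" ?u] by blast
  have "(\<lambda>n. f (r n) x) \<longlonglongrightarrow> f' x" if "(\<lambda>n. ?u (r n) x) \<longlonglongrightarrow> 0" for x
  proof -
    have "(\<lambda>n. sqrt (?u (r n) x)) \<longlonglongrightarrow> sqrt 0"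
      using that by (rule tendsto_real_sqrt)
    then show ?thesis
      by (subst LIM_zero_iff[symmetric], subst tendsto_norm_zero_iff[symmetric]) simp
  qed
  then show ?thesis using r by (auto intro!: that)
qed

text \<open>A subsequence with increments a_k of norm below 2^-k converges almost everywhere: the
  sum of 2^k a_k^2 has finite integral, and a_k <= 2^-k + 2^k a_k^2 makes the increments summable
  wherever that sum is finite. Fatou's lemma then identifies the pointwise limit as the limit in
  L^2.\<close>

lemma L2_complete:
  fixes f :: "nat \<Rightarrow> real^3 \<Rightarrow> 'b::euclidean_space"
  assumes f: "\<And>n. f n \<in> L2 D"
    and C: "\<And>e. e > 0 \<Longrightarrow> \<exists>N. \<forall>m\<ge>N. \<forall>n\<ge>N. l2_norm D (\<lambda>x. f m x - f n x) < e"
  obtains g where "g \<in> L2 D" "(\<lambda>n. l2_norm D (\<lambda>x. f n x - g x)) \<longlonglongrightarrow> 0"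
proof -
  have "\<exists>r :: nat \<Rightarrow> nat. \<forall>k. (\<forall>m\<ge>r k. \<forall>n\<ge>r k. l2_norm D (\<lambda>x. f m x - f n x) < (1/2)^k) \<and> r k < r (Suc k)"
  proof (rule dependent_nat_choice)
    show "\<exists>x. \<forall>m\<ge>x. \<forall>n\<ge>x. l2_norm D (\<lambda>x. f m x - f n x) < (1/2)^0"
      using C[of 1] by simp
    fix x :: nat and k
    obtain N where N: "\<forall>m\<ge>N. \<forall>n\<ge>N. l2_norm D (\<lambda>x. f m x - f n x) < (1/2)^Suc k"
      using C[of "(1/2)^Suc k"] by auto
    show "\<exists>y. (\<forall>m\<ge>y. \<forall>n\<ge>y. l2_norm D (\<lambda>x. f m x - f n x) < (1/2)^Suc k) \<and> x < y"
      using N by (intro exI[of _ "max N (Suc x)"]) auto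
  qed
  then obtain r where r: "\<And>k m n. m \<ge> r k \<Longrightarrow> n \<ge> r k \<Longrightarrow> l2_norm D (\<lambda>x. f m x - f n x) < (1/2)^k"
    and inc: "\<And>k. r k < r (Suc k)"
    by blast
  have rm: "strict_mono r" using inc by (simp add: strict_mono_Suc_iff)
  define M where "M = lebesgue_on D"
  have [measurable]: "f n \<in> borel_measurable M" for n
    using f by (simp add: M_def L2_def)
  define a where "a k x = norm (f (r (Suc k)) x - f (r k) x)" for k x
  \<comment> \<open>The squared increments have integral at most 4^-k, so the weight 2^k still
    leaves a geometric series.\<close>
  have "AE x in M. (\<Sum>k. ennreal (2^k * (a k x)\<^sup>2)) \<noteq> \<infinity>"
  proof (rule nn_integral_PInf_AE)
    show "(\<lambda>x. \<Sum>k. ennreal (2^k * (a k x)\<^sup>2)) \<in> borel_measurable M"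
      unfolding a_def by measurable
    have "(\<integral>\<^sup>+x. (\<Sum>k. ennreal (2^k * (a k x)\<^sup>2)) \<partial>M) = (\<Sum>k. \<integral>\<^sup>+x. ennreal (2^k * (a k x)\<^sup>2) \<partial>M)"
      unfolding a_def by (rule nn_integral_suminf) measurable
    also have "\<dots> \<le> (\<Sum>k. ennreal ((1/2)^k))"
    proof (rule suminf_le)
      fix k
      have "(\<integral>\<^sup>+x. ennreal (2^k * (a k x)\<^sup>2) \<partial>M) = ennreal (2^k) * (\<integral>\<^sup>+x. ennreal ((a k x)\<^sup>2) \<partial>M)"
        unfolding a_def by (subst nn_integral_cmult[symmetric]) (auto simp: ennreal_mult')
      also have "(\<integral>\<^sup>+x. ennreal ((a k x)\<^sup>2) \<partial>M) = ennreal ((l2_norm D (\<lambda>x. f (r (Suc k)) x - f (r k) x))\<^sup>2)"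
        unfolding a_def M_def by (rule nn_integral_norm_L2) (intro L2_diff f)
      also have "\<dots> \<le> ennreal (((1/2)^k)\<^sup>2)"
        using r[of k "r (Suc k)" "r k"] inc[of k] by (intro ennreal_leI power_mono) auto
      also have "ennreal (2^k) * ennreal (((1/2)^k)\<^sup>2) = ennreal ((1/2)^k)"
        by (simp add: ennreal_mult'[symmetric] power2_eq_square power_divide)
      finally show "(\<integral>\<^sup>+x. ennreal (2^k * (a k x)\<^sup>2) \<partial>M) \<le> ennreal ((1/2)^k)"
        by (simp add: mult_left_mono)
    qed auto
    also have "\<dots> = ennreal (\<Sum>k. (1/2)^k)"
      by (rule suminf_ennreal2) (auto intro: summable_geometric)
    finally show "(\<integral>\<^sup>+x. (\<Sum>k. ennreal (2^k * (a k x)\<^sup>2)) \<partial>M) \<noteq> \<infinity>"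
      by (auto simp: top_unique)
  qed
  then have conv: "AE x in M. convergent (\<lambda>k. f (r k) x)"
  proof (rule eventually_mono)
    fix x assume "(\<Sum>k. ennreal (2^k * (a k x)\<^sup>2)) \<noteq> \<infinity>"
    then have s1: "summable (\<lambda>k. 2^k * (a k x)\<^sup>2)"
      by (intro summable_suminf_not_top) auto
    have "summable (\<lambda>k. a k x)"
    proof (rule summable_comparison_test'[where N = 0])
      show "summable (\<lambda>k. (1/2)^k + 2^k * (a k x)\<^sup>2)"
        by (intro summable_add s1 summable_geometric) auto
      fix k
      let ?p = "(2::real)^k"
      have "2 * 1 * (?p * a k x) \<le> 1\<^sup>2 + (?p * a k x)\<^sup>2"
        by (rule sum_squares_bound)
      then have "2 * (?p * a k x) / ?p \<le> (1 + (?p * a k x)\<^sup>2) / ?p"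
        by (intro divide_right_mono) auto
      then have "2 * a k x \<le> 1 / ?p + ?p * (a k x)\<^sup>2"
        by (simp add: add_divide_distrib power2_eq_square mult_ac)
      moreover have "a k x \<ge> 0" by (simp add: a_def)
      ultimately show "norm (a k x) \<le> (1/2)^k + 2^k * (a k x)\<^sup>2"
        by (simp add: power_divide)
    qed
    then have "summable (\<lambda>k. f (r (Suc k)) x - f (r k) x)"
      unfolding a_def by (rule summable_norm_cancel)
    then have "convergent (\<lambda>n. \<Sum>k<n. f (r (Suc k)) x - f (r k) x)"
      by (simp add: summable_iff_convergent)
    then have "convergent (\<lambda>n. f (r n) x - f (r 0) x)"
      by (simp add: sum_lessThan_telescope[of "\<lambda>k. f (r k) x"])
    then show "convergent (\<lambda>n. f (r n) x)"
      using convergent_add[OF _ convergent_const[of "f (r 0) x"]] by fastforce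
  qed
  define g where "g x = lim (\<lambda>k. f (r k) x)" for x
  have [measurable]: "g \<in> borel_measurable M" unfolding g_def by measurable
  \<comment> \<open>Fatou along the subsequence \<open>f (r i)\<close> with \<open>n\<close> fixed;
    the bound holds for all i >= k. The same estimate gives square integrability of the limit (k =
    0) and the convergence of the full sequence.\<close>
  have est: "(\<integral>\<^sup>+x. ennreal ((norm (g x - f n x))\<^sup>2) \<partial>M) \<le> ennreal (((1/2)^k)\<^sup>2)" if n: "n \<ge> r k" for n k
  proof -
    have "(\<integral>\<^sup>+x. ennreal ((norm (g x - f n x))\<^sup>2) \<partial>M) = (\<integral>\<^sup>+x. liminf (\<lambda>i. ennreal ((norm (f (r i) x - f n x))\<^sup>2)) \<partial>M)"
    proof (rule nn_integral_cong_AE, rule AE_mp[OF conv], rule AE_I2, rule impI)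
      fix x assume "convergent (\<lambda>k. f (r k) x)"
      then have "(\<lambda>k. f (r k) x) \<longlonglongrightarrow> g x" by (simp add: g_def convergent_LIMSEQ_iff)
      then have "(\<lambda>i. ennreal ((norm (f (r i) x - f n x))\<^sup>2)) \<longlonglongrightarrow> ennreal ((norm (g x - f n x))\<^sup>2)"
        by (intro tendsto_intros)
      from lim_imp_Liminf[OF trivial_limit_sequentially this]
      show "ennreal ((norm (g x - f n x))\<^sup>2) = liminf (\<lambda>i. ennreal ((norm (f (r i) x - f n x))\<^sup>2))"
        by simp
    qed
    also have "\<dots> \<le> liminf (\<lambda>i. \<integral>\<^sup>+x. ennreal ((norm (f (r i) x - f n x))\<^sup>2) \<partial>M)"
      by (rule nn_integral_liminf) measurable
    also have "\<dots> \<le> ennreal (((1/2)^k)\<^sup>2)"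
    proof (rule Liminf_le)
      have "\<forall>\<^sub>F i in sequentially. i \<ge> k" by (rule eventually_ge_at_top)
      then show "\<forall>\<^sub>F i in sequentially. (\<integral>\<^sup>+x. ennreal ((norm (f (r i) x - f n x))\<^sup>2) \<partial>M) \<le> ennreal (((1/2)^k)\<^sup>2)"
      proof (rule eventually_mono)
        fix i assume "i \<ge> k"
        then have "r i \<ge> r k" using rm by (simp add: strict_mono_less_eq)
        then have "l2_norm D (\<lambda>x. f (r i) x - f n x) \<le> (1/2)^k"
          using r[of k "r i" n] n by (simp add: less_imp_le)
        then show "(\<integral>\<^sup>+x. ennreal ((norm (f (r i) x - f n x))\<^sup>2) \<partial>M) \<le> ennreal (((1/2)^k)\<^sup>2)"
          unfolding M_def by (subst nn_integral_norm_L2) (auto intro!: L2_diff f ennreal_leI power_mono)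
      qed
    qed simp
    finally show ?thesis .
  qed
  have "(\<lambda>x. g x - f (r 0) x) \<in> L2 D"
    by (rule L2I_nn_integral[OF _ est[of 0 "r 0", unfolded M_def]]) (auto simp flip: M_def)
  from L2_add[OF this f[of "r 0"]] have g: "g \<in> L2 D" by simp
  have "(\<lambda>n. l2_norm D (\<lambda>x. f n x - g x)) \<longlonglongrightarrow> 0"
  proof (rule LIMSEQ_I)
    fix e :: real assume "e > 0"
    then obtain k where k: "(1/2)^k < e" using real_arch_pow_inv[of e "1/2"] by auto
    have "l2_norm D (\<lambda>x. f n x - g x) < e" if "n \<ge> r k" for n
    proof -
      have "ennreal ((l2_norm D (\<lambda>x. g x - f n x))\<^sup>2) \<le> ennreal (((1/2)^k)\<^sup>2)"
        using est[OF that] nn_integral_norm_L2[OF L2_diff[OF g f[of n]]] by (simp add: M_def)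
      then have "(l2_norm D (\<lambda>x. g x - f n x))\<^sup>2 \<le> ((1/2)^k)\<^sup>2" 
        by (subst (asm) ennreal_le_iff) auto
      then have "l2_norm D (\<lambda>x. g x - f n x) \<le> (1/2)^k"
        by (rule power2_le_imp_le) simp
      then show ?thesis using k l2_norm_minus_commute[of D "f n" g] by simp
    qed
    then show "\<exists>no. \<forall>n\<ge>no. norm (l2_norm D (\<lambda>x. f n x - g x) - 0) < e" by auto
  qed
  with g show ?thesis by (rule that)
qed

section \<open>Smooth functions and test functions\<close>

lemma pd_eq: "(f has_derivative f') (at x) \<Longrightarrow> pd j f x = f' (axis j 1)"
  unfolding pd_def using frechet_derivative_at by metis

lemma pd_add:
  "f differentiable (at x) \<Longrightarrow> g differentiable (at x) \<Longrightarrow> pd j (\<lambda>x. f x + g x) x = pd j f x + pd j g x"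
  by (subst pd_eq[OF has_derivative_add[OF iffD1[OF frechet_derivative_works] iffD1[OF frechet_derivative_works]]])
    (auto simp: pd_def)

lemma pd_mult:
  "f differentiable (at x) \<Longrightarrow> g differentiable (at x) \<Longrightarrow>
    pd j (\<lambda>x. f x * g x) x = f x * pd j g x + pd j f x * g x"
  by (subst pd_eq[OF has_derivative_mult[OF iffD1[OF frechet_derivative_works] iffD1[OF frechet_derivative_works]]])
    (auto simp: pd_def)

lemma pd_const: "pd j (\<lambda>x. c) x = 0"
  by (subst pd_eq[OF has_derivative_const]) auto

definition smooth :: "(real^3 \<Rightarrow> real) \<Rightarrow> bool" where
  "smooth f \<longleftrightarrow> (\<forall>k. Ck_on k UNIV f)"

lemma smooth_differentiable: "smooth f \<Longrightarrow> f differentiable (at x)"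
  unfolding smooth_def by (drule spec[of _ "Suc 0"]) (auto simp: differentiable_on_def)

lemma smooth_pd: "smooth f \<Longrightarrow> smooth (pd j f)"
  unfolding smooth_def by (metis Ck_on.simps(2))

lemma smooth_continuous: "smooth f \<Longrightarrow> continuous_on S f"
  using smooth_differentiable differentiable_imp_continuous_within
  by (metis continuous_at_imp_continuous_on)

text \<open>Replaces an induction on the order of differentiation by the choice of a class closed
  under \<open>pd\<close>. Continuity of the highest derivatives is obtained from their
  differentiability.\<close>

lemma smooth_coinduct:
  assumes "P f"
    and diff: "\<And>g x. P g \<Longrightarrow> g differentiable (at x)"
    and pd: "\<And>g j. P g \<Longrightarrow> P (pd j g)"
  shows "smooth f"
proof -
  have "P g \<Longrightarrow> Ck_on k UNIV g" for g k
    by (induction k arbitrary: g)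
      (auto intro!: continuous_at_imp_continuous_on differentiable_imp_continuous_within diff pd
        simp: differentiable_on_def)
  with assms(1) show ?thesis by (simp add: smooth_def)
qed

lemma smooth_const: "smooth (\<lambda>x. c)"
  by (rule smooth_coinduct[of "\<lambda>f. \<exists>c. f = (\<lambda>x. c)"]) (auto simp: pd_const[abs_def])

lemma Ck_on_Suc_D: "Ck_on (Suc k) UNIV f \<Longrightarrow> Ck_on k UNIV f"
  by (induction k arbitrary: f) (auto intro: differentiable_imp_continuous_on)

lemma Ck_on_add: "Ck_on k UNIV f \<Longrightarrow> Ck_on k UNIV g \<Longrightarrow> Ck_on k UNIV (\<lambda>x. f x + g x)"
proof (induction k arbitrary: f g)
  case (Suc k)
  then have "pd j (\<lambda>x. f x + g x) = (\<lambda>x. pd j f x + pd j g x)" for j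
    by (auto simp: pd_add differentiable_on_def)
  with Suc show ?case by (auto simp: differentiable_on_def)
qed (auto intro: continuous_on_add)

lemma Ck_on_mult: "Ck_on k UNIV f \<Longrightarrow> Ck_on k UNIV g \<Longrightarrow> Ck_on k UNIV (\<lambda>x. f x * g x)"
proof (induction k arbitrary: f g)
  case (Suc k)
  then have "pd j (\<lambda>x. f x * g x) = (\<lambda>x. f x * pd j g x + pd j f x * g x)" for j
    by (auto simp: pd_mult differentiable_on_def)
  with Suc Ck_on_Suc_D[OF Suc.prems(1)] Ck_on_Suc_D[OF Suc.prems(2)] show ?case
    by (auto simp: differentiable_on_def intro!: Ck_on_add)
qed (auto intro: continuous_on_mult)

lemma smooth_add: "smooth f \<Longrightarrow> smooth g \<Longrightarrow> smooth (\<lambda>x. f x + g x)"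
  by (simp add: smooth_def Ck_on_add)

lemma smooth_mult: "smooth f \<Longrightarrow> smooth g \<Longrightarrow> smooth (\<lambda>x. f x * g x)"
  by (simp add: smooth_def Ck_on_mult)

lemma smooth_prod: "(\<And>i. i \<in> I \<Longrightarrow> smooth (f i)) \<Longrightarrow> smooth (\<lambda>x. \<Prod>i\<in>I. f i x)"
  by (induction I rule: infinite_finite_induct) (auto intro: smooth_const smooth_mult)

lemma test_functions_iff: "\<phi> \<in> test_functions D \<longleftrightarrow>
    smooth \<phi> \<and> compact (closure {x. \<phi> x \<noteq> 0}) \<and> closure {x. \<phi> x \<noteq> 0} \<subseteq> D"
  by (simp add: test_functions_def smooth_def)

lemma zero_outside_support: "x \<notin> closure {x. \<phi> x \<noteq> 0} \<Longrightarrow> \<phi> x = 0"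
  using closure_subset[of "{x. \<phi> x \<noteq> 0}"] by blast

lemma test_functions_support_subset:
  assumes "\<phi> \<in> test_functions D" "smooth \<psi>" "\<And>x. x \<notin> closure {x. \<phi> x \<noteq> 0} \<Longrightarrow> \<psi> x = 0"
  shows "\<psi> \<in> test_functions D"
proof -
  have sub: "closure {x. \<psi> x \<noteq> 0} \<subseteq> closure {x. \<phi> x \<noteq> 0}"
    by (rule closure_minimal) (use assms(3) in auto)
  have K: "closure {x. \<phi> x \<noteq> 0} \<subseteq> D" "compact (closure {x. \<phi> x \<noteq> 0})"
    using assms(1) by (simp_all add: test_functions_iff)
  have "compact (closure {x. \<psi> x \<noteq> 0})"
    using closed_Int_compact[OF closed_closure[of "{x. \<psi> x \<noteq> 0}"] K(2)] sub
    by (simp only: inf.absorb1)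
  then show ?thesis
    using assms(2) subset_trans[OF sub K(1)] by (simp add: test_functions_iff)
qed

lemma test_functions_mult:
  assumes "\<phi> \<in> test_functions D" "smooth \<psi>"
  shows "(\<lambda>x. \<phi> x * \<psi> x) \<in> test_functions D"
proof (rule test_functions_support_subset[OF assms(1)])
  show "smooth (\<lambda>x. \<phi> x * \<psi> x)"
    using assms by (auto simp: test_functions_iff intro: smooth_mult)
  show "\<phi> x * \<psi> x = 0" if "x \<notin> closure {x. \<phi> x \<noteq> 0}" for x
    using zero_outside_support[of x \<phi>] that by simp
qed

lemma test_functions_scale: "\<phi> \<in> test_functions D \<Longrightarrow> (\<lambda>x. c * \<phi> x) \<in> test_functions D"
  using test_functions_mult[OF _ smooth_const[of c]] by (simp add: mult.commute)

lemma test_functions_add: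
  assumes "\<phi> \<in> test_functions D" "\<psi> \<in> test_functions D"
  shows "(\<lambda>x. \<phi> x + \<psi> x) \<in> test_functions D"
proof -
  let ?K = "closure {x. \<phi> x \<noteq> 0} \<union> closure {x. \<psi> x \<noteq> 0}"
  have K: "compact ?K" "?K \<subseteq> D" using assms by (auto simp: test_functions_iff)
  have sub: "closure {x. \<phi> x + \<psi> x \<noteq> 0} \<subseteq> ?K"
  proof (rule closure_minimal)
    show "{x. \<phi> x + \<psi> x \<noteq> 0} \<subseteq> ?K"
    proof
      fix x assume "x \<in> {x. \<phi> x + \<psi> x \<noteq> 0}"
      then have "\<phi> x \<noteq> 0 \<or> \<psi> x \<noteq> 0" by auto
      then show "x \<in> ?K"
        using zero_outside_support[of x \<phi>] zero_outside_support[of x \<psi>] by blast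
    qed
  qed auto
  then have "compact (closure {x. \<phi> x + \<psi> x \<noteq> 0})"
    using closed_Int_compact[OF closed_closure[of "{x. \<phi> x + \<psi> x \<noteq> 0}"] K(1)]
    by (simp only: inf.absorb1)
  moreover have "smooth (\<lambda>x. \<phi> x + \<psi> x)"
    using assms by (intro smooth_add) (simp_all add: test_functions_iff)
  ultimately show ?thesis
    using subset_trans[OF sub K(2)] by (simp add: test_functions_iff)
qed

text \<open>Off its closed support the function vanishes on a whole neighbourhood, so its derivative
  vanishes there too.\<close>

lemma test_functions_pd:
  assumes "\<phi> \<in> test_functions D"
  shows "pd j \<phi> \<in> test_functions D"
proof (rule test_functions_support_subset[OF assms])
  show "smooth (pd j \<phi>)"
    using assms by (auto simp: test_functions_iff intro: smooth_pd)
  fix x assume x: "x \<notin> closure {x. \<phi> x \<noteq> 0}"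
  have "(\<phi> has_derivative (\<lambda>x. 0)) (at x)"
  proof (rule has_derivative_transform_within_open)
    show "((\<lambda>x. 0) has_derivative (\<lambda>x. 0)) (at x)" by simp
    show "open (- closure {x. \<phi> x \<noteq> 0})" by (simp add: open_Compl)
    show "0 = \<phi> y" if "y \<in> - closure {x. \<phi> x \<noteq> 0}" for y
      using zero_outside_support[of y \<phi>] that by simp
  qed (use x in simp)
  then show "pd j \<phi> x = 0" by (simp add: pd_eq)
qed

lemma test_functions_support:
  assumes "\<phi> \<in> test_functions D" "x \<notin> D"
  shows "\<phi> x = 0"
  using assms by (intro zero_outside_support[of x \<phi>]) (auto simp: test_functions_iff)

lemma test_functions_smooth: "\<phi> \<in> test_functions D \<Longrightarrow> smooth \<phi>"
  by (simp add: test_functions_iff)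

lemma test_functions_borel [measurable (raw)]:
  "\<phi> \<in> test_functions D \<Longrightarrow> \<phi> \<in> borel_measurable borel"
  by (intro borel_measurable_continuous_onI smooth_continuous test_functions_smooth)

lemma test_functions_bounded:
  assumes "\<phi> \<in> test_functions D"
  obtains B where "B > 0" "\<And>x. \<bar>\<phi> x\<bar> \<le> B"
proof -
  let ?K = "closure {x. \<phi> x \<noteq> 0}"
  have "compact (\<phi> ` ?K)"
    using assms by (auto intro!: compact_continuous_image smooth_continuous simp: test_functions_iff)
  then have "bounded (\<phi> ` ?K)" by (rule compact_imp_bounded)
  then obtain B where B: "B > 0" "\<And>x. x \<in> ?K \<Longrightarrow> \<bar>\<phi> x\<bar> \<le> B"
    by (auto simp: bounded_pos)
  have "\<bar>\<phi> x\<bar> \<le> B" for x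
    using B closure_subset[of "{x. \<phi> x \<noteq> 0}"] by (cases "\<phi> x = 0") auto
  then show ?thesis using B(1) that by blast
qed

lemma test_functions_integrable:
  assumes "\<phi> \<in> test_functions D"
  shows "integrable lborel \<phi>"
proof -
  let ?K = "closure {x. \<phi> x \<noteq> 0}"
  have "integrable lborel (\<lambda>x. indicator ?K x *\<^sub>R \<phi> x)"
    by (rule borel_integrable_compact)
      (use assms in \<open>auto simp: test_functions_iff intro: smooth_continuous\<close>)
  moreover have "(\<lambda>x. indicator ?K x *\<^sub>R \<phi> x) = \<phi>"
  proof
    fix x show "indicator ?K x *\<^sub>R \<phi> x = \<phi> x"
      using zero_outside_support[of x \<phi>] by (cases "x \<in> ?K") auto
  qed
  ultimately show ?thesis by simp
qed

text \<open>Moves integrals of functions vanishing off \<open>D\<close> to Borel measure on the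
  whole space, which is translation invariant and where partial derivatives of test functions are
  integrated.\<close>

lemma lebesgue_on_integral_support:
  fixes f :: "real^3 \<Rightarrow> 'b::euclidean_space"
  assumes D: "D \<in> sets lebesgue" and f: "f \<in> borel_measurable borel" "\<And>x. x \<notin> D \<Longrightarrow> f x = 0"
  shows "integrable (lebesgue_on D) f \<longleftrightarrow> integrable lborel f"
    and "integral\<^sup>L (lebesgue_on D) f = integral\<^sup>L lborel f"
proof -
  have eq: "(\<lambda>x. indicator D x *\<^sub>R f x) = f" using f(2) by (auto simp: indicator_def)
  show "integrable (lebesgue_on D) f \<longleftrightarrow> integrable lborel f"
    using D f(1) by (simp add: integrable_restrict_space eq integrable_completion)
  show "integral\<^sup>L (lebesgue_on D) f = integral\<^sup>L lborel f"
    using D f(1) by (simp add: integral_restrict_space eq integral_completion)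
qed

lemma borel_measurable_lebesgue_on:
  "f \<in> borel_measurable borel \<Longrightarrow> f \<in> borel_measurable (lebesgue_on D)"
  by (intro measurable_restrict_space1 measurable_completion) simp

lemma test_functions_L2:
  assumes "\<phi> \<in> test_functions D" "D \<in> sets lebesgue"
  shows "\<phi> \<in> L2 D"
proof -
  have t: "(\<lambda>x. \<phi> x * \<phi> x) \<in> test_functions D"
    by (intro test_functions_mult assms test_functions_smooth[OF assms(1)])
  have "integrable (lebesgue_on D) (\<lambda>x. \<phi> x * \<phi> x)"
    by (subst lebesgue_on_integral_support)
      (use assms in \<open>auto intro: test_functions_borel test_functions_integrable t
        test_functions_support[OF assms(1)]\<close>)
  then show ?thesis
    using assms by (auto simp: L2_def power2_eq_square
        intro!: borel_measurable_lebesgue_on test_functions_borel)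
qed

section \<open>Smooth bumps on boxes\<close>

text \<open>For p = 1 this is the classical flat function exp(-1/s), extended by zero to s <= 0. The
  polynomial factor in 1/s makes the family closed under differentiation.\<close>

definition flat_exp :: "real poly \<Rightarrow> real \<Rightarrow> real" where
  "flat_exp p s = (if s > 0 then poly p (1 / s) * exp (- (1 / s)) else 0)"

lemma poly_exp_tendsto_0: "((\<lambda>y::real. poly p y * exp (- y)) \<longlongrightarrow> 0) at_top"
proof -
  have "((\<lambda>y. \<Sum>i\<le>degree p. coeff p i * (y ^ i / exp y)) \<longlongrightarrow> (\<Sum>i\<le>degree p. coeff p i * 0)) at_top"
    by (intro tendsto_sum tendsto_mult tendsto_const tendsto_power_div_exp_0)
  then show ?thesis
    by (simp add: poly_altdef sum_distrib_right exp_minus divide_inverse mult.assoc)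
qed

lemma flat_exp_at_right_0: "(flat_exp p \<longlongrightarrow> 0) (at_right 0)"
proof -
  have "((\<lambda>x. poly p (1 / inverse x) * exp (- (1 / inverse x))) \<longlongrightarrow> 0) at_top"
    using poly_exp_tendsto_0[of p] by (simp add: field_simps)
  then have "((\<lambda>x. poly p (1 / x) * exp (- (1 / x))) \<longlongrightarrow> 0) (at_right 0)"
    by (simp add: filterlim_at_right_to_top)
  then show ?thesis
    by (rule Lim_transform_eventually)
      (auto simp: flat_exp_def eventually_at_right_field intro: exI[of _ 1])
qed

text \<open>With y = 1/s, differentiating p(y) exp(-y) gives y^2 (p - p')(y) exp(-y), whence the
  factor \<open>[:0, 0, 1:]\<close>. At s = 0 the right difference quotient is
  \<open>flat_exp (pCons 0 p)\<close>, again a member of the family, and therefore tends to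
  zero.\<close>

lemma flat_exp_derivative:
  "(flat_exp p has_real_derivative flat_exp ([:0, 0, 1:] * (p - pderiv p)) s) (at s)"
proof (cases s "0::real" rule: linorder_cases)
  case less
  have "((\<lambda>x. 0) has_real_derivative 0) (at s)" by simp
  then have "(flat_exp p has_real_derivative 0) (at s)"
    by (rule has_field_derivative_transform_within_open[where S = "{..<0}"])
      (use less in \<open>auto simp: flat_exp_def\<close>)
  then show ?thesis using less by (simp add: flat_exp_def)
next
  case greater
  have "((\<lambda>s. poly p (1 / s) * exp (- (1 / s))) has_real_derivative
      (poly ([:0, 0, 1:] * (p - pderiv p)) (1 / s) * exp (- (1 / s)))) (at s)"
    using greater
    by (auto intro!: derivative_eq_intros DERIV_chain2[OF poly_DERIV] simp: power2_eq_square field_simps)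
  then have "(flat_exp p has_real_derivative
      (poly ([:0, 0, 1:] * (p - pderiv p)) (1 / s) * exp (- (1 / s)))) (at s)"
    by (rule has_field_derivative_transform_within_open[where S = "{0<..}"])
      (use greater in \<open>auto simp: flat_exp_def\<close>)
  then show ?thesis using greater by (simp add: flat_exp_def)
next
  case equal
  have "((\<lambda>h. flat_exp p h / h) \<longlongrightarrow> 0) (at 0)"
  proof (rule filterlim_split_at)
    have "\<forall>\<^sub>F h in at_left 0. (0::real) = flat_exp p h / h"
      by (auto simp: eventually_at_left_field flat_exp_def intro: exI[of _ "-1"])
    then show "((\<lambda>h. flat_exp p h / h) \<longlongrightarrow> 0) (at_left 0)"
      by (rule Lim_transform_eventually[OF tendsto_const])
    have "\<forall>\<^sub>F h in at_right 0. flat_exp (pCons 0 p) h = flat_exp p h / h"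
      by (auto simp: eventually_at_right_field flat_exp_def intro: exI[of _ 1])
    then show "((\<lambda>h. flat_exp p h / h) \<longlongrightarrow> 0) (at_right 0)"
      by (rule Lim_transform_eventually[OF flat_exp_at_right_0])
  qed
  then show ?thesis using equal by (simp add: DERIV_def flat_exp_def)
qed

lemma smooth_flat_exp: "smooth (\<lambda>x. flat_exp p (a * x $ i + b))"
\<comment> \<open>The scalar c in the class absorbs the chain rule factor
  \<open>a * axis j 1 $ i\<close>, which is zero when i and j differ.\<close>
proof (rule smooth_coinduct[of "\<lambda>f. \<exists>c p. f = (\<lambda>x. c * flat_exp p (a * x $ i + b))"])
  fix g :: "real^3 \<Rightarrow> real" and x j
  assume "\<exists>c p. g = (\<lambda>x. c * flat_exp p (a * x $ i + b))"
  then obtain c p where g: "g = (\<lambda>x. c * flat_exp p (a * x $ i + b))" by blast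
  let ?q = "[:0, 0, 1:] * (p - pderiv p)"
  have d: "(g has_derivative (\<lambda>h. c * (flat_exp ?q (a * x $ i + b) * (a * h $ i)))) (at x)" for x
    unfolding g
    by (intro has_derivative_mult_right has_derivative_compose[of "\<lambda>x. a * x $ i + b" _ _ _ "flat_exp p",
        OF _ flat_exp_derivative[unfolded has_field_derivative_def]])
      (auto intro!: derivative_eq_intros bounded_linear_imp_has_derivative)
  then show "g differentiable (at x)"
    by (rule differentiableI)
  have "pd j g = (\<lambda>x. (c * a * axis j 1 $ i) * flat_exp ?q (a * x $ i + b))"
    by (rule ext, subst pd_eq[OF d]) simp
  then show "\<exists>c p. pd j g = (\<lambda>x. c * flat_exp p (a * x $ i + b))"
    by blast
qed (auto intro!: exI[of _ 1] exI[of _ p])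

text \<open>A smooth approximation of the indicator of the open box. The factor \<open>Suc n\<close>
  steepens the edges: at an interior point each factor is exp(-1/((n+1)c)) with c > 0 and tends to
  1, while the set where the bump is nonzero stays the box for all \<open>n\<close>.\<close>

definition box_bump :: "real^3 \<Rightarrow> real^3 \<Rightarrow> nat \<Rightarrow> real^3 \<Rightarrow> real" where
  "box_bump l u n x = (\<Prod>i\<in>UNIV. flat_exp 1 (real (Suc n) * x $ i + (- real (Suc n) * l $ i))
      * flat_exp 1 (- real (Suc n) * x $ i + real (Suc n) * u $ i))"

lemma flat_exp_1_bounds: "0 \<le> flat_exp 1 s" "flat_exp 1 s \<le> 1" "flat_exp 1 s = 0 \<longleftrightarrow> s \<le> 0"
  by (auto simp: flat_exp_def)

lemma box_bump_bounds: "0 \<le> box_bump l u n x" "box_bump l u n x \<le> 1"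
  unfolding box_bump_def
  by (auto intro!: prod_nonneg prod_le_1 mult_nonneg_nonneg mult_le_one simp: flat_exp_1_bounds)

lemma box_bump_eq_0: "box_bump l u n x = 0 \<longleftrightarrow> x \<notin> box l u"
proof -
  have "real (Suc n) * a + (- real (Suc n) * b) \<le> 0 \<longleftrightarrow> a \<le> b" for a b
    by (simp add: algebra_simps flip: of_nat_Suc) 
  moreover have "- real (Suc n) * a + real (Suc n) * b \<le> 0 \<longleftrightarrow> b \<le> a" for a b
    by (simp add: algebra_simps flip: of_nat_Suc) 
  ultimately show ?thesis
    unfolding box_bump_def mem_box_cart
    by (simp only: prod_zero_iff finite mult_eq_0_iff flat_exp_1_bounds) (auto simp: not_less)
qed

lemma box_bump_test:
  assumes "cbox l u \<subseteq> D"
  shows "box_bump l u n \<in> test_functions D"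
proof -
  have "closure {x. box_bump l u n x \<noteq> 0} \<subseteq> cbox l u"
    by (rule closure_minimal) (auto simp: box_bump_eq_0 box_subset_cbox[THEN subsetD])
  moreover from this have "compact (closure {x. box_bump l u n x \<noteq> 0})"
    by (metis closed_Int_compact closed_closure compact_cbox inf.absorb1)
  moreover have "smooth (box_bump l u n)"
    unfolding box_bump_def[abs_def] by (intro smooth_prod smooth_mult smooth_flat_exp)
  ultimately show ?thesis using assms by (auto simp: test_functions_iff)
qed

lemma box_bump_tendsto: "(\<lambda>n. box_bump l u n x) \<longlonglongrightarrow> indicator (box l u) x"
proof (cases "x \<in> box l u")
  case True
  have *: "(\<lambda>n. flat_exp 1 (real (Suc n) * c)) \<longlonglongrightarrow> 1" if "c > 0" for c
  proof -
    have "(\<lambda>n. exp (- (inverse (real (Suc n)) * (1 / c)))) \<longlonglongrightarrow> exp (- (0 * (1 / c)))"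
      by (intro tendsto_intros LIMSEQ_inverse_real_of_nat)
    moreover have "flat_exp 1 (real (Suc n) * c) = exp (- (inverse (real (Suc n)) * (1 / c)))" for n
      using that by (simp add: flat_exp_def zero_less_mult_iff divide_inverse)
    ultimately show ?thesis by simp
  qed
  have "(\<lambda>n. box_bump l u n x) \<longlonglongrightarrow> (\<Prod>i\<in>(UNIV::3 set). 1 * 1)"
    unfolding box_bump_def
  proof (intro tendsto_prod tendsto_mult)
    fix i :: 3
    have "x $ i - l $ i > 0" "u $ i - x $ i > 0" using True by (auto simp: mem_box_cart)
    from this[THEN *]
    show "(\<lambda>n. flat_exp 1 (real (Suc n) * x $ i + (- real (Suc n) * l $ i))) \<longlonglongrightarrow> 1"
      "(\<lambda>n. flat_exp 1 (- real (Suc n) * x $ i + real (Suc n) * u $ i)) \<longlonglongrightarrow> 1"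
      by (simp_all add: algebra_simps)
  qed
  then show ?thesis using True by simp
next
  case False
  then have "box_bump l u n x = 0" for n by (simp add: box_bump_eq_0)
  then show ?thesis using False by simp
qed

section \<open>The fundamental lemma of the calculus of variations\<close>

text \<open>The positive and negative parts of g, taken as densities, define measures that agree on
  boxes. Boxes form an intersection-stable generator of the Borel sets, so the measures coincide,
  and comparing them where the function is positive or negative shows that both parts
  vanish.\<close>

lemma AE_zero_if_integral_boxes_zero:
  fixes g :: "'a::euclidean_space \<Rightarrow> real"
  assumes g: "integrable lebesgue g"
    and 0: "\<And>l u. (LINT x|lebesgue. indicator (box l u) x * g x) = 0"
  shows "AE x in lebesgue. g x = 0"
proof -
  obtain f where f [measurable]: "f \<in> borel_measurable lborel" and ae: "AE x in lborel. g x = f x"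
    using completion_ex_borel_measurable_real[of g lborel] g by auto
  have ae': "AE x in lebesgue. g x = f x" using ae by (rule AE_completion)
  have gm [measurable]: "g \<in> borel_measurable lebesgue" using g by auto
  have fm [measurable]: "f \<in> borel_measurable lebesgue" using f by (rule measurable_completion)
  have fi': "integrable lebesgue f"
    by (rule integrable_cong_AE_imp[OF g]) (use ae' in auto)
  then have fi: "integrable lborel f" by (simp add: integrable_completion)
  have f0: "(LINT x|lborel. indicator (box l u) x * f x) = 0" for l u
  proof -
    have "(LINT x|lborel. indicator (box l u) x * f x) = (LINT x|lebesgue. indicator (box l u) x * f x)"
      by (rule integral_completion[symmetric]) measurable
    also have "\<dots> = (LINT x|lebesgue. indicator (box l u) x * g x)"
      by (intro integral_cong_AE borel_measurable_times borel_measurable_indicator fm gm)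
        (use ae' in auto)
    finally show ?thesis using 0 by simp
  qed
  \<comment> \<open>\<open>ennreal\<close> truncates negative values to zero, so these densities are
    the positive and the negative part of f.\<close>
  define \<mu> where "\<mu> = density lborel (\<lambda>x. ennreal (f x))"
  define \<nu> where "\<nu> = density lborel (\<lambda>x. ennreal (- f x))"
  have ne: "emeasure \<mu> A \<noteq> \<infinity>" if [measurable]: "A \<in> sets borel" for A
  proof -
    have "emeasure \<mu> A = (\<integral>\<^sup>+x. ennreal (f x) * indicator A x \<partial>lborel)"
      unfolding \<mu>_def by (rule emeasure_density) auto
    also have "\<dots> \<le> (\<integral>\<^sup>+x. ennreal (norm (f x)) \<partial>lborel)"
      by (intro nn_integral_mono) (auto simp: indicator_def intro!: ennreal_leI)
    also have "\<dots> < \<infinity>" using fi by (simp add: integrable_iff_bounded)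
    finally show ?thesis by simp
  qed
  have "\<mu> = \<nu>"
  proof (rule measure_eqI_generator_eq)
    let ?E = "range (\<lambda>(a, b). box a b::'a set)"
    show "Int_stable ?E"
      by (auto simp: Int_stable_def box_Int_box)
    show "?E \<subseteq> Pow UNIV" "sets \<mu> = sigma_sets UNIV ?E" "sets \<nu> = sigma_sets UNIV ?E"
      by (simp_all add: borel_eq_box \<mu>_def \<nu>_def)
    let ?A = "\<lambda>n::nat. box (- (real n *\<^sub>R One)) (real n *\<^sub>R One) :: 'a set"
    show "range ?A \<subseteq> ?E" "(\<Union>i. ?A i) = UNIV"
      unfolding UN_box_eq_UNIV by auto
    show "emeasure \<mu> (?A i) \<noteq> \<infinity>" for i by (rule ne) simp
    show "emeasure \<mu> X = emeasure \<nu> X" if X: "X \<in> ?E" for X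
    proof -
      obtain l u where X: "X = box l u" using X by auto
      let ?h = "\<lambda>x. indicator (box l u) x * f x"
      have hi: "integrable lborel ?h"
        using integrable_mult_indicator[OF _ fi, of "box l u"] by simp
      have "emeasure \<mu> X = (\<integral>\<^sup>+x. ennreal (?h x) \<partial>lborel)"
        unfolding \<mu>_def X by (subst emeasure_density) (auto intro!: nn_integral_cong simp: indicator_def)
      moreover have "emeasure \<nu> X = (\<integral>\<^sup>+x. ennreal (- ?h x) \<partial>lborel)"
        unfolding \<nu>_def X by (subst emeasure_density) (auto intro!: nn_integral_cong simp: indicator_def)
      moreover have "(\<integral>\<^sup>+x. ennreal (?h x) \<partial>lborel) = (\<integral>\<^sup>+x. ennreal (- ?h x) \<partial>lborel)"
      proof -
        obtain r q where rq: "0 \<le> r" "0 \<le> q" "(\<integral>\<^sup>+x. ennreal (?h x) \<partial>lborel) = ennreal r"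
            "(\<integral>\<^sup>+x. ennreal (- ?h x) \<partial>lborel) = ennreal q" "integral\<^sup>L lborel ?h = r - q"
          by (rule integrableE[OF hi])
        then show ?thesis using f0[of l u] by simp
      qed
      ultimately show ?thesis by simp
    qed
  qed
  have z: "AE x in lborel. \<not> 0 < h x"
    if h [measurable]: "h \<in> borel_measurable lborel"
      and eq: "density lborel (\<lambda>x. ennreal (h x)) = density lborel (\<lambda>x. ennreal (- h x))" for h :: "'a \<Rightarrow> real"
  proof -
    \<comment> \<open>On this set the density built from \<open>- h\<close> is zero, hence so is the
      integral of \<open>h\<close> over it.\<close>
    let ?A = "{x \<in> space lborel. 0 < h x}"
    have "(\<integral>\<^sup>+x. ennreal (h x) * indicator ?A x \<partial>lborel) = emeasure (density lborel (\<lambda>x. ennreal (h x))) ?A"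
      by (rule emeasure_density[symmetric]) auto
    also have "\<dots> = (\<integral>\<^sup>+x. ennreal (- h x) * indicator ?A x \<partial>lborel)"
      unfolding eq by (rule emeasure_density) auto
    also have "\<dots> = (\<integral>\<^sup>+x. 0 \<partial>(lborel :: 'a measure))"
      by (intro nn_integral_cong) (auto simp: indicator_def ennreal_neg)
    finally have "AE x in lborel. ennreal (h x) * indicator ?A x = 0"
        by (simp add: nn_integral_0_iff_AE)
    then show ?thesis by (rule eventually_mono) (auto simp: indicator_def)
  qed
  have "AE x in lebesgue. f x = 0"
    by (rule AE_completion) (use z[OF f] z[of "\<lambda>x. - f x"] \<open>\<mu> = \<nu>\<close> in \<open>auto simp: \<mu>_def \<nu>_def elim: eventually_elim2\<close>)
  then show ?thesis using ae' by (auto elim: eventually_elim2)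
qed

text \<open>Bumps converge boundedly to the indicator of a box, so g has integral zero over every
  box whose closure lies in \<open>D\<close>. Inside one such box this forces g = 0 almost
  everywhere, and countably many closed boxes exhaust \<open>D\<close>.\<close>

lemma test_functions_dense:
  fixes g :: "real^3 \<Rightarrow> real"
  assumes D: "open D" and g: "g \<in> L2 D" and 0: "\<And>\<phi>. \<phi> \<in> test_functions D \<Longrightarrow> l2_inner D g \<phi> = 0"
  shows "ae_eq D g (\<lambda>x. 0)"
proof -
  have Dl [measurable]: "D \<in> sets lebesgue" using D by auto
  define g0 where "g0 x = indicator D x *\<^sub>R g x" for x
  have g0m [measurable]: "g0 \<in> borel_measurable lebesgue"
    using L2_measurable[OF g] unfolding g0_def
    by (subst (asm) borel_measurable_restrict_space_iff) auto
  have sq: "integrable lebesgue (\<lambda>x. (g0 x)\<^sup>2)"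
  proof -
    have "integrable (lebesgue_on D) (\<lambda>x. (g x)\<^sup>2)" using g by (simp add: L2_def)
    then have "integrable lebesgue (\<lambda>x. indicator D x *\<^sub>R (g x)\<^sup>2)"
      by (subst (asm) integrable_restrict_space) auto
    also have "(\<lambda>x. indicator D x *\<^sub>R (g x)\<^sup>2) = (\<lambda>x. (g0 x)\<^sup>2)"
      by (auto simp: g0_def indicator_def)
    finally show ?thesis .
  qed
  have test0: "(LINT x|lebesgue. \<phi> x * g0 x) = 0" if "\<phi> \<in> test_functions D" for \<phi>
  proof -
    have "0 = (LINT x|lebesgue_on D. g x * \<phi> x)"
      using 0[OF that] by (simp add: l2_inner_def)
    also have "\<dots> = (LINT x|lebesgue. indicator D x *\<^sub>R (g x * \<phi> x))"
      by (rule integral_restrict_space) auto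
    finally show ?thesis by (simp add: g0_def mult_ac)
  qed
  \<comment> \<open>Square integrability gives integrability on a bounded box through |t| <= 1 +
    t^2.\<close>
  have boxi: "integrable lebesgue (\<lambda>x. indicator (box l u) x * g0 x)" for l u
  proof (rule Bochner_Integration.integrable_bound)
    show "integrable lebesgue (\<lambda>x. indicator (box l u) x + (g0 x)\<^sup>2)"
      by (intro Bochner_Integration.integrable_add sq) (use emeasure_lborel_box_finite[of l u] in \<open>simp add: integrable_completion integrable_indicator_iff\<close>)
    have "\<bar>t\<bar> \<le> 1 + t\<^sup>2" for t :: real
      using sum_squares_bound[of 1 "\<bar>t\<bar>"] by simp
    then show "AE x in lebesgue. norm (indicator (box l u) x * g0 x) \<le> norm (indicator (box l u) x + (g0 x)\<^sup>2)"
      by (intro AE_I2) (auto simp: indicator_def)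
    show "(\<lambda>x. indicator (box l u) x * g0 x) \<in> borel_measurable lebesgue"
      by (intro borel_measurable_times borel_measurable_indicator g0m) auto
  qed
  have box0: "(LINT x|lebesgue. indicator (box l u) x * g0 x) = 0" if "cbox l u \<subseteq> D" for l u
  proof -
    have "(\<lambda>n. LINT x|lebesgue. box_bump l u n x * g0 x) \<longlonglongrightarrow> (LINT x|lebesgue. indicator (box l u) x * g0 x)"
    proof (rule integral_dominated_convergence[where w = "\<lambda>x. norm (indicator (box l u) x * g0 x)"])
      show "(\<lambda>x. indicator (box l u) x * g0 x) \<in> borel_measurable lebesgue"
        by (intro borel_measurable_times borel_measurable_indicator g0m) auto
      show "integrable lebesgue (\<lambda>x. norm (indicator (box l u) x * g0 x))"
        by (intro integrable_norm boxi)
      show "(\<lambda>x. box_bump l u n x * g0 x) \<in> borel_measurable lebesgue" for n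
        using test_functions_borel[OF box_bump_test[OF that, of n]] measurable_completion[of _ lborel borel]
        by (intro borel_measurable_times g0m) simp
      show "AE x in lebesgue. (\<lambda>n. box_bump l u n x * g0 x) \<longlonglongrightarrow> indicator (box l u) x * g0 x"
        by (intro AE_I2 tendsto_intros box_bump_tendsto)
      show "AE x in lebesgue. norm (box_bump l u n x * g0 x) \<le> norm (indicator (box l u) x * g0 x)" for n
      proof (rule AE_I2)
        fix x
        have "\<bar>box_bump l u n x\<bar> \<le> indicator (box l u) x"
          using box_bump_bounds[of l u n x] box_bump_eq_0[of l u n x] by (auto simp: indicator_def)
        then show "norm (box_bump l u n x * g0 x) \<le> norm (indicator (box l u) x * g0 x)"
          by (simp add: abs_mult mult_right_mono)
      qed
    qed
    then show ?thesis
      by (simp only: test0[OF box_bump_test[OF that]] LIMSEQ_const_iff)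
  qed
  have local: "AE x in lebesgue. x \<in> cbox l u \<longrightarrow> g0 x = 0" if sub: "cbox l u \<subseteq> D" for l u
  proof -
    have "AE x in lebesgue. indicator (box l u) x * g0 x = 0"
    proof (rule AE_zero_if_integral_boxes_zero[OF boxi])
      fix l' u' :: "real^3"
      obtain a b where ab: "box l' u' \<inter> box l u = box a b"
        by (rule that) (rule box_Int_box)
      have eq: "indicator (box l' u') x * (indicator (box l u) x * g0 x) = indicator (box a b) x * g0 x" for x
        unfolding ab[symmetric] by (auto simp: indicator_def)
      show "(LINT x|lebesgue. indicator (box l' u') x * (indicator (box l u) x * g0 x)) = 0"
      proof (cases "box a b = {}")
        case True
        then show ?thesis unfolding eq by simp
      next
        case False
        \<comment> \<open>The endpoints are known only through the set \<open>box a b\<close>; it is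
          nonemptiness that makes \<open>cbox a b\<close> its closure and so confines it to
          \<open>D\<close>.\<close>
        then have "cbox a b = closure (box a b)" by simp
        also have "\<dots> \<subseteq> cbox l u"
          using ab box_subset_cbox[of l u] by (intro closure_minimal) auto
        finally show ?thesis unfolding eq using box0[of a b] sub by auto
      qed
    qed
    \<comment> \<open>The previous step controls only the open box; the faces form a null
      set.\<close>
    moreover have "AE x in lebesgue. x \<notin> cbox l u - box l u"
      using negligible_frontier_interval[of l u]
      by (intro AE_not_in) (simp add: negligible_iff_null_sets)
    ultimately show ?thesis
      by (rule eventually_elim2) (auto simp: indicator_def split: if_splits)
  qed
  obtain \<C> where \<C>: "countable \<C>" "\<C> \<subseteq> Pow D" "\<And>X. X \<in> \<C> \<Longrightarrow> \<exists>a b. X = cbox a b" "\<Union>\<C> = D"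
    using open_countable_Union_open_cbox[OF D] by metis
  have "AE x in lebesgue. \<forall>X\<in>\<C>. x \<in> X \<longrightarrow> g0 x = 0"
    unfolding AE_ball_countable[OF \<C>(1)] using \<C>(2,3) local by blast
  then have "AE x in lebesgue. x \<in> D \<longrightarrow> g x = 0"
    by (rule eventually_mono) (use \<C>(4) in \<open>auto simp: g0_def indicator_def split: if_splits\<close>)
  then show ?thesis
    unfolding ae_eq_def by (subst AE_restrict_space_iff) auto
qed

section \<open>Integration by parts and the Ladyzhenskaya inequality\<close>

lemma smooth_line_derivative:
  assumes "smooth \<phi>"
  shows "((\<lambda>t. \<phi> (x + t *\<^sub>R axis j 1)) has_real_derivative pd j \<phi> (x + t *\<^sub>R axis j 1)) (at t)"
proof -
  let ?e = "axis j 1 :: real^3" and ?p = "x + t *\<^sub>R axis j 1"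
  have d: "(\<phi> has_derivative frechet_derivative \<phi> (at ?p)) (at ?p)"
    using smooth_differentiable[OF assms] frechet_derivative_works by blast
  have "((\<lambda>t. x + t *\<^sub>R ?e) has_derivative (\<lambda>h. h *\<^sub>R ?e)) (at t)"
    by (auto intro!: derivative_eq_intros)
  from has_derivative_compose[OF this d]
  have "((\<lambda>t. \<phi> (x + t *\<^sub>R ?e)) has_derivative (\<lambda>h. frechet_derivative \<phi> (at ?p) (h *\<^sub>R ?e))) (at t)" .
  moreover have "frechet_derivative \<phi> (at ?p) (h *\<^sub>R ?e) = pd j \<phi> ?p * h" for h
    using linear_scale[OF has_derivative_linear[OF d]] by (simp add: pd_def)
  ultimately show ?thesis by (simp add: has_field_derivative_def)
qed

lemma test_functions_support_ball:
  assumes "\<phi> \<in> test_functions D"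
  obtains R where "R > 0" "\<And>x. norm x > R \<Longrightarrow> \<phi> x = 0"
proof -
  have "bounded (closure {x. \<phi> x \<noteq> 0})"
    using assms by (intro compact_imp_bounded) (simp add: test_functions_iff)
  then obtain R where R: "R > 0" "\<And>x. x \<in> closure {x. \<phi> x \<noteq> 0} \<Longrightarrow> norm x \<le> R"
    by (auto simp: bounded_pos)
  have "\<phi> x = 0" if "norm x > R" for x
    using R(2)[of x] zero_outside_support[of x \<phi>] that by auto
  with R(1) show ?thesis by (rule that)
qed

text \<open>Difference quotients of \<phi> have integral zero by translation invariance. The mean
  value theorem bounds them by the supremum of the derivative on a fixed ball, so dominated
  convergence passes to the derivative.\<close>

lemma integral_pd_eq_0:
  assumes \<phi>: "\<phi> \<in> test_functions D"
  shows "(LINT x|lborel. pd j \<phi> x) = 0"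
proof -
  let ?e = "axis j 1 :: real^3"
  define s where "s n = inverse (real (Suc n))" for n
  have s: "0 < s n" "s n \<le> 1" for n by (auto simp: s_def field_simps)
  define q where "q n x = (\<phi> (s n *\<^sub>R ?e + x) - \<phi> x) / s n" for n x
  have [measurable]: "\<phi> \<in> borel_measurable borel" "pd j \<phi> \<in> borel_measurable borel"
    using \<phi> test_functions_pd[OF \<phi>] by (auto intro: test_functions_borel)
  obtain B where B: "\<And>x. \<bar>pd j \<phi> x\<bar> \<le> B"
    using test_functions_bounded[OF test_functions_pd[OF \<phi>, of j]] by metis
  obtain R where R: "\<And>x. norm x > R \<Longrightarrow> \<phi> x = 0"
    using test_functions_support_ball[OF \<phi>] by metis
  \<comment> \<open>The steps \<open>s n\<close> are at most 1, so outside radius R + 1 both points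
    of the quotient lie where \<phi> vanishes.\<close>
  let ?K = "cball (0::real^3) (R + 1)"
  have "(\<lambda>n. integral\<^sup>L lborel (q n)) \<longlonglongrightarrow> integral\<^sup>L lborel (pd j \<phi>)"
  proof (rule integral_dominated_convergence[where w = "\<lambda>x. B * indicator ?K x"])
    show "integrable lborel (\<lambda>x. B * indicator ?K x)"
      using emeasure_bounded_finite[of ?K] by (simp add: integrable_indicator_iff)
    show "q n \<in> borel_measurable lborel" for n unfolding q_def by measurable
    show "AE x in lborel. (\<lambda>n. q n x) \<longlonglongrightarrow> pd j \<phi> x"
    proof (rule AE_I2)
      fix x
      have "((\<lambda>h. (\<phi> (x + (0 + h) *\<^sub>R ?e) - \<phi> (x + 0 *\<^sub>R ?e)) / h) \<longlongrightarrow> pd j \<phi> (x + 0 *\<^sub>R ?e)) (at 0)"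
        using smooth_line_derivative[OF test_functions_smooth[OF \<phi>], of x j 0] by (simp add: DERIV_def)
      moreover have "filterlim s (at 0) sequentially"
        unfolding s_def by (intro filterlim_atI LIMSEQ_inverse_real_of_nat) auto
      ultimately show "(\<lambda>n. q n x) \<longlonglongrightarrow> pd j \<phi> x"
        unfolding q_def by (auto dest: filterlim_compose simp: add.commute)
    qed
    show "AE x in lborel. norm (q n x) \<le> B * indicator ?K x" for n
    proof (rule AE_I2)
      fix x
      show "norm (q n x) \<le> B * indicator ?K x"
      proof (cases "x \<in> ?K")
        case True
        obtain z where "\<phi> (x + s n *\<^sub>R ?e) - \<phi> (x + 0 *\<^sub>R ?e) = (s n - 0) * pd j \<phi> (x + z *\<^sub>R ?e)"
          using MVT2[OF s(1)[of n], of "\<lambda>t. \<phi> (x + t *\<^sub>R ?e)" "\<lambda>t. pd j \<phi> (x + t *\<^sub>R ?e)"]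
            smooth_line_derivative[OF test_functions_smooth[OF \<phi>]] by blast
        then have "q n x = pd j \<phi> (x + z *\<^sub>R ?e)"
          using s(1)[of n] by (simp add: q_def add.commute)
        then show ?thesis using True B by simp
      next
        case False
        then have "norm x > R + 1" by simp
        moreover have "norm x \<le> norm (s n *\<^sub>R ?e + x) + norm (s n *\<^sub>R ?e)"
          using norm_triangle_ineq4[of "s n *\<^sub>R ?e + x" "s n *\<^sub>R ?e"] by simp
        moreover have "norm (s n *\<^sub>R ?e) \<le> 1" using s[of n] by simp
        ultimately have "\<phi> x = 0" "\<phi> (s n *\<^sub>R ?e + x) = 0" by (auto intro!: R)
        then show ?thesis using False by (simp add: q_def)
      qed
    qed
  qed measurable
  moreover have "integral\<^sup>L lborel (q n) = 0" for n
  proof -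
    have i: "integrable lborel \<phi>" by (rule test_functions_integrable[OF \<phi>])
    have "integrable (distr lborel borel ((+) (s n *\<^sub>R ?e))) \<phi>"
      using i by (simp add: lborel_distr_plus)
    then have i': "integrable lborel (\<lambda>x. \<phi> (s n *\<^sub>R ?e + x))"
      by (subst (asm) integrable_distr_eq) auto
    have "integral\<^sup>L lborel \<phi> = integral\<^sup>L (distr lborel borel ((+) (s n *\<^sub>R ?e))) \<phi>"
      by (simp add: lborel_distr_plus)
    also have "\<dots> = (LINT x|lborel. \<phi> (s n *\<^sub>R ?e + x))"
      by (rule integral_distr) auto
    finally show ?thesis using i i' by (simp add: q_def[abs_def])
  qed
  ultimately show ?thesis by (simp add: LIMSEQ_const_iff)
qed

lemma test_integration_by_parts:
  assumes \<phi>: "\<phi> \<in> test_functions D" and \<psi>: "smooth \<psi>" and D: "D \<in> sets lebesgue"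
  shows "l2_inner D \<phi> (pd j \<psi>) = - l2_inner D (pd j \<phi>) \<psi>"
proof -
  have t: "(\<lambda>x. \<phi> x * \<psi> x) \<in> test_functions D" "(\<lambda>x. \<phi> x * pd j \<psi> x) \<in> test_functions D"
    "(\<lambda>x. pd j \<phi> x * \<psi> x) \<in> test_functions D"
    by (intro test_functions_mult \<phi> \<psi> test_functions_pd smooth_pd)+
  have e: "l2_inner D f g = (LINT x|lborel. f x * g x)"
    if "(\<lambda>x. f x * g x) \<in> test_functions D" for f g :: "real^3 \<Rightarrow> real"
    unfolding l2_inner_def inner_real_def
    by (rule lebesgue_on_integral_support[OF D])
      (use that test_functions_support[OF that] in \<open>auto intro: test_functions_borel\<close>)
  have "0 = (LINT x|lborel. pd j (\<lambda>x. \<phi> x * \<psi> x) x)"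
    using integral_pd_eq_0[OF t(1)] by simp
  also have "\<dots> = (LINT x|lborel. \<phi> x * pd j \<psi> x + pd j \<phi> x * \<psi> x)"
    using smooth_differentiable[OF test_functions_smooth[OF \<phi>]] smooth_differentiable[OF \<psi>]
    by (simp add: pd_mult)
  also have "\<dots> = l2_inner D \<phi> (pd j \<psi>) + l2_inner D (pd j \<phi>) \<psi>"
    by (simp add: e t test_functions_integrable[OF t(2)] test_functions_integrable[OF t(3)])
  finally show ?thesis by simp
qed

section \<open>Ladyzhenskaya's inequality for test functions\<close>

lemma ennreal_two_mult_le: "2 * (a * b) \<le> a\<^sup>2 + b\<^sup>2" for a b :: ennreal
proof (cases "a = top \<or> b = top")
  case True
  then show ?thesis by (auto simp: power2_eq_square ennreal_mult_top ennreal_top_mult)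
next
  case False
  then obtain x y where "a = ennreal x" "b = ennreal y" "x \<ge> 0" "y \<ge> 0"
    by (metis ennreal_cases)
  moreover have "2 * (x * y) \<le> x\<^sup>2 + y\<^sup>2" using sum_squares_bound[of x y] by simp
  ultimately show ?thesis
    by (simp add: power2_eq_square ennreal_leI flip: ennreal_mult ennreal_plus ennreal_numeral)
qed

text \<open>Ladyzhenskaya's argument: bounding \<open>f\<^sup>4\<close> by the product of the line integrals in the second
  and the third direction, for a fixed first coordinate, leaves a product of two planar integrals;
  the line integral in the first direction bounds the planar integral of \<open>f\<^sup>2\<close> uniformly.\<close>

lemma nn_integral_ladyzhenskaya:
  fixes f g1 g2 g3 :: "real \<times> real \<times> real \<Rightarrow> ennreal"
  assumes [measurable]: "f \<in> borel_measurable (lborel \<Otimes>\<^sub>M lborel \<Otimes>\<^sub>M lborel)"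
      "g1 \<in> borel_measurable (lborel \<Otimes>\<^sub>M lborel \<Otimes>\<^sub>M lborel)"
      "g2 \<in> borel_measurable (lborel \<Otimes>\<^sub>M lborel \<Otimes>\<^sub>M lborel)"
      "g3 \<in> borel_measurable (lborel \<Otimes>\<^sub>M lborel \<Otimes>\<^sub>M lborel)"
    and 1: "\<And>a b c. (f (a, b, c))\<^sup>2 \<le> (\<integral>\<^sup>+s. 2 * (f (s, b, c) * g1 (s, b, c)) \<partial>lborel)"
    and 2: "\<And>a b c. (f (a, b, c))\<^sup>2 \<le> (\<integral>\<^sup>+s. 2 * (f (a, s, c) * g2 (a, s, c)) \<partial>lborel)"
    and 3: "\<And>a b c. (f (a, b, c))\<^sup>2 \<le> (\<integral>\<^sup>+s. 2 * (f (a, b, s) * g3 (a, b, s)) \<partial>lborel)"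
  defines "I \<equiv> \<lambda>h. (\<integral>\<^sup>+a. \<integral>\<^sup>+b. \<integral>\<^sup>+c. h (a, b, c) \<partial>lborel \<partial>lborel \<partial>lborel) :: ennreal"
  shows "2 * I (\<lambda>p. (f p)^4) \<le> 4 * I (\<lambda>p. 2 * (f p * g1 p)) * (I (\<lambda>p. (g2 p)\<^sup>2) + I (\<lambda>p. (g3 p)\<^sup>2))"
proof -
  let ?S = "I (\<lambda>p. 2 * (f p * g1 p))"
  define F where "F h a = (\<integral>\<^sup>+b. \<integral>\<^sup>+c. h (a, b, c) \<partial>lborel \<partial>lborel)" for h :: "real \<times> real \<times> real \<Rightarrow> ennreal" and a
  have F_meas [measurable]: "F h \<in> borel_measurable lborel"
    if [measurable]: "h \<in> borel_measurable (lborel \<Otimes>\<^sub>M lborel \<Otimes>\<^sub>M lborel)" for h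
    unfolding F_def by measurable
  have I_F: "I h = (\<integral>\<^sup>+a. F h a \<partial>lborel)" for h
    by (simp add: I_def F_def)
  have FS: "F (\<lambda>p. (f p)\<^sup>2) a \<le> ?S" for a
  proof -
    have "F (\<lambda>p. (f p)\<^sup>2) a \<le> (\<integral>\<^sup>+b. \<integral>\<^sup>+c. \<integral>\<^sup>+s. 2 * (f (s, b, c) * g1 (s, b, c)) \<partial>lborel \<partial>lborel \<partial>lborel)"
      unfolding F_def by (intro nn_integral_mono 1)
    also have "\<dots> = (\<integral>\<^sup>+b. \<integral>\<^sup>+s. \<integral>\<^sup>+c. 2 * (f (s, b, c) * g1 (s, b, c)) \<partial>lborel \<partial>lborel \<partial>lborel)"
      by (intro nn_integral_cong lborel_pair.Fubini') measurable
    also have "\<dots> = ?S"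
      unfolding I_def by (intro lborel_pair.Fubini') measurable
    finally show ?thesis .
  qed
  have CS: "(F (\<lambda>p. 2 * (f p * g p)) a)\<^sup>2 \<le> 4 * (?S * F (\<lambda>p. (g p)\<^sup>2) a)"
    if [measurable]: "g \<in> borel_measurable (lborel \<Otimes>\<^sub>M lborel \<Otimes>\<^sub>M lborel)" for g a
  proof -
    have F_pair: "F h a = (\<integral>\<^sup>+p. h (a, p) \<partial>(lborel \<Otimes>\<^sub>M lborel))"
      if [measurable]: "h \<in> borel_measurable (lborel \<Otimes>\<^sub>M lborel \<Otimes>\<^sub>M lborel)" for h
      unfolding F_def by (rule lborel.nn_integral_fst[of "\<lambda>p. h (a, p)"]) measurable
    have "F (\<lambda>p. 2 * (f p * g p)) a = 2 * (\<integral>\<^sup>+p. f (a, p) * g (a, p) \<partial>(lborel \<Otimes>\<^sub>M lborel))"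
      by (subst F_pair, measurable) (rule nn_integral_cmult, measurable)
    then have "(F (\<lambda>p. 2 * (f p * g p)) a)\<^sup>2 = 4 * (\<integral>\<^sup>+p. f (a, p) * g (a, p) \<partial>(lborel \<Otimes>\<^sub>M lborel))\<^sup>2"
      by (simp add: power_mult_distrib)
    also have "\<dots> \<le> 4 * ((\<integral>\<^sup>+p. (f (a, p))\<^sup>2 \<partial>(lborel \<Otimes>\<^sub>M lborel)) * (\<integral>\<^sup>+p. (g (a, p))\<^sup>2 \<partial>(lborel \<Otimes>\<^sub>M lborel)))"
    proof (rule mult_left_mono)
      show "(\<integral>\<^sup>+p. f (a, p) * g (a, p) \<partial>(lborel \<Otimes>\<^sub>M lborel))\<^sup>2 \<le>
          (\<integral>\<^sup>+p. (f (a, p))\<^sup>2 \<partial>(lborel \<Otimes>\<^sub>M lborel)) * (\<integral>\<^sup>+p. (g (a, p))\<^sup>2 \<partial>(lborel \<Otimes>\<^sub>M lborel))"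
        by (rule Cauchy_Schwarz_nn_integral) measurable
    qed simp
    also have "\<dots> = 4 * (F (\<lambda>p. (f p)\<^sup>2) a * F (\<lambda>p. (g p)\<^sup>2) a)"
      by (subst (1 2) F_pair) auto
    also have "\<dots> \<le> 4 * (?S * F (\<lambda>p. (g p)\<^sup>2) a)"
      by (intro mult_left_mono mult_right_mono FS) auto
    finally show ?thesis .
  qed
  let ?Y = "F (\<lambda>p. 2 * (f p * g2 p))" and ?Z = "F (\<lambda>p. 2 * (f p * g3 p))"
  have "F (\<lambda>p. (f p)^4) a \<le> ?Y a * ?Z a" for a
  proof -
    let ?y = "\<lambda>c. \<integral>\<^sup>+s. 2 * (f (a, s, c) * g2 (a, s, c)) \<partial>lborel"
    let ?z = "\<lambda>b. \<integral>\<^sup>+s. 2 * (f (a, b, s) * g3 (a, b, s)) \<partial>lborel"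
    have "F (\<lambda>p. (f p)^4) a \<le> (\<integral>\<^sup>+b. \<integral>\<^sup>+c. ?z b * ?y c \<partial>lborel \<partial>lborel)"
      unfolding F_def
    proof (intro nn_integral_mono)
      fix b c
      have "(f (a, b, c))^4 = (f (a, b, c))\<^sup>2 * (f (a, b, c))\<^sup>2"
        by (simp add: power2_eq_square power4_eq_xxxx mult.assoc)
      also have "\<dots> \<le> ?z b * ?y c"
        by (intro mult_mono 2 3) auto
      finally show "(f (a, b, c))^4 \<le> ?z b * ?y c" .
    qed
    also have "\<dots> = (\<integral>\<^sup>+b. ?z b * (\<integral>\<^sup>+c. ?y c \<partial>lborel) \<partial>lborel)"
      by (intro nn_integral_cong nn_integral_cmult) measurable
    also have "\<dots> = (\<integral>\<^sup>+b. ?z b \<partial>lborel) * (\<integral>\<^sup>+c. ?y c \<partial>lborel)"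
      by (rule nn_integral_multc) measurable
    also have "(\<integral>\<^sup>+c. ?y c \<partial>lborel) = ?Y a"
      unfolding F_def by (rule lborel_pair.Fubini') measurable
    finally show ?thesis by (simp add: F_def mult.commute)
  qed
  \<comment> \<open>The factor 2 is kept on the left so that 2YZ <= Y^2 + Z^2 applies directly to
    the two planar integrals; planar Cauchy-Schwarz then bounds each square.\<close>
  then have "2 * I (\<lambda>p. (f p)^4) \<le> 2 * (\<integral>\<^sup>+a. ?Y a * ?Z a \<partial>lborel)"
    unfolding I_F by (intro mult_left_mono nn_integral_mono) auto
  also have "\<dots> = (\<integral>\<^sup>+a. 2 * (?Y a * ?Z a) \<partial>lborel)"
    by (rule nn_integral_cmult[symmetric]) measurable
  also have "\<dots> \<le> (\<integral>\<^sup>+a. 4 * ?S * (F (\<lambda>p. (g2 p)\<^sup>2) a + F (\<lambda>p. (g3 p)\<^sup>2) a) \<partial>lborel)"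
  proof (intro nn_integral_mono)
    fix a
    have "2 * (?Y a * ?Z a) \<le> (?Y a)\<^sup>2 + (?Z a)\<^sup>2"
      by (rule ennreal_two_mult_le)
    also have "\<dots> \<le> 4 * (?S * F (\<lambda>p. (g2 p)\<^sup>2) a) + 4 * (?S * F (\<lambda>p. (g3 p)\<^sup>2) a)"
      by (intro add_mono CS) measurable
    finally show "2 * (?Y a * ?Z a) \<le> 4 * ?S * (F (\<lambda>p. (g2 p)\<^sup>2) a + F (\<lambda>p. (g3 p)\<^sup>2) a)"
      by (simp add: distrib_left mult.assoc)
  qed
  also have "\<dots> = 4 * ?S * (\<integral>\<^sup>+a. F (\<lambda>p. (g2 p)\<^sup>2) a + F (\<lambda>p. (g3 p)\<^sup>2) a \<partial>lborel)"
    by (rule nn_integral_cmult) measurable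
  also have "(\<integral>\<^sup>+a. F (\<lambda>p. (g2 p)\<^sup>2) a + F (\<lambda>p. (g3 p)\<^sup>2) a \<partial>lborel) = I (\<lambda>p. (g2 p)\<^sup>2) + I (\<lambda>p. (g3 p)\<^sup>2)"
    unfolding I_F by (rule nn_integral_add) measurable
  finally show ?thesis .
qed

definition point3 :: "real \<times> real \<times> real \<Rightarrow> real^3" where
  "point3 p = fst p *\<^sub>R axis 1 1 + fst (snd p) *\<^sub>R axis 2 1 + snd (snd p) *\<^sub>R axis 3 1"

lemma point3_nth: "point3 (a, b, c) $ 1 = a" "point3 (a, b, c) $ 2 = b" "point3 (a, b, c) $ 3 = c"
  by (auto simp: point3_def axis_def)

lemma point3_measurable [measurable]: "point3 \<in> borel_measurable (lborel \<Otimes>\<^sub>M lborel \<Otimes>\<^sub>M lborel)"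
  unfolding point3_def by measurable

lemma prod_Basis_real3: "(\<Prod>b\<in>(Basis :: (real^3) set). x \<bullet> b) = x $ 1 * x $ 2 * x $ 3"
proof -
  have "(Basis :: (real^3) set) = (\<lambda>i. axis i 1) ` UNIV"
    by (auto simp: Basis_vec_def)
  then have "(\<Prod>b\<in>(Basis :: (real^3) set). x \<bullet> b) = prod (\<lambda>b. x \<bullet> b) ((\<lambda>i. axis i 1) ` UNIV)"
    by (simp only:)
  also have "\<dots> = (\<Prod>i\<in>UNIV. x \<bullet> axis i 1)"
    by (subst prod.reindex) (auto simp: inj_on_def axis_eq_axis)
  finally show ?thesis unfolding UNIV_3 by (simp add: inner_axis mult.assoc)
qed

text \<open>Lebesgue measure is determined by the volumes of boxes, and \<open>point3\<close> pulls
  a box back to a product of three intervals. This opens the way to integrating one coordinate at a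
  time.\<close>

lemma lborel_real3: "lborel = distr (lborel \<Otimes>\<^sub>M lborel \<Otimes>\<^sub>M lborel) borel point3"
proof (rule lborel_eqI)
  fix l u :: "real^3"
  assume "\<And>b. b \<in> Basis \<Longrightarrow> l \<bullet> b \<le> u \<bullet> b"
  from this[of "axis i 1" for i] have le: "l $ i \<le> u $ i" for i
    by (simp add: inner_axis)
  have "point3 -` box l u \<inter> space (lborel \<Otimes>\<^sub>M lborel \<Otimes>\<^sub>M lborel)
      = box (l $ 1) (u $ 1) \<times> box (l $ 2) (u $ 2) \<times> box (l $ 3) (u $ 3)"
    by (auto simp: space_pair_measure mem_box_cart forall_3 point3_nth)
  then have "emeasure (distr (lborel \<Otimes>\<^sub>M lborel \<Otimes>\<^sub>M lborel) borel point3) (box l u)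
      = emeasure (lborel \<Otimes>\<^sub>M lborel \<Otimes>\<^sub>M lborel) (box (l $ 1) (u $ 1) \<times> box (l $ 2) (u $ 2) \<times> box (l $ 3) (u $ 3))"
    by (simp add: emeasure_distr)
  also have "\<dots> = emeasure lborel (box (l $ 1) (u $ 1)) * (emeasure lborel (box (l $ 2) (u $ 2)) * emeasure lborel (box (l $ 3) (u $ 3)))"
    by (subst lborel_pair.P.emeasure_pair_measure_Times, simp, simp,
        subst lborel.emeasure_pair_measure_Times, simp_all)
  also have "\<dots> = ennreal ((u - l) $ 1 * (u - l) $ 2 * (u - l) $ 3)"
    using le by (simp add: ennreal_mult' mult.assoc)
  finally show "emeasure (distr (lborel \<Otimes>\<^sub>M lborel \<Otimes>\<^sub>M lborel) borel point3) (box l u)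
      = ennreal (\<Prod>b\<in>Basis. (u - l) \<bullet> b)"
    by (simp add: prod_Basis_real3)
qed simp

lemma nn_integral_real3:
  assumes [measurable]: "h \<in> borel_measurable borel"
  shows "(\<integral>\<^sup>+x. h x \<partial>lborel) = (\<integral>\<^sup>+a. \<integral>\<^sup>+b. \<integral>\<^sup>+c. h (point3 (a, b, c)) \<partial>lborel \<partial>lborel \<partial>lborel)"
proof -
  have "(\<integral>\<^sup>+x. h x \<partial>lborel) = (\<integral>\<^sup>+p. h (point3 p) \<partial>(lborel \<Otimes>\<^sub>M lborel \<Otimes>\<^sub>M lborel))"
    by (subst lborel_real3, rule nn_integral_distr) auto
  also have "\<dots> = (\<integral>\<^sup>+a. \<integral>\<^sup>+q. h (point3 (a, q)) \<partial>(lborel \<Otimes>\<^sub>M lborel) \<partial>lborel)"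
    by (rule lborel_pair.P.nn_integral_fst[symmetric]) measurable
  also have "\<dots> = (\<integral>\<^sup>+a. \<integral>\<^sup>+b. \<integral>\<^sup>+c. h (point3 (a, b, c)) \<partial>lborel \<partial>lborel \<partial>lborel)"
    by (intro nn_integral_cong lborel.nn_integral_fst[symmetric]) measurable
  finally show ?thesis .
qed

text \<open>The fundamental theorem of calculus for g^2, whose derivative is 2 g g', on [L, a];
  absolute values then allow the integral to be extended to the whole line.\<close>

lemma power2_le_line_integral:
  fixes g g' :: "real \<Rightarrow> real"
  assumes d: "\<And>t. (g has_real_derivative g' t) (at t)" and c: "continuous_on UNIV g'"
    and z: "L \<le> a" "g L = 0"
  shows "ennreal ((g a)\<^sup>2) \<le> (\<integral>\<^sup>+s. ennreal (2 * (\<bar>g s\<bar> * \<bar>g' s\<bar>)) \<partial>lborel)"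
proof -
  have cg: "isCont g t" for t using d by (rule DERIV_isCont)
  have cg': "isCont g' t" for t using c by (simp add: continuous_on_eq_continuous_at)
  let ?h = "\<lambda>s. (2 * (g s * g' s)) * indicator {L..a} s"
  have hb: "has_bochner_integral lborel ?h ((g a)\<^sup>2 - (g L)\<^sup>2)"
  proof (rule has_bochner_integral_FTC_Icc_real[OF z(1)])
    show "((\<lambda>s. (g s)\<^sup>2) has_real_derivative 2 * (g x * g' x)) (at x)" for x
      by (auto intro!: derivative_eq_intros d)
    show "isCont (\<lambda>s. 2 * (g s * g' s)) x" for x
      by (intro continuous_intros cg cg')
  qed
  then have "ennreal ((g a)\<^sup>2) = ennreal (norm (integral\<^sup>L lborel ?h))"
    using z(2) by (simp add: has_bochner_integral_integral_eq)
  also have "\<dots> \<le> (\<integral>\<^sup>+s. ennreal (norm (?h s)) \<partial>lborel)"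
    by (rule integral_norm_bound_ennreal) (use hb in \<open>auto simp: has_bochner_integral_iff\<close>)
  also have "\<dots> \<le> (\<integral>\<^sup>+s. ennreal (2 * (\<bar>g s\<bar> * \<bar>g' s\<bar>)) \<partial>lborel)"
    by (intro nn_integral_mono ennreal_leI) (auto simp: indicator_def abs_mult)
  finally show ?thesis .
qed

lemma test_power2_le_line_integral:
  assumes "\<phi> \<in> test_functions D"
  shows "ennreal ((\<phi> (x + a *\<^sub>R axis j 1))\<^sup>2) \<le>
    (\<integral>\<^sup>+s. ennreal (2 * (\<bar>\<phi> (x + s *\<^sub>R axis j 1)\<bar> * \<bar>pd j \<phi> (x + s *\<^sub>R axis j 1)\<bar>)) \<partial>lborel)"
proof -
  let ?e = "axis j 1 :: real^3"
  have sm: "smooth \<phi>" "smooth (pd j \<phi>)"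
    using assms by (auto intro: test_functions_smooth smooth_pd)
  obtain R where R: "R > 0" "\<And>x. norm x > R \<Longrightarrow> \<phi> x = 0"
    using test_functions_support_ball[OF assms] by metis
  \<comment> \<open>Since |L| >= R + norm x + 1, the point at parameter L has norm above R, where
    \<phi> vanishes; the minimum with \<open>a\<close> secures L <= a.\<close>
  define L where "L = min a (- (R + norm x + 1))"
  have "R < norm (x + L *\<^sub>R ?e)"
    using norm_triangle_ineq4[of "x + L *\<^sub>R ?e" x] R(1) norm_ge_zero[of x]
    by (auto simp: L_def min_def split: if_splits)
  then have "\<phi> (x + L *\<^sub>R ?e) = 0" by (rule R(2))
  then show ?thesis
    by (intro power2_le_line_integral[where L = L] smooth_line_derivative sm)
      (auto simp: L_def intro!: continuous_intros continuous_on_compose2[OF smooth_continuous[OF sm(2)], of UNIV])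
qed

lemma L2_abs:
  fixes f :: "real^3 \<Rightarrow> real"
  assumes "f \<in> L2 D"
  shows "(\<lambda>x. \<bar>f x\<bar>) \<in> L2 D" "l2_norm D (\<lambda>x. \<bar>f x\<bar>) = l2_norm D f"
  using assms by (auto simp: L2_def l2_norm_def l2_inner_def)

text \<open>Everything happens on the whole space for the extension by zero, so the constant carries
  no trace of \<open>D\<close>. Cauchy-Schwarz bounds the integral of \<bar>\<phi> pd 1 \<phi>\<bar>
  by a product of norms, and the 4 is half of 4 * 2.\<close>

lemma test_functions_ladyzhenskaya:
  assumes \<phi>: "\<phi> \<in> test_functions D" and D: "D \<in> sets lebesgue"
  shows "(\<integral>\<^sup>+x. ennreal ((\<phi> x)^4) \<partial>lebesgue_on D) \<le>
    ennreal (4 * l2_norm D \<phi> * l2_norm D (pd 1 \<phi>) * ((l2_norm D (pd 2 \<phi>))\<^sup>2 + (l2_norm D (pd 3 \<phi>))\<^sup>2))"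
proof -
  have t: "pd j \<phi> \<in> test_functions D" for j using \<phi> by (rule test_functions_pd)
  have [measurable]: "\<phi> \<in> borel_measurable borel" "pd j \<phi> \<in> borel_measurable borel" for j
    using \<phi> t by (auto intro: test_functions_borel)
  have L2: "\<phi> \<in> L2 D" "pd j \<phi> \<in> L2 D" for j
    using \<phi> t D by (auto intro: test_functions_L2)
  have lb: "(\<integral>\<^sup>+x. h x \<partial>lborel) = (\<integral>\<^sup>+x. h x \<partial>lebesgue_on D)" if "\<And>x. x \<notin> D \<Longrightarrow> h x = 0" for h :: "real^3 \<Rightarrow> ennreal"
  proof -
    have "(\<integral>\<^sup>+x. h x \<partial>lebesgue_on D) = (\<integral>\<^sup>+x. h x * indicator D x \<partial>lebesgue)"
      by (rule nn_integral_restrict_space) (use D in auto)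
    also have "\<dots> = (\<integral>\<^sup>+x. h x \<partial>lebesgue)"
      using that by (intro nn_integral_cong) (auto simp: indicator_def)
    finally show ?thesis by (simp add: nn_integral_completion)
  qed
  define f where "f p = ennreal \<bar>\<phi> (point3 p)\<bar>" for p
  define g where "g j p = ennreal \<bar>pd j \<phi> (point3 p)\<bar>" for j p
  \<comment> \<open>Each coordinate line is written as a base point plus a multiple of its
    direction, the form in which \<open>test_power2_le_line_integral\<close> bounds the
    square.\<close>
  have line: "point3 (s, b, c) = point3 (0, b, c) + s *\<^sub>R axis 1 1"
    "point3 (a, s, c) = point3 (a, 0, c) + s *\<^sub>R axis 2 1"
    "point3 (a, b, s) = point3 (a, b, 0) + s *\<^sub>R axis 3 1" for a b c s
    by (simp_all add: point3_def)
  have fg: "2 * (f p * g j p) = ennreal (2 * (\<bar>\<phi> (point3 p)\<bar> * \<bar>pd j \<phi> (point3 p)\<bar>))"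
    "(f p)\<^sup>2 = ennreal ((\<phi> (point3 p))\<^sup>2)" "(f p)^4 = ennreal ((\<phi> (point3 p))^4)"
    "(g j p)\<^sup>2 = ennreal ((pd j \<phi> (point3 p))\<^sup>2)" for j p
    by (simp_all add: f_def g_def ennreal_mult ennreal_power)
  note ineq = nn_integral_ladyzhenskaya[of f "g 1" "g 2" "g 3", unfolded fg]
  have N: "(\<integral>\<^sup>+a. \<integral>\<^sup>+b. \<integral>\<^sup>+c. ennreal (h (point3 (a, b, c))) \<partial>lborel \<partial>lborel \<partial>lborel)
      = (\<integral>\<^sup>+x. ennreal (h x) \<partial>lebesgue_on D)"
    if [measurable]: "h \<in> borel_measurable borel" and "\<And>x. x \<notin> D \<Longrightarrow> h x = 0" for h :: "real^3 \<Rightarrow> real"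
    using nn_integral_real3[of "\<lambda>x. ennreal (h x)"] lb[of "\<lambda>x. ennreal (h x)"] that(2) by simp
  note supp = test_functions_support[OF \<phi>] test_functions_support[OF t]
  have "2 * (\<integral>\<^sup>+x. ennreal ((\<phi> x)^4) \<partial>lebesgue_on D) \<le>
    4 * (\<integral>\<^sup>+x. ennreal (2 * (\<bar>\<phi> x\<bar> * \<bar>pd 1 \<phi> x\<bar>)) \<partial>lebesgue_on D) *
      ((\<integral>\<^sup>+x. ennreal ((pd 2 \<phi> x)\<^sup>2) \<partial>lebesgue_on D) + (\<integral>\<^sup>+x. ennreal ((pd 3 \<phi> x)\<^sup>2) \<partial>lebesgue_on D))"
  proof (subst (1 2 3 4) N[symmetric])
    show "2 * (\<integral>\<^sup>+a. \<integral>\<^sup>+b. \<integral>\<^sup>+c. ennreal ((\<phi> (point3 (a, b, c)))^4) \<partial>lborel \<partial>lborel \<partial>lborel) \<le>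
      4 * (\<integral>\<^sup>+a. \<integral>\<^sup>+b. \<integral>\<^sup>+c. ennreal (2 * (\<bar>\<phi> (point3 (a, b, c))\<bar> * \<bar>pd 1 \<phi> (point3 (a, b, c))\<bar>)) \<partial>lborel \<partial>lborel \<partial>lborel) *
      ((\<integral>\<^sup>+a. \<integral>\<^sup>+b. \<integral>\<^sup>+c. ennreal ((pd 2 \<phi> (point3 (a, b, c)))\<^sup>2) \<partial>lborel \<partial>lborel \<partial>lborel)
       + (\<integral>\<^sup>+a. \<integral>\<^sup>+b. \<integral>\<^sup>+c. ennreal ((pd 3 \<phi> (point3 (a, b, c)))\<^sup>2) \<partial>lborel \<partial>lborel \<partial>lborel))"
    proof (rule ineq)
      show "f \<in> borel_measurable (lborel \<Otimes>\<^sub>M lborel \<Otimes>\<^sub>M lborel)"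
        "g 1 \<in> borel_measurable (lborel \<Otimes>\<^sub>M lborel \<Otimes>\<^sub>M lborel)"
        "g 2 \<in> borel_measurable (lborel \<Otimes>\<^sub>M lborel \<Otimes>\<^sub>M lborel)"
        "g 3 \<in> borel_measurable (lborel \<Otimes>\<^sub>M lborel \<Otimes>\<^sub>M lborel)"
        unfolding f_def g_def by measurable
    qed (subst line, subst (2 3) line, rule test_power2_le_line_integral[OF \<phi>])+
  qed (simp_all add: supp)
  also have "\<dots> = ennreal (4 * (2 * l2_inner D (\<lambda>x. \<bar>\<phi> x\<bar>) (\<lambda>x. \<bar>pd 1 \<phi> x\<bar>)) *
      ((l2_norm D (pd 2 \<phi>))\<^sup>2 + (l2_norm D (pd 3 \<phi>))\<^sup>2))"
  proof -
    have "(\<integral>\<^sup>+x. ennreal (2 * (\<bar>\<phi> x\<bar> * \<bar>pd 1 \<phi> x\<bar>)) \<partial>lebesgue_on D)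
        = ennreal (LINT x|lebesgue_on D. 2 * (\<bar>\<phi> x\<bar> * \<bar>pd 1 \<phi> x\<bar>))"
      using integrable_inner_L2[OF L2_abs(1)[OF L2(1)] L2_abs(1)[OF L2(2)[of 1]]]
      by (intro nn_integral_eq_integral) auto
    also have "(LINT x|lebesgue_on D. 2 * (\<bar>\<phi> x\<bar> * \<bar>pd 1 \<phi> x\<bar>)) = 2 * l2_inner D (\<lambda>x. \<bar>\<phi> x\<bar>) (\<lambda>x. \<bar>pd 1 \<phi> x\<bar>)"
      by (simp add: l2_inner_def)
    finally have 1: "(\<integral>\<^sup>+x. ennreal (2 * (\<bar>\<phi> x\<bar> * \<bar>pd 1 \<phi> x\<bar>)) \<partial>lebesgue_on D)
        = ennreal (2 * l2_inner D (\<lambda>x. \<bar>\<phi> x\<bar>) (\<lambda>x. \<bar>pd 1 \<phi> x\<bar>))" .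
    have 2: "(\<integral>\<^sup>+x. ennreal ((pd j \<phi> x)\<^sup>2) \<partial>lebesgue_on D) = ennreal ((l2_norm D (pd j \<phi>))\<^sup>2)" for j
      using nn_integral_norm_L2[OF L2(2)[of j]] by simp
    have 3: "0 \<le> l2_inner D (\<lambda>x. \<bar>\<phi> x\<bar>) (\<lambda>x. \<bar>pd 1 \<phi> x\<bar>)"
      unfolding l2_inner_def by (rule integral_nonneg_AE) simp
    show ?thesis
      unfolding 1 2 using 3
      by (simp add: ennreal_mult' flip: ennreal_plus)
  qed
  also have "\<dots> \<le> ennreal (4 * (2 * (l2_norm D \<phi> * l2_norm D (pd 1 \<phi>))) *
      ((l2_norm D (pd 2 \<phi>))\<^sup>2 + (l2_norm D (pd 3 \<phi>))\<^sup>2))"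
    using l2_Cauchy_Schwarz[OF L2_abs(1)[OF L2(1)] L2_abs(1)[OF L2(2)[of 1]]]
    by (intro ennreal_leI mult_right_mono mult_left_mono) (auto simp: L2_abs(2) L2)
  also have "\<dots> = 2 * ennreal (4 * l2_norm D \<phi> * l2_norm D (pd 1 \<phi>) *
      ((l2_norm D (pd 2 \<phi>))\<^sup>2 + (l2_norm D (pd 3 \<phi>))\<^sup>2))"
    by (subst ennreal_numeral[symmetric], subst ennreal_mult[symmetric]) (auto simp: mult_ac)
  finally show ?thesis
    by (subst (asm) ennreal_mult_le_mult_iff) auto
qed

section \<open>Weak derivatives and the space V\<close>

lemma L2_mult: "f \<in> L2 D \<Longrightarrow> (\<lambda>x. c * f x) \<in> L2 D" for f :: "real^3 \<Rightarrow> real"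
  using L2_scaleR[of f D c] by simp

text \<open>The difference of the two candidates is orthogonal to all test functions. Since
  \<open>wpd\<close> is an arbitrary choice, this is what identifies it with derivatives found by
  other means.\<close>

lemma weak_partial_unique:
  assumes D: "open D" and g: "weak_partial D j f g" and g': "weak_partial D j f g'"
  shows "ae_eq D g g'"
proof -
  have L2: "g \<in> L2 D" "g' \<in> L2 D" using g g' by (auto simp: weak_partial_def)
  have "ae_eq D (\<lambda>x. g x - g' x) (\<lambda>x. 0)"
  proof (rule test_functions_dense[OF D L2_diff[OF L2]])
    fix \<phi> assume \<phi>: "\<phi> \<in> test_functions D"
    then have "\<phi> \<in> L2 D" using D by (auto intro: test_functions_L2)
    then show "l2_inner D (\<lambda>x. g x - g' x) \<phi> = 0"
      using g g' \<phi> L2 by (simp add: l2_inner_diff_left weak_partial_def)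
  qed
  then show ?thesis by (auto simp: ae_eq_def)
qed

lemma wpd_weak_partial: "weak_partial D j f g \<Longrightarrow> weak_partial D j f (wpd D j f)"
  unfolding wpd_def by (rule someI[where P = "weak_partial D j f"])

lemma wpd_ae_eq: "open D \<Longrightarrow> weak_partial D j f g \<Longrightarrow> ae_eq D (wpd D j f) g"
  by (rule weak_partial_unique[OF _ wpd_weak_partial])

text \<open>Membership in the H^1 closure of the test functions with the gradient as an explicit
  argument instead of the choice \<open>wpd\<close>. Linear combinations and limits can then be
  handled with a concrete gradient, and \<open>test_closure_sobolev0\<close> translates
  back.\<close>

definition test_closure :: "(real^3) set \<Rightarrow> (real^3 \<Rightarrow> real) \<Rightarrow> (3 \<Rightarrow> real^3 \<Rightarrow> real) \<Rightarrow> bool" where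
  "test_closure D f F \<longleftrightarrow> f \<in> L2 D \<and> (\<forall>j. F j \<in> L2 D) \<and>
    (\<exists>\<phi>. (\<forall>n::nat. \<phi> n \<in> test_functions D) \<and> (\<lambda>n. l2_norm D (\<lambda>x. \<phi> n x - f x)) \<longlonglongrightarrow> 0 \<and>
      (\<forall>j. (\<lambda>n. l2_norm D (\<lambda>x. pd j (\<phi> n) x - F j x)) \<longlonglongrightarrow> 0))"

lemma test_closureD:
  assumes "test_closure D f F"
  shows "f \<in> L2 D" "F j \<in> L2 D"
    "\<exists>\<phi>. (\<forall>n::nat. \<phi> n \<in> test_functions D) \<and> (\<lambda>n. l2_norm D (\<lambda>x. \<phi> n x - f x)) \<longlonglongrightarrow> 0 \<and>
      (\<forall>j. (\<lambda>n. l2_norm D (\<lambda>x. pd j (\<phi> n) x - F j x)) \<longlonglongrightarrow> 0)"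
  using assms unfolding test_closure_def by blast+

lemma test_closure_test:
  "\<phi> \<in> test_functions D \<Longrightarrow> D \<in> sets lebesgue \<Longrightarrow> test_closure D \<phi> (\<lambda>j. pd j \<phi>)"
  unfolding test_closure_def
  by (auto intro!: exI[of _ "\<lambda>n. \<phi>"] test_functions_L2 test_functions_pd)

lemma l2_norm_lincomb_tendsto:
  assumes f: "\<And>n. f n \<in> L2 D" "f' \<in> L2 D" "((\<lambda>n. l2_norm D (\<lambda>x. f n x - f' x)) \<longlongrightarrow> 0) F"
    and g: "\<And>n. g n \<in> L2 D" "g' \<in> L2 D" "((\<lambda>n. l2_norm D (\<lambda>x. g n x - g' x)) \<longlongrightarrow> 0) F"
  shows "((\<lambda>n. l2_norm D (\<lambda>x. (a *\<^sub>R f n x + b *\<^sub>R g n x) - (a *\<^sub>R f' x + b *\<^sub>R g' x))) \<longlongrightarrow> 0) F"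
proof (rule Lim_null_comparison)
  have "l2_norm D (\<lambda>x. (a *\<^sub>R f n x + b *\<^sub>R g n x) - (a *\<^sub>R f' x + b *\<^sub>R g' x))
      \<le> \<bar>a\<bar> * l2_norm D (\<lambda>x. f n x - f' x) + \<bar>b\<bar> * l2_norm D (\<lambda>x. g n x - g' x)" for n
  proof -
    have eq: "(\<lambda>x. (a *\<^sub>R f n x + b *\<^sub>R g n x) - (a *\<^sub>R f' x + b *\<^sub>R g' x))
        = (\<lambda>x. a *\<^sub>R (f n x - f' x) + b *\<^sub>R (g n x - g' x))"
      by (simp add: algebra_simps)
    show ?thesis
      unfolding eq l2_norm_scaleR[symmetric] by (intro l2_norm_triangle L2_intros f g)
  qed
  then show "\<forall>\<^sub>F n in F. norm (l2_norm D (\<lambda>x. (a *\<^sub>R f n x + b *\<^sub>R g n x) - (a *\<^sub>R f' x + b *\<^sub>R g' x)))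
      \<le> \<bar>a\<bar> * l2_norm D (\<lambda>x. f n x - f' x) + \<bar>b\<bar> * l2_norm D (\<lambda>x. g n x - g' x)"
    by simp
  show "((\<lambda>n. \<bar>a\<bar> * l2_norm D (\<lambda>x. f n x - f' x) + \<bar>b\<bar> * l2_norm D (\<lambda>x. g n x - g' x)) \<longlongrightarrow> 0) F"
    by (auto intro!: tendsto_eq_intros f(3) g(3))
qed

lemma test_functions_lincomb:
  "\<phi> \<in> test_functions D \<Longrightarrow> \<psi> \<in> test_functions D \<Longrightarrow> (\<lambda>x. a * \<phi> x + b * \<psi> x) \<in> test_functions D"
  by (intro test_functions_add test_functions_scale)

lemma pd_lincomb:
  assumes "smooth \<phi>" "smooth \<psi>"
  shows "pd j (\<lambda>x. a * \<phi> x + b * \<psi> x) = (\<lambda>x. a * pd j \<phi> x + b * pd j \<psi> x)"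
proof
  fix x
  note d = smooth_differentiable[OF assms(1), of x] smooth_differentiable[OF assms(2), of x]
  show "pd j (\<lambda>x. a * \<phi> x + b * \<psi> x) x = a * pd j \<phi> x + b * pd j \<psi> x"
    using d by (simp add: pd_add pd_mult pd_const)
qed

lemma test_closure_lincomb:
  assumes f: "test_closure D f F" and g: "test_closure D g G" and D: "D \<in> sets lebesgue"
  shows "test_closure D (\<lambda>x. a * f x + b * g x) (\<lambda>j x. a * F j x + b * G j x)"
proof -
  obtain \<phi> where "\<forall>n::nat. \<phi> n \<in> test_functions D" "(\<lambda>n. l2_norm D (\<lambda>x. \<phi> n x - f x)) \<longlonglongrightarrow> 0"
    "\<forall>j. (\<lambda>n. l2_norm D (\<lambda>x. pd j (\<phi> n) x - F j x)) \<longlonglongrightarrow> 0"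
    using test_closureD(3)[OF f] by blast
  note \<phi> = test_closureD(1,2)[OF f] this[rule_format]
  obtain \<psi> where "\<forall>n::nat. \<psi> n \<in> test_functions D" "(\<lambda>n. l2_norm D (\<lambda>x. \<psi> n x - g x)) \<longlonglongrightarrow> 0"
    "\<forall>j. (\<lambda>n. l2_norm D (\<lambda>x. pd j (\<psi> n) x - G j x)) \<longlonglongrightarrow> 0"
    using test_closureD(3)[OF g] by blast
  note \<psi> = test_closureD(1,2)[OF g] this[rule_format]
  note L2 = test_functions_L2[OF \<phi>(3) D] test_functions_L2[OF \<psi>(3) D]
    test_functions_L2[OF test_functions_pd[OF \<phi>(3)] D] test_functions_L2[OF test_functions_pd[OF \<psi>(3)] D]
  show ?thesis
    unfolding test_closure_def
  proof (intro conjI allI exI[of _ "\<lambda>n x. a * \<phi> n x + b * \<psi> n x"])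
    show "(\<lambda>x. a * f x + b * g x) \<in> L2 D" "(\<lambda>x. a * F j x + b * G j x) \<in> L2 D" for j
      by (intro L2_add L2_mult \<phi> \<psi>)+
    show "(\<lambda>x. a * \<phi> n x + b * \<psi> n x) \<in> test_functions D" for n
      by (intro test_functions_lincomb \<phi> \<psi>)
    show "(\<lambda>n. l2_norm D (\<lambda>x. a * \<phi> n x + b * \<psi> n x - (a * f x + b * g x))) \<longlonglongrightarrow> 0"
      using l2_norm_lincomb_tendsto[OF L2(1) \<phi>(1,4) L2(2) \<psi>(1,4), of a b] by simp
    show "(\<lambda>n. l2_norm D (\<lambda>x. pd j (\<lambda>x. a * \<phi> n x + b * \<psi> n x) x - (a * F j x + b * G j x))) \<longlonglongrightarrow> 0" for j
      using l2_norm_lincomb_tendsto[OF L2(3) \<phi>(2,5) L2(4) \<psi>(2,5), of a j b]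
      by (simp add: pd_lincomb[OF test_functions_smooth[OF \<phi>(3)] test_functions_smooth[OF \<psi>(3)]])
  qed
qed

lemma test_closure_weak_partial:
  assumes f: "test_closure D f F" and D: "D \<in> sets lebesgue"
  shows "weak_partial D j f (F j)"
proof -
  obtain \<phi> where "\<forall>n::nat. \<phi> n \<in> test_functions D" "(\<lambda>n. l2_norm D (\<lambda>x. \<phi> n x - f x)) \<longlonglongrightarrow> 0"
    "\<forall>j. (\<lambda>n. l2_norm D (\<lambda>x. pd j (\<phi> n) x - F j x)) \<longlonglongrightarrow> 0"
    using test_closureD(3)[OF f] by blast
  note \<phi> = test_closureD(1,2)[OF f] this[rule_format]
  have "l2_inner D f (pd j \<psi>) = - l2_inner D (F j) \<psi>" if \<psi>: "\<psi> \<in> test_functions D" for \<psi>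
  proof (rule LIMSEQ_unique)
    show "(\<lambda>n. l2_inner D (\<phi> n) (pd j \<psi>)) \<longlonglongrightarrow> l2_inner D f (pd j \<psi>)"
      by (intro l2_inner_tendsto_left \<phi> test_functions_L2[OF _ D] test_functions_pd \<psi>)
    have "(\<lambda>n. - l2_inner D (pd j (\<phi> n)) \<psi>) \<longlonglongrightarrow> - l2_inner D (F j) \<psi>"
      by (intro tendsto_minus l2_inner_tendsto_left \<phi> test_functions_L2[OF _ D] test_functions_pd \<psi>)
    then show "(\<lambda>n. l2_inner D (\<phi> n) (pd j \<psi>)) \<longlonglongrightarrow> - l2_inner D (F j) \<psi>"
      by (simp add: test_integration_by_parts[OF \<phi>(3) test_functions_smooth[OF \<psi>] D])
  qed
  then show ?thesis using \<phi> by (simp add: weak_partial_def)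
qed

lemma sobolev0_weak_partial:
  assumes "f \<in> sobolev0 D"
  shows "weak_partial D j f (wpd D j f)"
  using assms wpd_weak_partial by (fastforce simp: sobolev0_def)

lemma sobolev0_test_closure: "f \<in> sobolev0 D \<Longrightarrow> test_closure D f (\<lambda>j. wpd D j f)"
  using sobolev0_weak_partial[of f D] unfolding test_closure_def
  by (auto simp: sobolev0_def weak_partial_def)

text \<open>Integration by parts in the limit makes each \<open>F j\<close> a weak derivative, hence
  almost everywhere equal to \<open>wpd D j f\<close>; the same approximating sequence then serves
  for \<open>sobolev0\<close>.\<close>

lemma test_closure_sobolev0:
  assumes f: "test_closure D f F" and D: "open D"
  shows "f \<in> sobolev0 D" "ae_eq D (wpd D j f) (F j)"
proof -
  have Dl: "D \<in> sets lebesgue" using D by auto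
  obtain \<phi> where "\<forall>n::nat. \<phi> n \<in> test_functions D" "(\<lambda>n. l2_norm D (\<lambda>x. \<phi> n x - f x)) \<longlonglongrightarrow> 0"
    "\<forall>j. (\<lambda>n. l2_norm D (\<lambda>x. pd j (\<phi> n) x - F j x)) \<longlonglongrightarrow> 0"
    using test_closureD(3)[OF f] by blast
  note \<phi> = test_closureD(1,2)[OF f] this[rule_format]
  have w: "weak_partial D j f (F j)" for j by (rule test_closure_weak_partial[OF f Dl])
  show ae: "ae_eq D (wpd D j f) (F j)" for j
    by (rule wpd_ae_eq[OF D w])
  have wL2: "wpd D j f \<in> L2 D" for j
    using wpd_weak_partial[OF w[of j]] by (simp add: weak_partial_def)
  have "l2_norm D (\<lambda>x. pd j (\<phi> n) x - wpd D j f x) = l2_norm D (\<lambda>x. pd j (\<phi> n) x - F j x)" for j n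
    using ae[of j] \<phi>(2) wL2 test_functions_L2[OF test_functions_pd[OF \<phi>(3)] Dl]
    by (intro l2_norm_cong L2_diff) (auto simp: ae_eq_def)
  then show "f \<in> sobolev0 D"
    using \<phi> w by (auto simp: sobolev0_def intro!: exI[of _ \<phi>] bexI[of _ "F _"])
qed

lemma sobolev0_lincomb:
  assumes "f \<in> sobolev0 D" "g \<in> sobolev0 D" "open D"
  shows "(\<lambda>x. a * f x + b * g x) \<in> sobolev0 D"
    "ae_eq D (wpd D j (\<lambda>x. a * f x + b * g x)) (\<lambda>x. a * wpd D j f x + b * wpd D j g x)"
proof -
  have "D \<in> sets lebesgue" using assms(3) by auto
  then have "test_closure D (\<lambda>x. a * f x + b * g x) (\<lambda>j x. a * wpd D j f x + b * wpd D j g x)"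
    by (intro test_closure_lincomb sobolev0_test_closure assms)
  from test_closure_sobolev0[OF this assms(3)]
  show "(\<lambda>x. a * f x + b * g x) \<in> sobolev0 D"
    "ae_eq D (wpd D j (\<lambda>x. a * f x + b * g x)) (\<lambda>x. a * wpd D j f x + b * wpd D j g x)"
    by auto
qed

text \<open>Convergence in L^2 does not control fourth powers, so the left side of the inequality
  for test functions passes to the limit by Fatou along an almost everywhere convergent subsequence,
  while the norms on the right converge.\<close>

lemma test_closure_square:
  assumes f: "test_closure D f F" and D: "D \<in> sets lebesgue"
  shows "(\<lambda>x. (f x)\<^sup>2) \<in> L2 D"
    and "(l2_norm D (\<lambda>x. (f x)\<^sup>2))\<^sup>2 \<le>
      4 * l2_norm D f * l2_norm D (F 1) * ((l2_norm D (F 2))\<^sup>2 + (l2_norm D (F 3))\<^sup>2)" (is "_ \<le> ?R")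
proof -
  obtain \<phi> where "\<forall>n::nat. \<phi> n \<in> test_functions D" "(\<lambda>n. l2_norm D (\<lambda>x. \<phi> n x - f x)) \<longlonglongrightarrow> 0"
    "\<forall>j. (\<lambda>n. l2_norm D (\<lambda>x. pd j (\<phi> n) x - F j x)) \<longlonglongrightarrow> 0"
    using test_closureD(3)[OF f] by blast
  note \<phi> = test_closureD(1,2)[OF f] this[rule_format]
  note L2 = test_functions_L2[OF \<phi>(3) D] test_functions_L2[OF test_functions_pd[OF \<phi>(3)] D]
  obtain r :: "nat \<Rightarrow> nat" where r: "strict_mono r" "AE x in lebesgue_on D. (\<lambda>n. \<phi> (r n) x) \<longlonglongrightarrow> f x"
    using l2_convergent_AE_subseq[OF L2(1) \<phi>(1,4)] by metis
  let ?b = "\<lambda>n. 4 * l2_norm D (\<phi> (r n)) * l2_norm D (pd 1 (\<phi> (r n))) *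
     ((l2_norm D (pd 2 (\<phi> (r n))))\<^sup>2 + (l2_norm D (pd 3 (\<phi> (r n))))\<^sup>2)"
  have lim: "(\<lambda>n. l2_norm D (\<phi> (r n))) \<longlonglongrightarrow> l2_norm D f"
    "(\<lambda>n. l2_norm D (pd j (\<phi> (r n)))) \<longlonglongrightarrow> l2_norm D (F j)" for j
    using LIMSEQ_subseq_LIMSEQ[OF l2_norm_tendsto[OF L2(1) \<phi>(1,4)] r(1)]
      LIMSEQ_subseq_LIMSEQ[OF l2_norm_tendsto[OF L2(2) \<phi>(2,5)] r(1)]
    by (auto simp: o_def)
  have m: "f \<in> borel_measurable (lebesgue_on D)" "\<phi> n \<in> borel_measurable (lebesgue_on D)" for n
    using \<phi>(1) L2(1) by (auto intro: L2_measurable)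
  have "(\<integral>\<^sup>+x. ennreal ((f x)^4) \<partial>lebesgue_on D) = (\<integral>\<^sup>+x. liminf (\<lambda>n. ennreal ((\<phi> (r n) x)^4)) \<partial>lebesgue_on D)"
  proof (rule nn_integral_cong_AE, rule AE_mp[OF r(2)], rule AE_I2, rule impI)
    fix x assume "(\<lambda>n. \<phi> (r n) x) \<longlonglongrightarrow> f x"
    then have "(\<lambda>n. ennreal ((\<phi> (r n) x)^4)) \<longlonglongrightarrow> ennreal ((f x)^4)"
      by (intro tendsto_intros)
    from lim_imp_Liminf[OF trivial_limit_sequentially this]
    show "ennreal ((f x)^4) = liminf (\<lambda>n. ennreal ((\<phi> (r n) x)^4))" by simp
  qed
  also have "\<dots> \<le> liminf (\<lambda>n. \<integral>\<^sup>+x. ennreal ((\<phi> (r n) x)^4) \<partial>lebesgue_on D)"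
    by (rule nn_integral_liminf) (use m in measurable)
  also have "\<dots> \<le> liminf (\<lambda>n. ennreal (?b n))"
    by (intro Liminf_mono always_eventually allI test_functions_ladyzhenskaya \<phi>(3) D)
  also have "\<dots> = ennreal ?R"
    by (intro lim_imp_Liminf tendsto_intros lim) simp
  finally have le: "(\<integral>\<^sup>+x. ennreal ((norm ((f x)\<^sup>2))\<^sup>2) \<partial>lebesgue_on D) \<le> ennreal ?R"
    by simp
  show sq: "(\<lambda>x. (f x)\<^sup>2) \<in> L2 D"
    by (rule L2I_nn_integral[OF _ le]) (use m in measurable)
  show "(l2_norm D (\<lambda>x. (f x)\<^sup>2))\<^sup>2 \<le> ?R"
    using le unfolding nn_integral_norm_L2[OF sq] by (subst (asm) ennreal_le_iff) auto
qed

text \<open>Hoelder's inequality for two functions in L^4, where membership in L^4 is expressed by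
  the square lying in L^2.\<close>

lemma L2_mult_of_squares:
  fixes f g :: "real^3 \<Rightarrow> real"
  assumes f: "f \<in> L2 D" "(\<lambda>x. (f x)\<^sup>2) \<in> L2 D" and g: "g \<in> L2 D" "(\<lambda>x. (g x)\<^sup>2) \<in> L2 D"
  shows "(\<lambda>x. f x * g x) \<in> L2 D"
    and "(l2_norm D (\<lambda>x. f x * g x))\<^sup>2 \<le> l2_norm D (\<lambda>x. (f x)\<^sup>2) * l2_norm D (\<lambda>x. (g x)\<^sup>2)"
proof -
  have e: "(\<lambda>x. (norm (f x * g x))\<^sup>2) = (\<lambda>x. (f x)\<^sup>2 \<bullet> (g x)\<^sup>2)"
    by (simp add: power_mult_distrib)
  have "(\<lambda>x. f x * g x) \<in> borel_measurable (lebesgue_on D)"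
    by (intro borel_measurable_times L2_measurable f g)
  then show "(\<lambda>x. f x * g x) \<in> L2 D"
    using integrable_inner_L2[OF f(2) g(2)] by (simp only: L2_def mem_Collect_eq e)
  have "(l2_norm D (\<lambda>x. f x * g x))\<^sup>2 = l2_inner D (\<lambda>x. (f x)\<^sup>2) (\<lambda>x. (g x)\<^sup>2)"
    unfolding l2_norm_power2 l2_inner_def by (simp add: power2_eq_square mult_ac)
  also have "\<dots> \<le> l2_norm D (\<lambda>x. (f x)\<^sup>2) * l2_norm D (\<lambda>x. (g x)\<^sup>2)"
    using l2_Cauchy_Schwarz[OF f(2) g(2)] by linarith
  finally show "(l2_norm D (\<lambda>x. f x * g x))\<^sup>2 \<le> l2_norm D (\<lambda>x. (f x)\<^sup>2) * l2_norm D (\<lambda>x. (g x)\<^sup>2)" .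
qed

lemma l2_inner_vec:
  fixes f g :: "real^3 \<Rightarrow> ('b::euclidean_space)^'n::finite"
  assumes "f \<in> L2 D" "g \<in> L2 D"
  shows "l2_inner D f g = (\<Sum>i\<in>UNIV. l2_inner D (\<lambda>x. f x $ i) (\<lambda>x. g x $ i))"
  unfolding l2_inner_def inner_vec_def
  by (rule Bochner_Integration.integral_sum) (intro integrable_inner_L2 L2_component assms)

lemma l2_norm_component_le:
  fixes f :: "real^3 \<Rightarrow> ('b::euclidean_space)^'n::finite"
  assumes "f \<in> L2 D"
  shows "l2_norm D (\<lambda>x. f x $ i) \<le> l2_norm D f"
proof (rule power2_le_imp_le)
  have "l2_inner D (\<lambda>x. f x $ i) (\<lambda>x. f x $ i) \<le> (\<Sum>i\<in>UNIV. l2_inner D (\<lambda>x. f x $ i) (\<lambda>x. f x $ i))"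
    by (rule member_le_sum) (auto simp: l2_inner_self_nonneg)
  then show "(l2_norm D (\<lambda>x. f x $ i))\<^sup>2 \<le> (l2_norm D f)\<^sup>2"
    by (simp add: l2_norm_power2 l2_inner_vec[OF assms assms])
qed simp

section \<open>The spaces H and V\<close>

lemma solenoidal_test_fields_test: "\<phi> \<in> solenoidal_test_fields D \<Longrightarrow> (\<lambda>x. \<phi> x $ i) \<in> test_functions D"
  by (simp add: solenoidal_test_fields_def)

lemma solenoidal_test_fields_L2: "\<phi> \<in> solenoidal_test_fields D \<Longrightarrow> D \<in> sets lebesgue \<Longrightarrow> \<phi> \<in> L2 D"
  by (intro L2_vec test_functions_L2 solenoidal_test_fields_test)

lemma solenoidal_test_fields_lincomb:
  assumes "\<phi> \<in> solenoidal_test_fields D" "\<psi> \<in> solenoidal_test_fields D"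
  shows "(\<lambda>x. a *\<^sub>R \<phi> x + b *\<^sub>R \<psi> x) \<in> solenoidal_test_fields D"
proof -
  note t = solenoidal_test_fields_test[OF assms(1)] solenoidal_test_fields_test[OF assms(2)]
  have "(\<Sum>i\<in>UNIV. pd i (\<lambda>y. a * \<phi> y $ i + b * \<psi> y $ i) x)
    = a * (\<Sum>i\<in>UNIV. pd i (\<lambda>y. \<phi> y $ i) x) + b * (\<Sum>i\<in>UNIV. pd i (\<lambda>y. \<psi> y $ i) x)" for x
    by (simp add: pd_lincomb[OF test_functions_smooth[OF t(1)] test_functions_smooth[OF t(2)]]
        sum.distrib sum_distrib_left)
  then show ?thesis
    using assms by (auto simp: solenoidal_test_fields_def intro!: test_functions_lincomb)
qed

lemma H_space_L2: "u \<in> H_space D \<Longrightarrow> u \<in> L2 D"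
  by (simp add: H_space_def)

lemma H_space_lincomb:
  assumes "u \<in> H_space D" "v \<in> H_space D" and D: "D \<in> sets lebesgue"
  shows "(\<lambda>x. a *\<^sub>R u x + b *\<^sub>R v x) \<in> H_space D"
proof -
  obtain \<phi> where \<phi>: "\<And>n::nat. \<phi> n \<in> solenoidal_test_fields D" "(\<lambda>n. l2_norm D (\<lambda>x. \<phi> n x - u x)) \<longlonglongrightarrow> 0"
    using assms(1) by (auto simp: H_space_def)
  obtain \<psi> where \<psi>: "\<And>n::nat. \<psi> n \<in> solenoidal_test_fields D" "(\<lambda>n. l2_norm D (\<lambda>x. \<psi> n x - v x)) \<longlonglongrightarrow> 0"
    using assms(2) by (auto simp: H_space_def)
  have "(\<lambda>n. l2_norm D (\<lambda>x. (a *\<^sub>R \<phi> n x + b *\<^sub>R \<psi> n x) - (a *\<^sub>R u x + b *\<^sub>R v x))) \<longlonglongrightarrow> 0"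
    by (intro l2_norm_lincomb_tendsto \<phi> \<psi> solenoidal_test_fields_L2 H_space_L2 assms)
  then show ?thesis
    unfolding H_space_def mem_Collect_eq
    by (intro conjI exI[of _ "\<lambda>n x. a *\<^sub>R \<phi> n x + b *\<^sub>R \<psi> n x"] L2_intros H_space_L2[OF assms(1)]
        H_space_L2[OF assms(2)] allI solenoidal_test_fields_lincomb \<phi> \<psi>)
qed

text \<open>A diagonal choice: for each n a solenoidal test field within 1/(n+1) of
  \<open>u n\<close>.\<close>

lemma H_space_closed:
  assumes u: "\<And>n::nat. u n \<in> H_space D" and v: "v \<in> L2 D"
    and lim: "(\<lambda>n. l2_norm D (\<lambda>x. u n x - v x)) \<longlonglongrightarrow> 0" and D: "D \<in> sets lebesgue"
  shows "v \<in> H_space D"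
proof -
  have "\<exists>\<phi>\<in>solenoidal_test_fields D. l2_norm D (\<lambda>x. \<phi> x - u n x) < inverse (real (Suc n))" for n
  proof -
    obtain \<phi> where \<phi>: "\<And>k::nat. \<phi> k \<in> solenoidal_test_fields D" "(\<lambda>k. l2_norm D (\<lambda>x. \<phi> k x - u n x)) \<longlonglongrightarrow> 0"
      using u[of n] by (auto simp: H_space_def)
    have "\<forall>\<^sub>F k in sequentially. l2_norm D (\<lambda>x. \<phi> k x - u n x) < inverse (real (Suc n))"
      using order_tendstoD(2)[OF \<phi>(2), of "inverse (real (Suc n))"] by simp
    then obtain k where "l2_norm D (\<lambda>x. \<phi> k x - u n x) < inverse (real (Suc n))"
      using eventually_happens by force
    with \<phi>(1) show ?thesis by blast
  qed
  then obtain \<phi> where \<phi>: "\<And>n. \<phi> n \<in> solenoidal_test_fields D"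
    "\<And>n. l2_norm D (\<lambda>x. \<phi> n x - u n x) < inverse (real (Suc n))"
    by metis
  have "(\<lambda>n. l2_norm D (\<lambda>x. \<phi> n x - v x)) \<longlonglongrightarrow> 0"
  proof (rule Lim_null_comparison)
    have "l2_norm D (\<lambda>x. \<phi> n x - v x) \<le> inverse (real (Suc n)) + l2_norm D (\<lambda>x. u n x - v x)" for n
      using l2_norm_triangle_diff[OF solenoidal_test_fields_L2[OF \<phi>(1)[of n] D] H_space_L2[OF u[of n]] v] \<phi>(2)[of n]
      by linarith
    then show "\<forall>\<^sub>F n in sequentially. norm (l2_norm D (\<lambda>x. \<phi> n x - v x))
        \<le> inverse (real (Suc n)) + l2_norm D (\<lambda>x. u n x - v x)"
      by simp
    show "(\<lambda>n. inverse (real (Suc n)) + l2_norm D (\<lambda>x. u n x - v x)) \<longlonglongrightarrow> 0"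
      using tendsto_add[OF LIMSEQ_inverse_real_of_nat lim] by simp
  qed
  then show ?thesis using v \<phi>(1) by (auto simp: H_space_def)
qed

lemma V_space_H: "u \<in> V_space D \<Longrightarrow> u \<in> H_space D"
  by (simp add: V_space_def)

lemma V_space_L2: "u \<in> V_space D \<Longrightarrow> u \<in> L2 D"
  by (intro H_space_L2 V_space_H)

lemma V_space_sobolev0: "u \<in> V_space D \<Longrightarrow> (\<lambda>x. u x $ i) \<in> sobolev0 D"
  by (simp add: V_space_def)

lemma V_space_lincomb:
  assumes "u \<in> V_space D" "v \<in> V_space D" "open D"
  shows "(\<lambda>x. a *\<^sub>R u x + b *\<^sub>R v x) \<in> V_space D"
proof -
  have "(\<lambda>x. (a *\<^sub>R u x + b *\<^sub>R v x) $ i) \<in> sobolev0 D" for i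
    using sobolev0_lincomb(1)[OF V_space_sobolev0[OF assms(1), of i] V_space_sobolev0[OF assms(2), of i] assms(3)]
    by simp
  moreover have "(\<lambda>x. a *\<^sub>R u x + b *\<^sub>R v x) \<in> H_space D"
    using assms by (intro H_space_lincomb V_space_H) auto
  ultimately show ?thesis unfolding V_space_def by blast
qed

lemma V_space_diff:
  "u \<in> V_space D \<Longrightarrow> v \<in> V_space D \<Longrightarrow> open D \<Longrightarrow> (\<lambda>x. u x - v x) \<in> V_space D"
  using V_space_lincomb[of u D v 1 "-1"] by simp

lemma wpd_L2: "f \<in> sobolev0 D \<Longrightarrow> wpd D j f \<in> L2 D"
  using sobolev0_weak_partial by (auto simp: weak_partial_def)

lemma wgrad_nth: "wgrad D u x $ i $ j = wpd D j (\<lambda>y. u y $ i) x"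
  by (simp add: wgrad_def)

lemma wgrad_L2: "u \<in> V_space D \<Longrightarrow> wgrad D u \<in> L2 D"
  by (intro L2_vec) (simp add: wgrad_nth wpd_L2 V_space_sobolev0)

text \<open>Each of the nine entries contributes a null set. Equality is only almost everywhere
  because \<open>wpd\<close> chooses its representative separately for every function.\<close>

lemma wgrad_lincomb:
  assumes "u \<in> V_space D" "v \<in> V_space D" "open D"
  shows "ae_eq D (wgrad D (\<lambda>x. a *\<^sub>R u x + b *\<^sub>R v x)) (\<lambda>x. a *\<^sub>R wgrad D u x + b *\<^sub>R wgrad D v x)"
proof -
  have "AE x in lebesgue_on D. wpd D j (\<lambda>x. a * u x $ i + b * v x $ i) x
      = a * wpd D j (\<lambda>x. u x $ i) x + b * wpd D j (\<lambda>x. v x $ i) x" for i j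
    using sobolev0_lincomb(2)[OF V_space_sobolev0[OF assms(1), of i] V_space_sobolev0[OF assms(2), of i] assms(3)]
    by (simp add: ae_eq_def)
  then have "AE x in lebesgue_on D. \<forall>i\<in>UNIV. \<forall>j\<in>UNIV. wpd D j (\<lambda>x. a * u x $ i + b * v x $ i) x
      = a * wpd D j (\<lambda>x. u x $ i) x + b * wpd D j (\<lambda>x. v x $ i) x"
    by (intro AE_finite_allI) auto
  then show ?thesis
    unfolding ae_eq_def by (rule eventually_mono) (simp add: vec_eq_iff wgrad_nth)
qed

lemma wgrad_diff:
  assumes "u \<in> V_space D" "v \<in> V_space D" "open D"
  shows "ae_eq D (wgrad D (\<lambda>x. u x - v x)) (\<lambda>x. wgrad D u x - wgrad D v x)"
  using wgrad_lincomb[OF assms, of 1 "-1"] by simp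

lemma V_norm_nonneg [simp]: "0 \<le> V_norm D u"
  by (simp add: V_norm_def)

lemma stokes_dual_self: "stokes_dual D u u = (V_norm D u)\<^sup>2"
  by (simp add: stokes_dual_def V_norm_def l2_norm_power2)

lemma stokes_dual_expand:
  assumes "u \<in> V_space D" "v \<in> V_space D"
  shows "stokes_dual D u v = (\<Sum>i\<in>UNIV. \<Sum>j\<in>UNIV. l2_inner D (wpd D j (\<lambda>x. u x $ i)) (wpd D j (\<lambda>x. v x $ i)))"
  unfolding stokes_dual_def
  by (simp add: l2_inner_vec wgrad_L2[OF assms(1)] wgrad_L2[OF assms(2)] L2_component wgrad_nth)

lemma l2_norm_wpd_le_V_norm:
  assumes "u \<in> V_space D"
  shows "l2_norm D (wpd D j (\<lambda>x. u x $ i)) \<le> V_norm D u"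
  using l2_norm_component_le[OF L2_component[OF wgrad_L2[OF assms]], of i j]
    l2_norm_component_le[OF wgrad_L2[OF assms], of i]
  by (simp add: wgrad_nth V_norm_def)

lemma V_norm_power2:
  assumes "u \<in> V_space D"
  shows "(V_norm D u)\<^sup>2 = (\<Sum>i\<in>UNIV. \<Sum>j\<in>UNIV. (l2_norm D (wpd D j (\<lambda>x. u x $ i)))\<^sup>2)"
  using stokes_dual_expand[OF assms assms] by (simp add: stokes_dual_self l2_norm_power2)

text \<open>In the scalar inequality the single first derivative is bounded by |grad u| and the two
  squared ones together by |grad u|^2, which makes the cube.\<close>

lemma V_space_component_square:
  assumes u: "u \<in> V_space D" and D: "D \<in> sets lebesgue"
  shows "(\<lambda>x. (u x $ i)\<^sup>2) \<in> L2 D"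
    and "(l2_norm D (\<lambda>x. (u x $ i)\<^sup>2))\<^sup>2 \<le> 4 * l2_norm D u * V_norm D u ^ 3"
proof -
  let ?F = "\<lambda>j. wpd D j (\<lambda>x. u x $ i)"
  note t = test_closure_square[OF sobolev0_test_closure[OF V_space_sobolev0[OF u, of i]] D]
  show "(\<lambda>x. (u x $ i)\<^sup>2) \<in> L2 D" by (rule t)
  have "(l2_norm D (?F 2))\<^sup>2 + (l2_norm D (?F 3))\<^sup>2 \<le> (\<Sum>j\<in>UNIV. (l2_norm D (?F j))\<^sup>2)"
    unfolding UNIV_3 by simp
  also have "\<dots> \<le> (V_norm D u)\<^sup>2"
    unfolding V_norm_power2[OF u]
    using member_le_sum[of i UNIV "\<lambda>i. \<Sum>j\<in>UNIV. (l2_norm D (wpd D j (\<lambda>x. u x $ i)))\<^sup>2"]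
    by (simp add: sum_nonneg)
  finally have "4 * l2_norm D (\<lambda>x. u x $ i) * l2_norm D (?F 1) * ((l2_norm D (?F 2))\<^sup>2 + (l2_norm D (?F 3))\<^sup>2)
      \<le> 4 * l2_norm D u * V_norm D u * (V_norm D u)\<^sup>2"
    by (intro mult_mono l2_norm_wpd_le_V_norm[OF u] l2_norm_component_le[OF V_space_L2[OF u]]) auto
  also have "\<dots> = 4 * l2_norm D u * V_norm D u ^ 3"
    by (simp add: power2_eq_square power3_eq_cube)
  finally show "(l2_norm D (\<lambda>x. (u x $ i)\<^sup>2))\<^sup>2 \<le> 4 * l2_norm D u * V_norm D u ^ 3"
    using t(2) by linarith
qed

text \<open>The constant is 36 = 3^2 * 4: the triangle inequality over the three components, each
  bounded by the square root of the scalar estimate.\<close>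

lemma V_space_ladyzhenskaya:
  assumes u: "u \<in> V_space D" and D: "D \<in> sets lebesgue"
  shows "(\<lambda>x. (norm (u x))\<^sup>2) \<in> L2 D"
    and "(l2_norm D (\<lambda>x. (norm (u x))\<^sup>2))\<^sup>2 \<le> 36 * l2_norm D u * V_norm D u ^ 3"
proof -
  let ?q = "\<lambda>i x. (u x $ i)\<^sup>2" and ?K = "sqrt (4 * l2_norm D u * V_norm D u ^ 3)"
  note q = V_space_component_square[OF u D]
  have e: "(\<lambda>x. (norm (u x))\<^sup>2) = (\<lambda>x. (?q 1 x + ?q 2 x) + ?q 3 x)"
    unfolding power2_norm_eq_inner inner_vec_def UNIV_3 by (simp add: power2_eq_square add.assoc)
  show "(\<lambda>x. (norm (u x))\<^sup>2) \<in> L2 D"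
    unfolding e by (intro L2_add q)
  have K: "l2_norm D (?q i) \<le> ?K" for i
    using q(2)[of i] by (rule real_le_rsqrt)
  have "l2_norm D (\<lambda>x. (norm (u x))\<^sup>2) \<le> (l2_norm D (?q 1) + l2_norm D (?q 2)) + l2_norm D (?q 3)"
    unfolding e using l2_norm_triangle[OF L2_add[OF q(1)[of 1] q(1)[of 2]] q(1)[of 3]]
      l2_norm_triangle[OF q(1)[of 1] q(1)[of 2]]
    by linarith
  then have "l2_norm D (\<lambda>x. (norm (u x))\<^sup>2) \<le> 3 * ?K"
    using K[of 1] K[of 2] K[of 3] by linarith
  then have "(l2_norm D (\<lambda>x. (norm (u x))\<^sup>2))\<^sup>2 \<le> (3 * ?K)\<^sup>2"
    by (rule power_mono) simp
  also have "\<dots> = 36 * l2_norm D u * V_norm D u ^ 3"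
    by (simp add: power_mult_distrib)
  finally show "(l2_norm D (\<lambda>x. (norm (u x))\<^sup>2))\<^sup>2 \<le> 36 * l2_norm D u * V_norm D u ^ 3" .
qed

section \<open>Eigenfunction expansions\<close>

lemma stokes_dual_commute: "stokes_dual D u v = stokes_dual D v u"
  by (simp add: stokes_dual_def l2_inner_commute)

lemma stokes_dual_lincomb_left:
  assumes "u \<in> V_space D" "v \<in> V_space D" "z \<in> V_space D" "open D"
  shows "stokes_dual D (\<lambda>x. a *\<^sub>R u x + b *\<^sub>R v x) z = a * stokes_dual D u z + b * stokes_dual D v z"
proof -
  note L2 = wgrad_L2[OF assms(1)] wgrad_L2[OF assms(2)] wgrad_L2[OF assms(3)]
  have "stokes_dual D (\<lambda>x. a *\<^sub>R u x + b *\<^sub>R v x) z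
      = l2_inner D (\<lambda>x. a *\<^sub>R wgrad D u x + b *\<^sub>R wgrad D v x) (wgrad D z)"
    unfolding stokes_dual_def
    by (intro l2_inner_cong_left wgrad_lincomb assms wgrad_L2 V_space_lincomb L2_intros)
  then show ?thesis
    using L2 by (simp add: l2_inner_simps L2_intros stokes_dual_def)
qed

lemma stokes_dual_diff_left:
  "u \<in> V_space D \<Longrightarrow> v \<in> V_space D \<Longrightarrow> z \<in> V_space D \<Longrightarrow> open D \<Longrightarrow>
    stokes_dual D (\<lambda>x. u x - v x) z = stokes_dual D u z - stokes_dual D v z"
  using stokes_dual_lincomb_left[of u D v z 1 "-1"] by simp

text \<open>Integration by parts against an H^1 limit of test functions; the approximants have
  compact support in \<open>D\<close>, so no boundary term arises. It will be applied to first
  derivatives of eigenfunctions and components of elements of V.\<close>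

lemma weak_partial_test_closure:
  assumes fg: "weak_partial D j f g" and h: "test_closure D h H" and D: "D \<in> sets lebesgue"
  shows "l2_inner D f (H j) = - l2_inner D g h"
proof -
  obtain \<phi> where "\<forall>n::nat. \<phi> n \<in> test_functions D" "(\<lambda>n. l2_norm D (\<lambda>x. \<phi> n x - h x)) \<longlonglongrightarrow> 0"
    "\<forall>j. (\<lambda>n. l2_norm D (\<lambda>x. pd j (\<phi> n) x - H j x)) \<longlonglongrightarrow> 0"
    using test_closureD(3)[OF h] by blast
  note \<phi> = test_closureD(1,2)[OF h] this[rule_format]
  have L2: "f \<in> L2 D" "g \<in> L2 D" using fg by (auto simp: weak_partial_def)
  have "(\<lambda>n. l2_inner D (pd j (\<phi> n)) f) \<longlonglongrightarrow> l2_inner D (H j) f"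
    by (intro l2_inner_tendsto_left \<phi> L2 test_functions_L2[OF _ D] test_functions_pd)
  moreover have "(\<lambda>n. - l2_inner D (\<phi> n) g) \<longlonglongrightarrow> - l2_inner D h g"
    by (intro tendsto_minus l2_inner_tendsto_left \<phi> L2 test_functions_L2[OF _ D])
  moreover have "l2_inner D (pd j (\<phi> n)) f = - l2_inner D (\<phi> n) g" for n
    using fg \<phi>(3)[of n] by (simp add: weak_partial_def l2_inner_commute)
  ultimately show ?thesis
    using LIMSEQ_unique by (simp add: l2_inner_commute) blast
qed

lemma weak_partial_cong:
  assumes "weak_partial D j f g" "ae_eq D f f'" "f' \<in> L2 D" "D \<in> sets lebesgue"
  shows "weak_partial D j f' g"
  unfolding weak_partial_def
proof (intro conjI ballI)
  show "f' \<in> L2 D" "g \<in> L2 D" using assms by (auto simp: weak_partial_def)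
  fix \<phi> assume \<phi>: "\<phi> \<in> test_functions D"
  have "l2_inner D f' (pd j \<phi>) = l2_inner D f (pd j \<phi>)"
    using assms test_functions_L2[OF test_functions_pd[OF \<phi>] assms(4)]
    by (intro l2_inner_cong_left[OF ae_eq_sym]) (auto simp: weak_partial_def)
  then show "l2_inner D f' (pd j \<phi>) = - l2_inner D g \<phi>"
    using assms(1) \<phi> by (simp add: weak_partial_def)
qed

locale stokes_system =
  fixes D :: "(real^3) set" and w :: "nat \<Rightarrow> vfield" and lam :: "nat \<Rightarrow> real"
  assumes open_D: "open D" and system: "stokes_eigensystem D w lam"
begin

lemma D_lebesgue [simp]: "D \<in> sets lebesgue"
  using open_D by auto

lemma w_stokes_domain: "j \<ge> 1 \<Longrightarrow> w j \<in> stokes_domain D"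
  and w_eigen: "j \<ge> 1 \<Longrightarrow> ae_eq D (stokes D (w j)) (\<lambda>x. lam j *\<^sub>R w j x)"
  and w_orth: "j \<ge> 1 \<Longrightarrow> k \<ge> 1 \<Longrightarrow> l2_inner D (w j) (w k) = (if j = k then 1 else 0)"
  and w_complete: "u \<in> H_space D \<Longrightarrow> (\<And>j. j \<ge> 1 \<Longrightarrow> l2_inner D u (w j) = 0) \<Longrightarrow> ae_eq D u (\<lambda>x. 0)"
  and lam_1_pos: "0 < lam 1"
  and lam_step: "j \<ge> 1 \<Longrightarrow> lam j \<le> lam (Suc j)"
  using system unfolding stokes_eigensystem_def by auto

lemma lam_mono: "1 \<le> i \<Longrightarrow> i \<le> j \<Longrightarrow> lam i \<le> lam j"
  using lift_Suc_mono_le[of "\<lambda>k. lam (Suc k)" "i - 1" "j - 1"] lam_step by simp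

lemma lam_pos: "j \<ge> 1 \<Longrightarrow> 0 < lam j"
  using lam_1_pos lam_mono[of 1 j] by linarith

lemma w_V: "j \<ge> 1 \<Longrightarrow> w j \<in> V_space D"
  using w_stokes_domain by (simp add: stokes_domain_def)

lemma w_L2: "j \<ge> 1 \<Longrightarrow> w j \<in> L2 D"
  by (intro V_space_L2 w_V)

definition psum :: "(nat \<Rightarrow> real) \<Rightarrow> nat \<Rightarrow> vfield" where
  "psum c n = (\<lambda>x. \<Sum>j=1..n. c j *\<^sub>R w j x)"

lemma psum_Suc: "psum c (Suc n) = (\<lambda>x. 1 *\<^sub>R psum c n x + c (Suc n) *\<^sub>R w (Suc n) x)"
  by (simp add: psum_def)

lemma psum_V: "psum c n \<in> V_space D"
proof (induction n)
  case 0
  have "(\<lambda>x. 0 *\<^sub>R w 1 x + 0 *\<^sub>R w 1 x) \<in> V_space D"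
    by (intro V_space_lincomb w_V open_D) auto
  then show ?case by (simp add: psum_def)
next
  case (Suc n)
  then show ?case unfolding psum_Suc by (intro V_space_lincomb w_V open_D) auto
qed

lemma psum_H: "psum c n \<in> H_space D"
  by (intro V_space_H psum_V)

lemma psum_L2: "psum c n \<in> L2 D"
  by (intro V_space_L2 psum_V)

lemma l2_inner_psum:
  assumes "f \<in> L2 D"
  shows "l2_inner D (psum c n) f = (\<Sum>j=1..n. c j * l2_inner D f (w j))"
  unfolding psum_def using assms w_L2
  by (subst l2_inner_sum_left) (auto simp: l2_inner_scaleR_left L2_scaleR l2_inner_commute)

lemma l2_inner_psum_w: "j \<ge> 1 \<Longrightarrow> l2_inner D (psum c n) (w j) = (if j \<le> n then c j else 0)"
  by (auto simp: l2_inner_psum w_L2 w_orth if_distrib[of "\<lambda>t. _ * t"] sum.delta cong: if_cong)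

lemma l2_inner_psum_psum: "n \<le> m \<Longrightarrow> l2_inner D (psum c n) (psum c m) = (\<Sum>j=1..n. (c j)\<^sup>2)"
  by (auto simp: l2_inner_psum psum_L2 l2_inner_psum_w power2_eq_square intro!: sum.cong)

lemma l2_norm_psum_diff:
  assumes "n \<le> m"
  shows "(l2_norm D (\<lambda>x. psum c m x - psum c n x))\<^sup>2 = (\<Sum>j=1..m. (c j)\<^sup>2) - (\<Sum>j=1..n. (c j)\<^sup>2)"
  using assms l2_inner_psum_psum[OF assms, of c]
  by (simp add: l2_norm_power2 l2_inner_simps L2_intros psum_L2 l2_inner_psum_psum
      l2_inner_commute[of D "psum c m" "psum c n"])

text \<open>The squared distance of two partial sums is the difference of their sums of squares,
  which are increasing and bounded. The Cauchy sequence has a limit in L^2 that stays in the closed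
  space H. This produces the witnesses for the Leray projection and for the negative Stokes
  power.\<close>

lemma riesz_fischer:
  assumes bound: "\<And>n. (\<Sum>j=1..n. (c j)\<^sup>2) \<le> K"
  shows "\<exists>g\<in>H_space D. (\<lambda>n. l2_norm D (\<lambda>x. psum c n x - g x)) \<longlonglongrightarrow> 0 \<and>
    (\<forall>j\<ge>1. l2_inner D g (w j) = c j)"
proof -
  let ?a = "\<lambda>n. \<Sum>j=1..n. (c j)\<^sup>2"
  have "incseq ?a" by (rule incseq_SucI) simp
  then have "convergent ?a"
    using bound by (meson Bseq_eq_bounded incseq_convergent convergent_def)
  then have "Cauchy ?a" by (rule convergent_Cauchy)
  have cauchy: "\<exists>N. \<forall>m\<ge>N. \<forall>n\<ge>N. l2_norm D (\<lambda>x. psum c m x - psum c n x) < e" if "e > 0" for e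
  proof -
    obtain N where N: "\<And>m n. m \<ge> N \<Longrightarrow> n \<ge> N \<Longrightarrow> \<bar>?a m - ?a n\<bar> < e\<^sup>2"
      using \<open>Cauchy ?a\<close> \<open>e > 0\<close> unfolding Cauchy_def dist_real_def by (metis zero_less_power)
    have *: "l2_norm D (\<lambda>x. psum c m x - psum c n x) < e" if "N \<le> n" "n \<le> m" for m n
    proof (rule power2_less_imp_less)
      show "(l2_norm D (\<lambda>x. psum c m x - psum c n x))\<^sup>2 < e\<^sup>2"
        using N[of m n] that by (simp add: l2_norm_psum_diff)
    qed (use \<open>e > 0\<close> in simp)
    have "l2_norm D (\<lambda>x. psum c m x - psum c n x) < e" if "N \<le> n" "N \<le> m" for m n
      using *[of n m] *[of m n] that l2_norm_minus_commute[of D "psum c m" "psum c n"]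
      by (cases "n \<le> m") auto
    then show ?thesis by blast
  qed
  obtain g where g: "g \<in> L2 D" "(\<lambda>n. l2_norm D (\<lambda>x. psum c n x - g x)) \<longlonglongrightarrow> 0"
    by (rule L2_complete[OF psum_L2 cauchy])
  have "l2_inner D g (w j) = c j" if j: "j \<ge> 1" for j
  proof (rule LIMSEQ_unique)
    show "(\<lambda>n. l2_inner D (psum c n) (w j)) \<longlonglongrightarrow> l2_inner D g (w j)"
      by (intro l2_inner_tendsto_left psum_L2 g w_L2 j)
    have "\<forall>\<^sub>F n in sequentially. c j = l2_inner D (psum c n) (w j)"
      using eventually_ge_at_top[of j] by (rule eventually_mono) (use j in \<open>simp add: l2_inner_psum_w\<close>)
    then show "(\<lambda>n. l2_inner D (psum c n) (w j)) \<longlonglongrightarrow> c j"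
      by (rule Lim_transform_eventually[OF tendsto_const])
  qed
  moreover have "g \<in> H_space D"
    by (rule H_space_closed[OF psum_H g D_lebesgue])
  ultimately show ?thesis using g(2) by blast
qed

abbreviation coef :: "vfield \<Rightarrow> nat \<Rightarrow> real" where
  "coef f j \<equiv> l2_inner D f (w j)"

lemma bessel:
  assumes "f \<in> L2 D"
  shows "(\<Sum>j=1..n. (coef f j)\<^sup>2) \<le> (l2_norm D f)\<^sup>2"
proof -
  let ?s = "psum (coef f) n"
  have "0 \<le> l2_inner D (\<lambda>x. f x - ?s x) (\<lambda>x. f x - ?s x)"
    by (rule l2_inner_self_nonneg)
  also have "\<dots> = (l2_norm D f)\<^sup>2 - (\<Sum>j=1..n. (coef f j)\<^sup>2)"
    using assms l2_inner_psum[OF assms, of "coef f" n]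
    unfolding l2_norm_power2
    by (simp add: l2_inner_simps L2_intros psum_L2 l2_inner_psum_psum
        l2_inner_commute[of D f ?s] power2_eq_square)
  finally show ?thesis by simp
qed

text \<open>The Riesz-Fischer limit has the same coefficients as u, and the difference lies in H, so
  completeness of the eigenfunctions makes it vanish almost everywhere.\<close>

lemma expansion:
  assumes u: "u \<in> H_space D"
  shows "(\<lambda>n. l2_norm D (\<lambda>x. psum (coef u) n x - u x)) \<longlonglongrightarrow> 0"
proof -
  have uL2: "u \<in> L2 D" using u by (rule H_space_L2)
  obtain g where "g \<in> H_space D" "(\<lambda>n. l2_norm D (\<lambda>x. psum (coef u) n x - g x)) \<longlonglongrightarrow> 0"
    "\<forall>j\<ge>1. l2_inner D g (w j) = coef u j"
    using riesz_fischer[OF bessel[OF uL2]] by blast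
  note g = this[rule_format]
  have gL2: "g \<in> L2 D" using g(1) by (rule H_space_L2)
  have "(\<lambda>x. 1 *\<^sub>R g x + (- 1) *\<^sub>R u x) \<in> H_space D"
    by (intro H_space_lincomb g u D_lebesgue)
  then have "ae_eq D (\<lambda>x. g x - u x) (\<lambda>x. 0)"
    using g(3) uL2 gL2 by (intro w_complete) (auto simp: l2_inner_diff_left w_L2)
  then have "l2_norm D (\<lambda>x. psum (coef u) n x - u x) = l2_norm D (\<lambda>x. psum (coef u) n x - g x)" for n
    by (intro l2_norm_cong L2_diff psum_L2 uL2 gL2) (auto simp: ae_eq_def elim: eventually_mono)
  then show ?thesis using g(2) by simp
qed

text \<open>The expansion of u is paired with f by continuity. The second argument ranges over all
  of L^2, so it may be a residual that is still to be shown orthogonal to H.\<close>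

lemma parseval:
  assumes u: "u \<in> H_space D" and f: "f \<in> L2 D"
  shows "(\<lambda>n. \<Sum>j=1..n. coef u j * coef f j) \<longlonglongrightarrow> l2_inner D u f"
  using l2_inner_tendsto_left[OF psum_L2 H_space_L2[OF u] expansion[OF u] f]
  by (simp add: l2_inner_psum[OF f])

text \<open>The element of H with the coefficients of f is a projection: its residual is orthogonal
  to every \<open>w j\<close>, hence to H by \<open>parseval\<close>. With existence settled, the
  choice in \<open>orth_proj\<close> has the stated properties.\<close>

lemma leray:
  assumes f: "f \<in> L2 D"
  shows "leray D f \<in> H_space D" "z \<in> H_space D \<Longrightarrow> l2_inner D (\<lambda>x. f x - leray D f x) z = 0"
proof -
  obtain g where "g \<in> H_space D" "\<forall>j\<ge>1. l2_inner D g (w j) = coef f j"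
    using riesz_fischer[OF bessel[OF f]] by blast
  note g = this[rule_format]
  have gL2: "g \<in> L2 D" using g(1) by (rule H_space_L2)
  have "l2_inner D (\<lambda>x. f x - g x) z = 0" if z: "z \<in> H_space D" for z
  proof -
    have "(\<lambda>n. \<Sum>j=1..n. coef z j * coef (\<lambda>x. f x - g x) j) \<longlonglongrightarrow> l2_inner D z (\<lambda>x. f x - g x)"
      by (intro parseval z L2_diff f gL2)
    moreover have "coef (\<lambda>x. f x - g x) j = 0" if "j \<ge> 1" for j
      using g(2)[OF that] f gL2 w_L2[OF that] by (simp add: l2_inner_diff_left)
    ultimately show ?thesis
      by (simp add: LIMSEQ_const_iff l2_inner_commute)
  qed
  with g(1) have ex: "\<exists>p. p \<in> H_space D \<and> (\<forall>z\<in>H_space D. l2_inner D (\<lambda>x. f x - p x) z = 0)"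
    by blast
  show "leray D f \<in> H_space D" "z \<in> H_space D \<Longrightarrow> l2_inner D (\<lambda>x. f x - leray D f x) z = 0"
    using someI_ex[OF ex] unfolding orth_proj_def by blast+
qed

section \<open>The Dirichlet form and spectral estimates\<close>

text \<open>Membership in \<open>sobolev 2 D\<close> provides some first derivative that is again
  weakly differentiable, whereas \<open>wlaplacian\<close> iterates the choice \<open>wpd\<close>.
  Both representatives agree almost everywhere, so differentiability passes to the chosen
  one.\<close>

lemma weak_partial_second:
  assumes j: "j \<ge> 1"
  shows "weak_partial D k (wpd D k (\<lambda>x. w j x $ i)) (wpd D k (wpd D k (\<lambda>x. w j x $ i)))"
proof -
  let ?f = "\<lambda>x. w j x $ i"
  have "?f \<in> sobolev (Suc (Suc 0)) D"
    using w_stokes_domain[OF j] by (simp add: stokes_domain_def numeral_2_eq_2)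
  then obtain g where g: "g \<in> sobolev (Suc 0) D" "weak_partial D k ?f g"
    by (auto simp del: sobolev.simps simp add: sobolev.simps(2)[of "Suc 0"])
  then obtain g2 where g2: "weak_partial D k g g2" by auto
  have "weak_partial D k (wpd D k ?f) g2"
    by (rule weak_partial_cong[OF g2 ae_eq_sym[OF wpd_ae_eq[OF open_D g(2)]]])
      (use wpd_weak_partial[OF g(2)] in \<open>auto simp: weak_partial_def\<close>)
  then show ?thesis by (rule wpd_weak_partial)
qed

text \<open>The weak form of the eigenvalue equation. Integration by parts turns the Dirichlet form
  into the negative Laplacian paired with \<phi>, the Leray projection is invisible against \<phi>
  in H, and the eigenvalue equation finishes.\<close>

lemma stokes_dual_w:
  assumes j: "j \<ge> 1" and \<phi>: "\<phi> \<in> V_space D"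
  shows "stokes_dual D (w j) \<phi> = lam j * l2_inner D (w j) \<phi>"
proof -
  let ?f = "\<lambda>i x. w j x $ i" and ?L = "wlaplacian D (w j)"
  have L2: "wpd D k (wpd D k (?f i)) \<in> L2 D" for i k
    using weak_partial_second[OF j, of k i] by (simp add: weak_partial_def)
  have LL2: "?L \<in> L2 D"
    by (rule L2_vec) (simp add: wlaplacian_def L2_sum L2)
  have \<phi>L2: "\<phi> \<in> L2 D" by (rule V_space_L2[OF \<phi>])
  have c: "(\<lambda>x. \<phi> x $ i) \<in> L2 D" for i by (rule L2_component[OF \<phi>L2])
  have "stokes_dual D (w j) \<phi> = (\<Sum>i\<in>UNIV. \<Sum>k\<in>UNIV. l2_inner D (wpd D k (?f i)) (wpd D k (\<lambda>x. \<phi> x $ i)))"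
    by (rule stokes_dual_expand[OF w_V[OF j] \<phi>])
  also have "\<dots> = (\<Sum>i\<in>UNIV. \<Sum>k\<in>UNIV. - l2_inner D (wpd D k (wpd D k (?f i))) (\<lambda>x. \<phi> x $ i))"
    by (intro sum.cong refl weak_partial_test_closure weak_partial_second j sobolev0_test_closure
        V_space_sobolev0 \<phi> D_lebesgue)
  also have "\<dots> = - (\<Sum>i\<in>UNIV. l2_inner D (\<lambda>x. ?L x $ i) (\<lambda>x. \<phi> x $ i))"
    by (simp add: wlaplacian_def l2_inner_sum_left L2 c sum_negf)
  also have "\<dots> = - l2_inner D ?L \<phi>"
    by (simp add: l2_inner_vec[OF LL2 \<phi>L2])
  also have "\<dots> = - l2_inner D (leray D ?L) \<phi>"
    using leray(2)[OF LL2 V_space_H[OF \<phi>]] l2_inner_diff_left[OF LL2 H_space_L2[OF leray(1)[OF LL2]] \<phi>L2]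
    by simp
  also have "\<dots> = l2_inner D (stokes D (w j)) \<phi>"
    by (simp add: stokes_def l2_inner_uminus_left)
  also have "\<dots> = l2_inner D (\<lambda>x. lam j *\<^sub>R w j x) \<phi>"
    by (rule l2_inner_cong_left[OF w_eigen[OF j]])
      (auto simp: stokes_def intro!: L2_uminus[OF H_space_L2] L2_scaleR leray(1) LL2 w_L2 j \<phi>L2)
  finally show ?thesis by (simp add: l2_inner_scaleR_left)
qed

lemma stokes_dual_psum:
  assumes \<phi>: "\<phi> \<in> V_space D"
  shows "stokes_dual D (psum c n) \<phi> = (\<Sum>j=1..n. c j * (lam j * coef \<phi> j))"
proof (induction n)
  case 0
  have "stokes_dual D (\<lambda>x. 0 *\<^sub>R w 1 x + 0 *\<^sub>R w 1 x) \<phi> = 0"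
    by (subst stokes_dual_lincomb_left) (auto intro: w_V \<phi> open_D)
  then show ?case by (simp add: psum_def)
next
  case (Suc n)
  then show ?case
    unfolding psum_Suc
    by (subst stokes_dual_lincomb_left)
      (auto intro: psum_V w_V \<phi> open_D simp: stokes_dual_w \<phi> l2_inner_commute)
qed

text \<open>Expands the nonnegative Dirichlet form of the remainder. The remainder has zero
  coefficients up to n, so it is orthogonal to the partial sum in this form as well.\<close>

lemma bessel_V:
  assumes \<phi>: "\<phi> \<in> V_space D"
  shows "(\<Sum>j=1..n. lam j * (coef \<phi> j)\<^sup>2) \<le> (V_norm D \<phi>)\<^sup>2"
proof -
  let ?s = "psum (coef \<phi>) n"
  have d: "(\<lambda>x. \<phi> x - ?s x) \<in> V_space D" by (intro V_space_diff \<phi> psum_V open_D)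
  have "0 \<le> stokes_dual D (\<lambda>x. \<phi> x - ?s x) (\<lambda>x. \<phi> x - ?s x)"
    by (simp add: stokes_dual_self)
  also have "\<dots> = stokes_dual D \<phi> (\<lambda>x. \<phi> x - ?s x) - stokes_dual D ?s (\<lambda>x. \<phi> x - ?s x)"
    by (intro stokes_dual_diff_left \<phi> psum_V d open_D)
  also have "stokes_dual D ?s (\<lambda>x. \<phi> x - ?s x) = 0"
    unfolding stokes_dual_psum[OF d]
    by (rule sum.neutral) (auto simp: l2_inner_diff_left V_space_L2[OF \<phi>] psum_L2 w_L2 l2_inner_psum_w)
  also have "stokes_dual D \<phi> (\<lambda>x. \<phi> x - ?s x) = stokes_dual D \<phi> \<phi> - stokes_dual D ?s \<phi>"
    unfolding stokes_dual_commute[of D \<phi> "\<lambda>x. \<phi> x - ?s x"]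
    by (intro stokes_dual_diff_left \<phi> psum_V open_D)
  finally show ?thesis
    by (simp add: stokes_dual_psum[OF \<phi>] stokes_dual_self power2_eq_square mult_ac)
qed

text \<open>Parseval in H is compared term by term with \<open>bessel_V\<close>: modes up to m
  contribute nothing and the others have eigenvalue at least \<open>lam (m + 1)\<close>. With m = 0
  this is the usual Poincare inequality.\<close>

lemma poincare:
  assumes z: "z \<in> V_space D" and 0: "\<And>j. 1 \<le> j \<Longrightarrow> j \<le> m \<Longrightarrow> coef z j = 0"
  shows "lam (m + 1) * (l2_norm D z)\<^sup>2 \<le> (V_norm D z)\<^sup>2"
proof (rule LIMSEQ_le_const2)
  show "(\<lambda>n. lam (m + 1) * (\<Sum>j=1..n. coef z j * coef z j)) \<longlonglongrightarrow> lam (m + 1) * (l2_norm D z)\<^sup>2"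
    unfolding l2_norm_power2 by (intro tendsto_mult_left parseval V_space_H V_space_L2 z)
  have "lam (m + 1) * (\<Sum>j=1..n. coef z j * coef z j) \<le> (\<Sum>j=1..n. lam j * (coef z j)\<^sup>2)" for n
    unfolding sum_distrib_left
  proof (rule sum_mono)
    fix j assume j: "j \<in> {1..n}"
    show "lam (m + 1) * (coef z j * coef z j) \<le> lam j * (coef z j)\<^sup>2"
    proof (cases "j \<le> m")
      case True
      then show ?thesis using 0[of j] j by simp
    next
      case False
      then show ?thesis
        using lam_mono[of "m + 1" j] by (auto simp: power2_eq_square intro!: mult_right_mono)
    qed
  qed
  then show "\<exists>N. \<forall>n\<ge>N. lam (m + 1) * (\<Sum>j=1..n. coef z j * coef z j) \<le> (V_norm D z)\<^sup>2"
    using bessel_V[OF z] order_trans by blast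
qed

text \<open>The duality of V_{-1} and V: split 1 as lam_j^(-1/2) lam_j^(1/2) in each product of
  coefficients, apply Cauchy-Schwarz to the partial sums, bound the factor of \<phi> by
  \<open>bessel_V\<close>, and let n grow.\<close>

lemma dual_norm_bound:
  assumes h: "h \<in> H_space D" and \<phi>: "\<phi> \<in> V_space D"
  shows "l2_inner D h \<phi> \<le> stokes_norm D w lam (-1) h * V_norm D \<phi>"
proof -
  let ?c = "\<lambda>j. lam j powr (- (1 / 2)) * coef h j"
  have hL2: "h \<in> L2 D" by (rule H_space_L2[OF h])
  have sq: "(lam j powr (- (1 / 2)))\<^sup>2 = 1 / lam j" if "j \<ge> 1" for j
    using lam_pos[OF that] by (simp add: power2_eq_square powr_minus_divide flip: powr_add)
  \<comment> \<open>The bound 1 / lam j <= 1 / lam 1 makes the scaled coefficients square summable,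
    so that the element sought by \<open>stokes_power\<close> exists.\<close>
  have "(\<Sum>j=1..n. (?c j)\<^sup>2) \<le> 1 / lam 1 * (l2_norm D h)\<^sup>2" for n
  proof -
    have "(\<Sum>j=1..n. (?c j)\<^sup>2) \<le> (\<Sum>j=1..n. 1 / lam 1 * (coef h j)\<^sup>2)"
      using lam_1_pos lam_mono[of 1] by (intro sum_mono) (auto simp: power_mult_distrib sq
          intro!: mult_right_mono divide_left_mono mult_pos_pos lam_pos)
    also have "\<dots> = 1 / lam 1 * (\<Sum>j=1..n. (coef h j)\<^sup>2)" by (simp add: sum_distrib_left)
    also have "\<dots> \<le> 1 / lam 1 * (l2_norm D h)\<^sup>2"
      using lam_1_pos bessel[OF hL2, of n] by (intro mult_left_mono) auto
    finally show ?thesis .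
  qed
  from riesz_fischer[OF this] have ex: "\<exists>g. g \<in> H_space D \<and> (\<forall>j\<ge>1. l2_inner D g (w j) = lam j powr (- (1 / 2)) * l2_inner D h (w j))"
    by blast
  define g where "g = stokes_power D w lam (- (1 / 2)) h"
  have g: "g \<in> H_space D" "\<And>j. j \<ge> 1 \<Longrightarrow> coef g j = ?c j"
    using someI_ex[OF ex] unfolding g_def stokes_power_def by blast+
  have norm: "stokes_norm D w lam (-1) h = l2_norm D g"
    by (simp add: stokes_norm_def g_def)
  show ?thesis
  proof (rule LIMSEQ_le_const2[OF parseval[OF h V_space_L2[OF \<phi>]]])
    have "(\<Sum>j=1..n. coef h j * coef \<phi> j) \<le> l2_norm D g * V_norm D \<phi>" for n
    proof (rule power2_le_imp_le)
      have summand: "coef h j * coef \<phi> j = coef g j * (sqrt (lam j) * coef \<phi> j)" if "j \<ge> 1" for j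
      proof -
        have "lam j powr (- (1 / 2)) * sqrt (lam j) = 1"
          using lam_pos[OF that] by (simp add: powr_half_sqrt[symmetric] flip: powr_add)
        then show ?thesis using g(2)[OF that] by (simp add: algebra_simps)
      qed
      have "(\<Sum>j=1..n. coef h j * coef \<phi> j)\<^sup>2 = (\<Sum>j=1..n. coef g j * (sqrt (lam j) * coef \<phi> j))\<^sup>2"
        by (rule arg_cong[where f = "\<lambda>t. t\<^sup>2"], rule sum.cong) (simp_all only: summand atLeastAtMost_iff)
      also have "\<dots> \<le> (\<Sum>j=1..n. (coef g j)\<^sup>2) * (\<Sum>j=1..n. (sqrt (lam j) * coef \<phi> j)\<^sup>2)"
        by (rule Cauchy_Schwarz_ineq_sum)
      also have "(\<Sum>j=1..n. (sqrt (lam j) * coef \<phi> j)\<^sup>2) = (\<Sum>j=1..n. lam j * (coef \<phi> j)\<^sup>2)"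
        using lam_pos by (intro sum.cong) (auto simp: power_mult_distrib less_imp_le)
      also have "(\<Sum>j=1..n. (coef g j)\<^sup>2) * (\<Sum>j=1..n. lam j * (coef \<phi> j)\<^sup>2) \<le> (l2_norm D g)\<^sup>2 * (V_norm D \<phi>)\<^sup>2"
        using lam_pos by (intro mult_mono bessel H_space_L2 g bessel_V \<phi> sum_nonneg) (auto simp: less_imp_le)
      finally show "(\<Sum>j=1..n. coef h j * coef \<phi> j)\<^sup>2 \<le> (l2_norm D g * V_norm D \<phi>)\<^sup>2"
        by (simp add: power_mult_distrib)
    qed simp
    then show "\<exists>N. \<forall>n\<ge>N. (\<Sum>j=1..n. coef h j * coef \<phi> j) \<le> stokes_norm D w lam (-1) h * V_norm D \<phi>"
      unfolding norm by blast
  qed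
qed

text \<open>The partial sum of u witnesses that the projection exists; testing the residual with
  \<open>w j\<close>, itself in the span, returns the coefficient.\<close>

lemma mode_proj_coef:
  assumes u: "u \<in> L2 D"
  shows "mode_proj D w m u \<in> L2 D" "1 \<le> j \<Longrightarrow> j \<le> m \<Longrightarrow> coef (mode_proj D w m u) j = coef u j"
proof -
  let ?M = "{\<lambda>x. \<Sum>j=1..m. c j *\<^sub>R w j x | c. True}"
  have M: "?M = range (\<lambda>c. psum c m)" by (auto simp: psum_def)
  have "l2_inner D (\<lambda>x. u x - psum (coef u) m x) (psum c m) = 0" for c
  proof -
    have "l2_inner D (\<lambda>x. u x - psum (coef u) m x) (psum c m)
       = (\<Sum>j=1..m. c j * coef (\<lambda>x. u x - psum (coef u) m x) j)"
      by (subst l2_inner_commute) (intro l2_inner_psum L2_diff u psum_L2)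
    also have "\<dots> = 0"
      by (rule sum.neutral) (auto simp: l2_inner_diff_left u psum_L2 w_L2 l2_inner_psum_w)
    finally show ?thesis .
  qed
  then have ex: "\<exists>p. p \<in> ?M \<and> (\<forall>z\<in>?M. l2_inner D (\<lambda>x. u x - p x) z = 0)"
    unfolding M by blast
  define p where "p = mode_proj D w m u"
  have p: "p \<in> ?M" "\<And>z. z \<in> ?M \<Longrightarrow> l2_inner D (\<lambda>x. u x - p x) z = 0"
    using someI_ex[OF ex] unfolding p_def mode_proj_def orth_proj_def by blast+
  show L: "mode_proj D w m u \<in> L2 D"
    using p(1) psum_L2 unfolding M p_def[symmetric] by blast
  assume j: "1 \<le> j" "j \<le> m"
  have "(\<lambda>x. \<Sum>k=1..m. (if k = j then 1 else 0) *\<^sub>R w k x) = w j"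
    using j by (auto simp: if_distrib[of "\<lambda>t. t *\<^sub>R _"] cong: if_cong)
  then have "w j \<in> ?M"
    unfolding mem_Collect_eq by (intro exI[of _ "\<lambda>k. if k = j then 1 else 0"] conjI TrueI) (rule sym)
  from p(2)[OF this] show "coef (mode_proj D w m u) j = coef u j"
    using u L w_L2[OF j(1)] by (simp add: p_def l2_inner_diff_left)
qed

lemma coef_eq_if_mode_proj_eq:
  assumes "u \<in> L2 D" "v \<in> L2 D" "ae_eq D (mode_proj D w m u) (mode_proj D w m v)" "1 \<le> j" "j \<le> m"
  shows "coef u j = coef v j"
  using l2_inner_cong_left[OF assms(3) mode_proj_coef(1)[OF assms(1)] mode_proj_coef(1)[OF assms(2)] w_L2[OF assms(4)]]
    mode_proj_coef(2)[OF assms(1,4,5)] mode_proj_coef(2)[OF assms(2,4,5)]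
  by simp

end

section \<open>The trilinear form\<close>

text \<open>The integrand of the trilinear form is the Frobenius product of the Jacobian with this matrix.\<close>

definition outer :: "vfield \<Rightarrow> vfield \<Rightarrow> real^3 \<Rightarrow> real^3^3" where
  "outer u \<phi> x = (\<chi> i. \<phi> x $ i *\<^sub>R u x)"

lemma B_dual_eq_outer: "B_dual D u v \<phi> = l2_inner D (wgrad D v) (outer u \<phi>)"
proof -
  have "(A *v y) \<bullet> z = A \<bullet> (\<chi> i. z $ i *\<^sub>R y)" for A :: "real^3^3" and y z :: "real^3"
    by (simp add: inner_vec_def[of "A *v y"] inner_vec_def[of A] matrix_vector_mul_component mult.commute)
  then show ?thesis by (simp add: B_dual_def l2_inner_def outer_def)
qed

lemma norm_outer: "(norm (outer u \<phi> x))\<^sup>2 = (norm (\<phi> x))\<^sup>2 * (norm (u x))\<^sup>2"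
proof -
  have "outer u \<phi> x \<bullet> outer u \<phi> x = (\<Sum>i\<in>UNIV. outer u \<phi> x $ i \<bullet> outer u \<phi> x $ i)"
    by (rule inner_vec_def)
  also have "\<dots> = (\<Sum>i\<in>UNIV. \<phi> x $ i * \<phi> x $ i) * (u x \<bullet> u x)"
    by (simp add: outer_def sum_distrib_right mult.assoc)
  also have "(\<Sum>i\<in>UNIV. \<phi> x $ i * \<phi> x $ i) = \<phi> x \<bullet> \<phi> x"
    by (simp add: inner_vec_def)
  finally show ?thesis by (simp add: power2_norm_eq_inner)
qed

text \<open>Entries are products of two components, each in L^4 by Ladyzhenskaya's
  inequality.\<close>

lemma outer_L2:
  assumes "u \<in> V_space D" "\<phi> \<in> V_space D" "D \<in> sets lebesgue"
  shows "outer u \<phi> \<in> L2 D"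
proof (intro L2_vec)
  fix i k
  note c = L2_component[OF V_space_L2[OF assms(1)], of k] L2_component[OF V_space_L2[OF assms(2)], of i]
  show "(\<lambda>x. outer u \<phi> x $ i $ k) \<in> L2 D"
    using L2_mult_of_squares(1)[OF c(2) V_space_component_square(1)[OF assms(2,3)]
        c(1) V_space_component_square(1)[OF assms(1,3)]]
    by (simp add: outer_def)
qed

text \<open>The Frobenius norm of \<open>outer z z\<close> is |z|^2 pointwise, so after
  Cauchy-Schwarz its L^2 norm is the quantity of \<open>V_space_ladyzhenskaya\<close>. The squared
  form avoids fractional powers of the norms.\<close>

lemma B_dual_bound:
  assumes z: "z \<in> V_space D" and v: "v \<in> V_space D" and D: "D \<in> sets lebesgue"
  shows "(B_dual D z v z)\<^sup>2 \<le> (V_norm D v)\<^sup>2 * (36 * l2_norm D z * V_norm D z ^ 3)"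
proof -
  have "(l2_norm D (outer z z))\<^sup>2 = (l2_norm D (\<lambda>x. (norm (z x))\<^sup>2))\<^sup>2"
    unfolding l2_norm_power2 l2_inner_def
    by (simp add: norm_outer flip: power2_norm_eq_inner)
  then have outer: "(l2_norm D (outer z z))\<^sup>2 \<le> 36 * l2_norm D z * V_norm D z ^ 3"
    using V_space_ladyzhenskaya(2)[OF z D] by simp
  have "\<bar>B_dual D z v z\<bar> \<le> V_norm D v * l2_norm D (outer z z)"
    unfolding B_dual_eq_outer V_norm_def by (intro l2_Cauchy_Schwarz wgrad_L2 outer_L2 z v D)
  then have "\<bar>B_dual D z v z\<bar>\<^sup>2 \<le> (V_norm D v * l2_norm D (outer z z))\<^sup>2"
    by (rule power_mono) simp
  also have "\<dots> \<le> (V_norm D v)\<^sup>2 * (36 * l2_norm D z * V_norm D z ^ 3)"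
    unfolding power_mult_distrib by (intro mult_left_mono outer) simp
  finally show ?thesis by simp
qed

text \<open>The weak form of div u = 0: integration by parts proves it for solenoidal test fields,
  and it survives limits in L^2.\<close>

lemma H_space_divergence_free:
  assumes u: "u \<in> H_space D" and \<psi>: "\<psi> \<in> test_functions D" and D: "D \<in> sets lebesgue"
  shows "(\<Sum>k\<in>UNIV. l2_inner D (\<lambda>x. u x $ k) (pd k \<psi>)) = 0"
proof -
  obtain \<phi> where \<phi>: "\<forall>n::nat. \<phi> n \<in> solenoidal_test_fields D" "(\<lambda>n. l2_norm D (\<lambda>x. \<phi> n x - u x)) \<longlonglongrightarrow> 0"
    using u by (auto simp: H_space_def)
  have \<phi>s: "\<phi> n \<in> solenoidal_test_fields D" for n using \<phi>(1) by blast
  note uL2 = H_space_L2[OF u] and \<phi>L2 = solenoidal_test_fields_L2[OF \<phi>s D]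
  note t = solenoidal_test_fields_test[OF \<phi>s]
  have c: "(\<lambda>n. l2_norm D (\<lambda>x. \<phi> n x $ k - u x $ k)) \<longlonglongrightarrow> 0" for k
  proof (rule Lim_null_comparison[OF _ \<phi>(2)])
    show "\<forall>\<^sub>F n in sequentially. norm (l2_norm D (\<lambda>x. \<phi> n x $ k - u x $ k)) \<le> l2_norm D (\<lambda>x. \<phi> n x - u x)"
      using l2_norm_component_le[OF L2_diff[OF \<phi>L2 uL2], where i = k] by simp
  qed
  have "(\<lambda>n. \<Sum>k\<in>UNIV. l2_inner D (\<lambda>x. \<phi> n x $ k) (pd k \<psi>)) \<longlonglongrightarrow> (\<Sum>k\<in>UNIV. l2_inner D (\<lambda>x. u x $ k) (pd k \<psi>))"
    by (intro tendsto_sum l2_inner_tendsto_left c L2_component \<phi>L2 uL2 test_functions_L2 test_functions_pd \<psi> D)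
  moreover have "(\<Sum>k\<in>UNIV. l2_inner D (\<lambda>x. \<phi> n x $ k) (pd k \<psi>)) = 0" for n
  proof -
    have "(\<Sum>k\<in>UNIV. l2_inner D (\<lambda>x. \<phi> n x $ k) (pd k \<psi>)) = - (\<Sum>k\<in>UNIV. l2_inner D (pd k (\<lambda>x. \<phi> n x $ k)) \<psi>)"
      by (simp add: test_integration_by_parts[OF t test_functions_smooth[OF \<psi>] D] sum_negf)
    also have "(\<Sum>k\<in>UNIV. l2_inner D (pd k (\<lambda>x. \<phi> n x $ k)) \<psi>)
        = l2_inner D (\<lambda>x. \<Sum>k\<in>UNIV. pd k (\<lambda>x. \<phi> n x $ k) x) \<psi>"
      by (rule l2_inner_sum_left[symmetric]) (intro test_functions_L2 test_functions_pd t \<psi> D)+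
    also have "\<dots> = 0"
      using \<phi>s[of n] by (simp add: solenoidal_test_fields_def l2_inner_def)
    finally show ?thesis by simp
  qed
  ultimately show ?thesis by (simp add: LIMSEQ_const_iff)
qed

text \<open>For a test function in place of f the sum is half the integral of u . grad(f^2), which
  vanishes because u is weakly divergence free. The difficulty is the limit: it takes L^2
  convergence of the products of u with the approximants.\<close>

lemma transport_term_zero:
  assumes u: "u \<in> V_space D" and f: "f \<in> sobolev0 D" and D: "D \<in> sets lebesgue"
  shows "(\<Sum>k\<in>UNIV. l2_inner D (wpd D k f) (\<lambda>x. u x $ k * f x)) = 0"
proof -
  note tc = sobolev0_test_closure[OF f]
  obtain \<phi> where "\<forall>n::nat. \<phi> n \<in> test_functions D" "(\<lambda>n. l2_norm D (\<lambda>x. \<phi> n x - f x)) \<longlonglongrightarrow> 0"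
    "\<forall>j. (\<lambda>n. l2_norm D (\<lambda>x. pd j (\<phi> n) x - wpd D j f x)) \<longlonglongrightarrow> 0"
    using test_closureD(3)[OF tc] by blast
  note \<phi> = this[rule_format]
  have fL2: "f \<in> L2 D" "(\<lambda>x. (f x)\<^sup>2) \<in> L2 D" using test_closureD(1)[OF tc] test_closure_square(1)[OF tc D] by auto
  have uL2: "(\<lambda>x. u x $ k) \<in> L2 D" "(\<lambda>x. (u x $ k)\<^sup>2) \<in> L2 D" for k
    using L2_component[OF V_space_L2[OF u]] V_space_component_square(1)[OF u D] by auto
  have \<phi>L2: "\<phi> n \<in> L2 D" "pd j (\<phi> n) \<in> L2 D" "(\<lambda>x. (\<phi> n x)\<^sup>2) \<in> L2 D" for n j
    using test_functions_L2[OF \<phi>(1) D] test_functions_L2[OF test_functions_pd[OF \<phi>(1)] D]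
      test_closure_square(1)[OF test_closure_test[OF \<phi>(1) D] D] by auto
  have prod: "(\<lambda>x. u x $ k * \<phi> n x) \<in> L2 D" "(\<lambda>x. u x $ k * f x) \<in> L2 D" for k n
    by (intro L2_mult_of_squares fL2 uL2 \<phi>L2)+
  define e where "e n = (\<lambda>x. \<phi> n x - f x)" for n
  have tce: "test_closure D (e n) (\<lambda>j x. pd j (\<phi> n) x - wpd D j f x)" for n
    using test_closure_lincomb[OF test_closure_test[OF \<phi>(1) D] tc D, where a = 1 and b = "-1"] by (simp add: e_def)
  \<comment> \<open>Ladyzhenskaya's inequality for the error \<open>e n\<close> turns H^1
    convergence into L^4 convergence, which Hoelder transfers to the products with u.\<close>
  have "(\<lambda>n. (l2_norm D (\<lambda>x. (e n x)\<^sup>2))\<^sup>2) \<longlonglongrightarrow> 0"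
  proof (rule Lim_null_comparison)
    let ?g = "\<lambda>j n. l2_norm D (\<lambda>x. pd j (\<phi> n) x - wpd D j f x)"
    show "\<forall>\<^sub>F n in sequentially. norm ((l2_norm D (\<lambda>x. (e n x)\<^sup>2))\<^sup>2)
        \<le> 4 * l2_norm D (e n) * ?g 1 n * ((?g 2 n)\<^sup>2 + (?g 3 n)\<^sup>2)"
      using test_closure_square(2)[OF tce D] by simp
    show "(\<lambda>n. 4 * l2_norm D (e n) * ?g 1 n * ((?g 2 n)\<^sup>2 + (?g 3 n)\<^sup>2)) \<longlonglongrightarrow> 0"
      unfolding e_def by (auto intro!: tendsto_eq_intros \<phi>(2,3))
  qed
  from tendsto_real_sqrt[OF this] have e4: "(\<lambda>n. l2_norm D (\<lambda>x. (e n x)\<^sup>2)) \<longlonglongrightarrow> 0"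
    by simp
  have lim: "(\<lambda>n. l2_norm D (\<lambda>x. u x $ k * \<phi> n x - u x $ k * f x)) \<longlonglongrightarrow> 0" for k
  proof -
    have "(\<lambda>n. (l2_norm D (\<lambda>x. u x $ k * e n x))\<^sup>2) \<longlonglongrightarrow> 0"
    proof (rule Lim_null_comparison)
      show "\<forall>\<^sub>F n in sequentially. norm ((l2_norm D (\<lambda>x. u x $ k * e n x))\<^sup>2)
          \<le> l2_norm D (\<lambda>x. (u x $ k)\<^sup>2) * l2_norm D (\<lambda>x. (e n x)\<^sup>2)"
        using L2_mult_of_squares(2)[OF uL2 test_closureD(1)[OF tce] test_closure_square(1)[OF tce D]] by simp
      show "(\<lambda>n. l2_norm D (\<lambda>x. (u x $ k)\<^sup>2) * l2_norm D (\<lambda>x. (e n x)\<^sup>2)) \<longlonglongrightarrow> 0"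
        using tendsto_mult_left[OF e4] by simp
    qed
    from tendsto_real_sqrt[OF this] show ?thesis
      by (simp add: e_def right_diff_distrib)
  qed
  have "(\<lambda>n. \<Sum>k\<in>UNIV. l2_inner D (pd k (\<phi> n)) (\<lambda>x. u x $ k * \<phi> n x))
      \<longlonglongrightarrow> (\<Sum>k\<in>UNIV. l2_inner D (wpd D k f) (\<lambda>x. u x $ k * f x))"
    by (intro tendsto_sum l2_inner_tendsto \<phi>L2 \<phi>(3) wpd_L2[OF f] prod lim)
  moreover have "(\<Sum>k\<in>UNIV. l2_inner D (pd k (\<phi> n)) (\<lambda>x. u x $ k * \<phi> n x)) = 0" for n
  proof -
    have t: "(\<lambda>x. \<phi> n x * \<phi> n x) \<in> test_functions D"
      by (intro test_functions_mult test_functions_smooth[OF \<phi>(1)] \<phi>(1))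
    \<comment> \<open>Uses 2 \<phi> grad \<phi> = grad (\<phi> \<phi>), where the product is again a
      test function.\<close>
    have "2 * (\<Sum>k\<in>UNIV. l2_inner D (pd k (\<phi> n)) (\<lambda>x. u x $ k * \<phi> n x))
        = (\<Sum>k\<in>UNIV. l2_inner D (\<lambda>x. u x $ k) (pd k (\<lambda>x. \<phi> n x * \<phi> n x)))"
      unfolding sum_distrib_left
    proof (rule sum.cong[OF refl])
      fix k
      have "pd k (\<lambda>x. \<phi> n x * \<phi> n x) x = 2 * (\<phi> n x * pd k (\<phi> n) x)" for x
        using smooth_differentiable[OF test_functions_smooth[OF \<phi>(1)], of n x]
        by (simp add: pd_mult)
      then show "2 * l2_inner D (pd k (\<phi> n)) (\<lambda>x. u x $ k * \<phi> n x) = l2_inner D (\<lambda>x. u x $ k) (pd k (\<lambda>x. \<phi> n x * \<phi> n x))"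
        unfolding l2_inner_def by (simp add: mult_ac flip: integral_mult_right_zero)
    qed
    also have "\<dots> = 0"
      by (rule H_space_divergence_free[OF V_space_H[OF u] t D])
    finally show ?thesis by simp
  qed
  ultimately show ?thesis by (simp add: LIMSEQ_const_iff)
qed

lemma B_dual_skew:
  assumes u: "u \<in> V_space D" and z: "z \<in> V_space D" and D: "D \<in> sets lebesgue"
  shows "B_dual D u z z = 0"
proof -
  note L2 = wgrad_L2[OF z] outer_L2[OF u z D]
  have "B_dual D u z z = (\<Sum>i\<in>UNIV. \<Sum>k\<in>UNIV. l2_inner D (wpd D k (\<lambda>x. z x $ i)) (\<lambda>x. u x $ k * z x $ i))"
    unfolding B_dual_eq_outer l2_inner_vec[OF L2]
  proof (rule sum.cong[OF refl])
    fix i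
    show "l2_inner D (\<lambda>x. wgrad D z x $ i) (\<lambda>x. outer u z x $ i)
        = (\<Sum>k\<in>UNIV. l2_inner D (wpd D k (\<lambda>x. z x $ i)) (\<lambda>x. u x $ k * z x $ i))"
      using l2_inner_vec[OF L2_component[OF L2(1)] L2_component[OF L2(2)], of i i]
      by (simp add: wgrad_nth outer_def mult.commute)
  qed
  also have "\<dots> = 0"
    by (intro sum.neutral ballI transport_term_zero u V_space_sobolev0 z D)
  finally show ?thesis .
qed

text \<open>\<open>outer z z\<close> splits into \<open>outer v z\<close> minus
  \<open>outer u z\<close>, and b(u,z,z) = 0 allows the Jacobian of v to be exchanged for that of u
  against \<open>outer u z\<close>.\<close>

lemma B_dual_diff:
  assumes u: "u \<in> V_space D" and v: "v \<in> V_space D" and D: "open D"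
  defines "z \<equiv> \<lambda>x. v x - u x"
  shows "B_dual D v v z - B_dual D u u z = B_dual D z v z"
proof -
  have Dl: "D \<in> sets lebesgue" using D by auto
  have z: "z \<in> V_space D" unfolding z_def by (intro V_space_diff u v D)
  note L2 = wgrad_L2[OF u] wgrad_L2[OF v] wgrad_L2[OF z] outer_L2[OF u z Dl] outer_L2[OF v z Dl]
  have o: "outer z z = (\<lambda>x. outer v z x - outer u z x)"
    by (auto simp: outer_def fun_eq_iff vec_eq_iff z_def algebra_simps)
  have "B_dual D u z z = l2_inner D (\<lambda>x. wgrad D v x - wgrad D u x) (outer u z)"
    unfolding B_dual_eq_outer
    by (intro l2_inner_cong_left L2 L2_diff) (unfold z_def, intro wgrad_diff u v D)
  then have "l2_inner D (wgrad D v) (outer u z) = l2_inner D (wgrad D u) (outer u z)"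
    using B_dual_skew[OF u z Dl] L2 by (simp add: l2_inner_simps)
  then show ?thesis
    unfolding B_dual_eq_outer o using L2 by (simp add: l2_inner_simps)
qed

section \<open>Energy estimates\<close>

text \<open>With d the difference quotient and f s = f t + (s - t) d s, the quotient of the squared
  norm is 2 (d s, f t) + (s - t) |d s|^2. The target space is left general because the result is
  applied both to a solution and to its Jacobian.\<close>

lemma l2_inner_self_has_derivative:
  fixes f :: "real \<Rightarrow> real^3 \<Rightarrow> 'b::euclidean_space"
  assumes f: "\<And>s. f s \<in> L2 D" and f': "f' \<in> L2 D"
    and lim: "((\<lambda>s. l2_norm D (\<lambda>x. (f s x - f t x) /\<^sub>R (s - t) - f' x)) \<longlongrightarrow> 0) (at t)"
  shows "((\<lambda>s. l2_inner D (f s) (f s)) has_real_derivative 2 * l2_inner D (f t) f') (at t)"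
proof -
  define d where "d s = (\<lambda>x. (f s x - f t x) /\<^sub>R (s - t))" for s
  have d: "d s \<in> L2 D" for s unfolding d_def by (intro L2_intros f)
  have lim': "((\<lambda>s. l2_norm D (\<lambda>x. d s x - f' x)) \<longlongrightarrow> 0) (at t)"
    using lim by (simp add: d_def)
  have eq: "(l2_inner D (f s) (f s) - l2_inner D (f t) (f t)) / (s - t)
      = 2 * l2_inner D (d s) (f t) + (s - t) * l2_inner D (d s) (d s)" if "s \<noteq> t" for s
  proof -
    have "f s = (\<lambda>x. f t x + (s - t) *\<^sub>R d s x)" using that by (simp add: d_def)
    then have "l2_inner D (f s) (f s) = l2_inner D (\<lambda>x. f t x + (s - t) *\<^sub>R d s x) (\<lambda>x. f t x + (s - t) *\<^sub>R d s x)"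
      by simp
    also have "\<dots> = l2_inner D (f t) (f t) + (s - t) * (2 * l2_inner D (d s) (f t) + (s - t) * l2_inner D (d s) (d s))"
      using f[of t] d[of s] by (simp add: l2_inner_simps L2_intros l2_inner_commute[of D "f t" "d s"] algebra_simps)
    finally show ?thesis using that by simp
  qed
  have "((\<lambda>s. 2 * l2_inner D (d s) (f t) + (s - t) * l2_inner D (d s) (d s))
      \<longlongrightarrow> 2 * l2_inner D f' (f t) + (t - t) * l2_inner D f' f') (at t)"
    by (intro tendsto_intros l2_inner_tendsto l2_inner_tendsto_left d f f' lim')
  moreover have "\<forall>\<^sub>F s in at t. 2 * l2_inner D (d s) (f t) + (s - t) * l2_inner D (d s) (d s)
      = (l2_inner D (f s) (f s) - l2_inner D (f t) (f t)) / (s - t)"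
    by (auto simp: eventually_at_filter eq)
  ultimately have "((\<lambda>s. (l2_inner D (f s) (f s) - l2_inner D (f t) (f t)) / (s - t)) \<longlongrightarrow> 2 * l2_inner D f' (f t)) (at t)"
    by (auto dest: Lim_transform_eventually)
  then show ?thesis
    by (simp add: has_field_derivative_iff l2_inner_commute)
qed

lemma V_norm_diff_le:
  assumes "u \<in> V_space D" "v \<in> V_space D" "open D"
  shows "V_norm D (\<lambda>x. u x - v x) \<le> V_norm D u + V_norm D v"
proof -
  have "V_norm D (\<lambda>x. u x - v x) = l2_norm D (\<lambda>x. wgrad D u x - wgrad D v x)"
    unfolding V_norm_def by (intro l2_norm_cong wgrad_diff wgrad_L2 V_space_diff L2_diff assms)
  also have "\<dots> \<le> l2_norm D (\<lambda>x. wgrad D u x - 0) + l2_norm D (\<lambda>x. 0 - wgrad D v x)"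
    by (rule l2_norm_triangle_diff) (intro wgrad_L2 assms L2_zero)+
  also have "l2_norm D (\<lambda>x. 0 - wgrad D v x) = l2_norm D (\<lambda>x. wgrad D v x - 0)"
    by (rule l2_norm_minus_commute)
  finally show ?thesis by (simp add: V_norm_def)
qed

text \<open>Rewrites convergence of difference quotients in V as L^2 convergence for the Jacobians,
  the form in which the squared gradient norm can be differentiated.\<close>

lemma difference_quotient_V:
  assumes "a \<in> V_space D" "b \<in> V_space D" "c \<in> V_space D" "open D"
  shows "(\<lambda>x. (a x - b x) /\<^sub>R r - c x) \<in> V_space D"
    and "V_norm D (\<lambda>x. (a x - b x) /\<^sub>R r - c x)
      = l2_norm D (\<lambda>x. (wgrad D a x - wgrad D b x) /\<^sub>R r - wgrad D c x)"
proof -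
  \<comment> \<open>The zero summand brings the scaling into the shape of
    \<open>V_space_lincomb\<close> and \<open>wgrad_lincomb\<close>.\<close>
  let ?p = "\<lambda>x. inverse r *\<^sub>R (a x - b x) + 0 *\<^sub>R a x"
  have e: "(\<lambda>x. (a x - b x) /\<^sub>R r - c x) = (\<lambda>x. ?p x - c x)" by simp
  have ab: "(\<lambda>x. a x - b x) \<in> V_space D" and p: "?p \<in> V_space D"
    by (intro V_space_lincomb V_space_diff assms)+
  show q: "(\<lambda>x. (a x - b x) /\<^sub>R r - c x) \<in> V_space D"
    unfolding e by (intro V_space_diff p assms)
  have "ae_eq D (wgrad D (\<lambda>x. ?p x - c x)) (\<lambda>x. (wgrad D a x - wgrad D b x) /\<^sub>R r - wgrad D c x)"
    using wgrad_diff[OF p assms(3,4)] wgrad_lincomb[OF ab assms(1,4), of "inverse r" 0] wgrad_diff[OF assms(1,2,4)]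
    unfolding ae_eq_def by eventually_elim simp
  then show "V_norm D (\<lambda>x. (a x - b x) /\<^sub>R r - c x)
      = l2_norm D (\<lambda>x. (wgrad D a x - wgrad D b x) /\<^sub>R r - wgrad D c x)"
    unfolding V_norm_def e[symmetric] by (intro l2_norm_cong wgrad_L2 q L2_intros assms)
qed

lemma V_has_derivative_diff:
  assumes v: "\<And>s. v s \<in> V_space D" "V_has_derivative D I v t v'"
    and u: "\<And>s. u s \<in> V_space D" "V_has_derivative D I u t u'" and D: "open D"
  shows "V_has_derivative D I (\<lambda>s x. v s x - u s x) t (\<lambda>x. v' x - u' x)"
proof -
  have V: "v' \<in> V_space D" "u' \<in> V_space D" using v u by (auto simp: V_has_derivative_def)
  let ?p = "\<lambda>s x. (v s x - v t x) /\<^sub>R (s - t) - v' x" and ?q = "\<lambda>s x. (u s x - u t x) /\<^sub>R (s - t) - u' x"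
  have e: "(\<lambda>x. ((v s x - u s x) - (v t x - u t x)) /\<^sub>R (s - t) - (v' x - u' x)) = (\<lambda>x. ?p s x - ?q s x)" for s
    by (simp add: algebra_simps)
  have "((\<lambda>s. V_norm D (\<lambda>x. ?p s x - ?q s x)) \<longlongrightarrow> 0) (at t within I)"
  proof (rule Lim_null_comparison)
    show "\<forall>\<^sub>F s in at t within I. norm (V_norm D (\<lambda>x. ?p s x - ?q s x)) \<le> V_norm D (?p s) + V_norm D (?q s)"
      by (intro always_eventually allI)
        (simp add: V_norm_diff_le difference_quotient_V(1) v u V D)
    show "((\<lambda>s. V_norm D (?p s) + V_norm D (?q s)) \<longlongrightarrow> 0) (at t within I)"
      using tendsto_add[of "\<lambda>s. V_norm D (?p s)" 0 _ "\<lambda>s. V_norm D (?q s)" 0] v(2) u(2)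
      by (simp add: V_has_derivative_def)
  qed
  then show ?thesis
    unfolding V_has_derivative_def e using V_space_diff[OF V D] by blast
qed

text \<open>The integrating factor makes (E - M) exp(k s) nonincreasing, so its value at t is at
  most its value at any earlier s. That is at most (R - M) exp(k s), which tends to zero as s tends
  to minus infinity.\<close>

lemma bounded_solution_le_equilibrium:
  fixes E E' :: "real \<Rightarrow> real"
  assumes d: "\<And>t. (E has_real_derivative E' t) (at t)" and le: "\<And>t. E' t \<le> - k * (E t - M)"
    and bd: "\<And>t. E t \<le> R" and k: "k > 0"
  shows "E t \<le> M"
proof -
  define G where "G s = (E s - M) * exp (k * s)" for s
  have G: "(G has_real_derivative (E' s + k * (E s - M)) * exp (k * s)) (at s)" for s
    unfolding G_def by (auto intro!: derivative_eq_intros d simp: algebra_simps)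
  have "G t \<le> 0"
  proof (rule tendsto_lowerbound)
    have "filterlim (\<lambda>s. k * s) at_bot at_bot"
      by (rule filterlim_tendsto_pos_mult_at_bot[OF tendsto_const k filterlim_ident])
    from filterlim_compose[OF exp_at_bot this]
    show "((\<lambda>s. (R - M) * exp (k * s)) \<longlongrightarrow> 0) at_bot"
      using tendsto_mult_left[of "\<lambda>s. exp (k * s)" 0 at_bot "R - M"] by simp
    have "G t \<le> (R - M) * exp (k * s)" if "s \<le> t" for s
    proof -
      have "G t \<le> G s"
      proof (rule DERIV_nonpos_imp_nonincreasing[OF that])
        fix x
        have "(E' x + k * (E x - M)) * exp (k * x) \<le> 0"
          using le[of x] by (intro mult_nonpos_nonneg) auto
        then show "\<exists>y. (G has_real_derivative y) (at x) \<and> y \<le> 0" using G by blast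
      qed
      also have "\<dots> \<le> (R - M) * exp (k * s)"
        using bd[of s] by (simp add: G_def)
      finally show ?thesis .
    qed
    then show "\<forall>\<^sub>F s in at_bot. G t \<le> (R - M) * exp (k * s)"
      by (auto simp: eventually_at_bot_linorder)
  qed simp
  then show ?thesis by (simp add: G_def mult_le_0_iff)
qed

lemma topspace_V_topology: "topspace (V_topology D) \<subseteq> V_space D"
  by (auto simp: V_topology_def topology_generated_by_topspace)

section \<open>Energy along complete bounded solutions\<close>

context stokes_system
begin

definition energy :: "real \<Rightarrow> vfield \<Rightarrow> real" where
  "energy \<alpha> v = l2_inner D v v + \<alpha>\<^sup>2 * stokes_dual D v v"

lemma energy_eq: "energy \<alpha> v = (l2_norm D v)\<^sup>2 + \<alpha>\<^sup>2 * (V_norm D v)\<^sup>2"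
  by (simp add: energy_def l2_norm_power2 stokes_dual_self)

lemma poincare_1: "z \<in> V_space D \<Longrightarrow> lam 1 * (l2_norm D z)\<^sup>2 \<le> (V_norm D z)\<^sup>2"
  using poincare[of z 0] by simp

text \<open>Multiplied by the minimum, each of the two summands of the energy is at most |grad z|^2,
  one by Poincare and one trivially; adding them accounts for the factor 1/2 in d1.\<close>

lemma energy_le_V_norm:
  assumes z: "z \<in> V_space D" and \<alpha>: "\<alpha> > 0"
  shows "1/2 * min (1 / \<alpha>\<^sup>2) (lam 1) * energy \<alpha> z \<le> (V_norm D z)\<^sup>2"
proof -
  let ?d = "min (1 / \<alpha>\<^sup>2) (lam 1)"
  have "?d * (l2_norm D z)\<^sup>2 \<le> lam 1 * (l2_norm D z)\<^sup>2"
    by (intro mult_right_mono) auto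
  also have "\<dots> \<le> (V_norm D z)\<^sup>2" by (rule poincare_1[OF z])
  finally have 1: "?d * (l2_norm D z)\<^sup>2 \<le> (V_norm D z)\<^sup>2" .
  have "?d * (\<alpha>\<^sup>2 * (V_norm D z)\<^sup>2) \<le> 1 / \<alpha>\<^sup>2 * (\<alpha>\<^sup>2 * (V_norm D z)\<^sup>2)"
    by (intro mult_right_mono) auto
  also have "\<dots> = (V_norm D z)\<^sup>2" using \<alpha> by simp
  finally show ?thesis using 1 by (simp add: energy_eq algebra_simps)
qed

text \<open>Poincare's inequality turns differentiability in V into differentiability in L^2, so
  both summands of the energy can be differentiated.\<close>

lemma energy_derivative:
  assumes v: "\<And>s. v s \<in> V_space D" and d: "V_has_derivative D UNIV v t v'"
  shows "((\<lambda>s. energy \<alpha> (v s)) has_real_derivative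
    2 * (l2_inner D v' (v t) + \<alpha>\<^sup>2 * stokes_dual D v' (v t))) (at t)"
proof -
  have v': "v' \<in> V_space D" using d by (simp add: V_has_derivative_def)
  let ?q = "\<lambda>s x. (v s x - v t x) /\<^sub>R (s - t) - v' x"
  have q: "((\<lambda>s. V_norm D (?q s)) \<longlongrightarrow> 0) (at t)"
    using d by (simp add: V_has_derivative_def)
  have qV: "?q s \<in> V_space D" for s
    by (intro difference_quotient_V v v' open_D)
  have "((\<lambda>s. l2_norm D (?q s)) \<longlongrightarrow> 0) (at t)"
  proof (rule Lim_null_comparison)
    have "l2_norm D (?q s) \<le> V_norm D (?q s) / sqrt (lam 1)" for s
    proof (rule power2_le_imp_le)
      show "(l2_norm D (?q s))\<^sup>2 \<le> (V_norm D (?q s) / sqrt (lam 1))\<^sup>2"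
        using poincare_1[OF qV[of s]] lam_1_pos by (simp add: power_divide field_simps)
      show "0 \<le> V_norm D (?q s) / sqrt (lam 1)" using lam_1_pos by simp
    qed
    then show "\<forall>\<^sub>F s in at t. norm (l2_norm D (?q s)) \<le> V_norm D (?q s) / sqrt (lam 1)" by simp
    show "((\<lambda>s. V_norm D (?q s) / sqrt (lam 1)) \<longlongrightarrow> 0) (at t)"
      using lam_1_pos by (auto intro!: tendsto_eq_intros q)
  qed
  then have 1: "((\<lambda>s. l2_inner D (v s) (v s)) has_real_derivative 2 * l2_inner D (v t) v') (at t)"
    by (intro l2_inner_self_has_derivative V_space_L2 v v')
  have "((\<lambda>s. l2_norm D (\<lambda>x. (wgrad D (v s) x - wgrad D (v t) x) /\<^sub>R (s - t) - wgrad D v' x)) \<longlongrightarrow> 0) (at t)"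
    using q by (simp only: difference_quotient_V(2)[OF v v v' open_D])
  then have 2: "((\<lambda>s. stokes_dual D (v s) (v s)) has_real_derivative 2 * stokes_dual D (v t) v') (at t)"
    unfolding stokes_dual_def by (intro l2_inner_self_has_derivative wgrad_L2 v v')
  show ?thesis
    unfolding energy_def
    by (rule DERIV_cong[OF DERIV_add[OF 1 DERIV_cmult[OF 2]]])
      (simp add: l2_inner_commute[of D v'] stokes_dual_commute[of D v'] algebra_simps)
qed

text \<open>Balls of V about zero with integer radii cover the set, so finitely many suffice;
  Poincare's inequality converts the largest radius into an energy bound.\<close>

lemma compact_energy_bounded:
  assumes "compactin (V_topology D) \<A>"
  obtains R where "\<And>a. a \<in> \<A> \<Longrightarrow> energy \<alpha> a \<le> R"
proof -
  have zero: "(\<lambda>x. 0) \<in> V_space D" using psum_V[of _ 0] by (simp add: psum_def)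
  define U where "U n = {z \<in> V_space D. V_norm D (\<lambda>x. z x - 0) < real (Suc n)}" for n
  have "openin (V_topology D) (U n)" for n
    unfolding V_topology_def U_def using zero
    by (intro topology_generated_by_Basis CollectI exI[of _ "\<lambda>x. 0"] exI[of _ "real (Suc n)"]) auto
  moreover have AV: "\<A> \<subseteq> V_space D"
    using assms topspace_V_topology by (auto simp: compactin_def)
  have "\<A> \<subseteq> \<Union>(range U)"
  proof
    fix z assume "z \<in> \<A>"
    moreover obtain n where "V_norm D z < real n" using reals_Archimedean2 by blast
    ultimately have "z \<in> U n" using AV by (auto simp: U_def)
    then show "z \<in> \<Union>(range U)" by blast
  qed
  ultimately obtain \<F> where \<F>: "finite \<F>" "\<F> \<subseteq> range U" "\<A> \<subseteq> \<Union>\<F>"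
    using assms unfolding compactin_def by (metis rangeE)
  obtain N where N: "finite N" "\<F> = U ` N" using finite_subset_image[OF \<F>(1,2)] by blast
  \<comment> \<open>Inserting 0 keeps the maximum defined when the subcover is empty.\<close>
  define R where "R = real (Suc (Max (insert 0 N)))"
  have "energy \<alpha> a \<le> R\<^sup>2 / lam 1 + \<alpha>\<^sup>2 * R\<^sup>2" if a: "a \<in> \<A>" for a
  proof -
    obtain n where n: "n \<in> N" "a \<in> U n" using a \<F>(3) N(2) by blast
    have "n \<le> Max (insert 0 N)" using n(1) N(1) by simp
    then have "V_norm D a \<le> R" using n(2) by (simp add: U_def R_def)
    then have V: "(V_norm D a)\<^sup>2 \<le> R\<^sup>2" by (rule power_mono) simp
    have "lam 1 * (l2_norm D a)\<^sup>2 \<le> R\<^sup>2"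
      using poincare_1[of a] a AV V by (auto intro: order_trans)
    then have "(l2_norm D a)\<^sup>2 \<le> R\<^sup>2 / lam 1"
      using lam_1_pos by (simp add: field_simps)
    then show ?thesis
      unfolding energy_eq using V by (intro add_mono mult_left_mono) auto
  qed
  then show ?thesis by (rule that)
qed

lemma bounded_solution_V_norm_bound:
  fixes \<nu> \<alpha> :: real
  assumes pos: "\<nu> > 0" "\<alpha> > 0" and h: "h \<in> H_space D" and v: "\<And>t. v t \<in> V_space D"
    and sol: "nsv_solution D \<nu> \<alpha> h UNIV v" and bd: "\<And>t. energy \<alpha> (v t) \<le> R"
  defines "d \<equiv> 1/2 * min (1 / \<alpha>\<^sup>2) (lam 1)"
  shows "(V_norm D (v t))\<^sup>2 \<le> (stokes_norm D w lam (-1) h)\<^sup>2 / (\<alpha>\<^sup>2 * \<nu>\<^sup>2 * d)"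
proof -
  let ?K = "stokes_norm D w lam (-1) h"
  have d: "d > 0" using pos lam_1_pos by (simp add: d_def)
  obtain v' where v': "\<And>t. V_has_derivative D UNIV v t (v' t)"
    and eq: "\<And>t \<phi>. \<phi> \<in> V_space D \<Longrightarrow> l2_inner D (v' t) \<phi> + \<nu> * stokes_dual D (v t) \<phi> + \<alpha>\<^sup>2 * stokes_dual D (v' t) \<phi>
        + B_dual D (v t) (v t) \<phi> = l2_inner D h \<phi>"
    using sol unfolding nsv_solution_def by blast
  have "energy \<alpha> (v t) \<le> ?K\<^sup>2 / (\<nu>\<^sup>2 * d)"
  proof (rule bounded_solution_le_equilibrium[OF energy_derivative[OF v v'] _ bd])
    show "0 < \<nu> * d" using pos d by simp
    fix s
    let ?X = "V_norm D (v s)"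
    have "2 * (l2_inner D (v' s) (v s) + \<alpha>\<^sup>2 * stokes_dual D (v' s) (v s)) = 2 * (l2_inner D h (v s) - \<nu> * ?X\<^sup>2)"
      using eq[OF v, of s s] B_dual_skew[OF v v D_lebesgue, of s s] by (simp add: stokes_dual_self algebra_simps)
    also have "\<dots> \<le> 2 * (?K * ?X) - 2 * \<nu> * ?X\<^sup>2"
      using dual_norm_bound[OF h v, of s] by simp
    also have "\<dots> \<le> ?K\<^sup>2 / \<nu> - \<nu> * ?X\<^sup>2"
    proof -
      \<comment> \<open>Young's inequality as a completed square; it spends half of the dissipation
        2 \<nu> |grad v|^2 on the forcing.\<close>
      have "0 \<le> (?K - \<nu> * ?X)\<^sup>2 / \<nu>" using pos by simp
      also have "\<dots> = ?K\<^sup>2 / \<nu> - 2 * (?K * ?X) + \<nu> * ?X\<^sup>2"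
        using pos by (simp add: power2_eq_square field_simps)
      finally show ?thesis by simp
    qed
    also have "\<dots> \<le> ?K\<^sup>2 / \<nu> - \<nu> * (d * energy \<alpha> (v s))"
      using energy_le_V_norm[OF v pos(2), of s] pos by (simp add: d_def)
    \<comment> \<open>The relaxation rate is \<nu> d, and the forcing term divided by it is the
      equilibrium energy.\<close>
    also have "\<dots> = - (\<nu> * d) * (energy \<alpha> (v s) - ?K\<^sup>2 / (\<nu>\<^sup>2 * d))"
      using pos d by (simp add: field_simps power2_eq_square)
    finally show "2 * (l2_inner D (v' s) (v s) + \<alpha>\<^sup>2 * stokes_dual D (v' s) (v s))
        \<le> - (\<nu> * d) * (energy \<alpha> (v s) - ?K\<^sup>2 / (\<nu>\<^sup>2 * d))" .
  qed
  moreover have "\<alpha>\<^sup>2 * (V_norm D (v t))\<^sup>2 \<le> energy \<alpha> (v t)"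
    by (simp add: energy_eq)
  ultimately have "\<alpha>\<^sup>2 * (V_norm D (v t))\<^sup>2 \<le> ?K\<^sup>2 / (\<nu>\<^sup>2 * d)" by linarith
  then have "(V_norm D (v t))\<^sup>2 \<le> ?K\<^sup>2 / (\<nu>\<^sup>2 * d) / \<alpha>\<^sup>2"
    using pos(2) by (simp only: pos_le_divide_eq zero_less_power mult.commute[of _ "\<alpha>\<^sup>2"])
  then show ?thesis by (simp add: mult_ac)
qed

text \<open>Poincare trades the single factor |z| for |grad z| / sqrt(lam_{m+1}), making the
  Ladyzhenskaya bound a fourth power of |grad z|. It falls below (\<nu> |grad z|^2 / 2)^2 once 36 P
  <= (\<nu>^2 / 4) sqrt(lam_{m+1}), that is sqrt(lam_{m+1}) >= 144 P / \<nu>^2, whose square is the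
  hypothesis.\<close>

lemma B_dual_high_modes_bound:
  assumes \<nu>: "\<nu> > 0" and z: "z \<in> V_space D" and v: "v \<in> V_space D"
    and modes: "\<And>j. 1 \<le> j \<Longrightarrow> j \<le> m \<Longrightarrow> coef z j = 0"
    and P: "(V_norm D v)\<^sup>2 \<le> P" and L: "20736 * P\<^sup>2 / \<nu>^4 \<le> lam (m + 1)"
  shows "\<bar>B_dual D z v z\<bar> \<le> \<nu> / 2 * (V_norm D z)\<^sup>2"
proof -
  let ?Z = "V_norm D z" and ?s = "sqrt (lam (m + 1))"
  have s: "?s > 0" "?s\<^sup>2 = lam (m + 1)" using lam_pos[of "m + 1"] by auto
  have P0: "0 \<le> P" using P by (rule order_trans[rotated]) simp
  have "(144 * P / \<nu>\<^sup>2)\<^sup>2 \<le> ?s\<^sup>2"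
    using L unfolding s(2) by (simp add: power_divide power_mult_distrib)
  then have "144 * P / \<nu>\<^sup>2 \<le> ?s" using s(1) by (auto intro: power2_le_imp_le)
  then have Ps: "36 * P \<le> \<nu>\<^sup>2 / 4 * ?s" using \<nu> by (simp add: field_simps)
  have "(?s * l2_norm D z)\<^sup>2 \<le> ?Z\<^sup>2"
    using poincare[OF z modes] s(2) by (simp add: power_mult_distrib)
  then have zs: "?s * l2_norm D z \<le> ?Z" by (rule power2_le_imp_le) simp
  have "(B_dual D z v z)\<^sup>2 \<le> (V_norm D v)\<^sup>2 * (36 * l2_norm D z * ?Z^3)"
    by (rule B_dual_bound[OF z v D_lebesgue])
  also have "\<dots> \<le> P * (36 * l2_norm D z * ?Z^3)"
    using P by (intro mult_right_mono) auto
  also have "\<dots> = (36 * P) * (l2_norm D z * ?Z^3)" by simp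
  also have "\<dots> \<le> (\<nu>\<^sup>2 / 4 * ?s) * (l2_norm D z * ?Z^3)"
    by (intro mult_right_mono Ps) auto
  also have "\<dots> = \<nu>\<^sup>2 / 4 * ((?s * l2_norm D z) * ?Z^3)" by simp
  also have "\<dots> \<le> \<nu>\<^sup>2 / 4 * (?Z * ?Z^3)"
    by (intro mult_left_mono mult_right_mono zs) auto
  also have "\<dots> = (\<nu> / 2 * ?Z\<^sup>2)\<^sup>2"
    by (simp add: power_mult_distrib power_divide power2_eq_square power3_eq_cube)
  finally have "\<bar>B_dual D z v z\<bar>\<^sup>2 \<le> (\<nu> / 2 * ?Z\<^sup>2)\<^sup>2" by simp
  then show ?thesis by (rule power2_le_imp_le) (use \<nu> in simp)
qed

lemma determining_modes:
  fixes \<nu> \<alpha> :: real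
  assumes pos: "\<nu> > 0" "\<alpha> > 0" and h: "h \<in> H_space D"
    and u: "\<And>t. u t \<in> V_space D" "nsv_solution D \<nu> \<alpha> h UNIV u" "\<And>t. energy \<alpha> (u t) \<le> R"
    and v: "\<And>t. v t \<in> V_space D" "nsv_solution D \<nu> \<alpha> h UNIV v" "\<And>t. energy \<alpha> (v t) \<le> R"
    and modes: "\<And>t j. 1 \<le> j \<Longrightarrow> j \<le> m \<Longrightarrow> coef (u t) j = coef (v t) j"
    and lam: "20736 * (stokes_norm D w lam (-1) h ^ 4 / (\<alpha> ^ 4 * \<nu> ^ 8 * (1/2 * min (1 / \<alpha>\<^sup>2) (lam 1))\<^sup>2))
      \<le> lam (m + 1)"
  shows "ae_eq D (v t) (u t)"
proof -
  define d where "d = 1/2 * min (1 / \<alpha>\<^sup>2) (lam 1)"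
  have d: "d > 0" using pos lam_1_pos by (simp add: d_def)
  define P where "P = (stokes_norm D w lam (-1) h)\<^sup>2 / (\<alpha>\<^sup>2 * \<nu>\<^sup>2 * d)"
  have P: "(V_norm D (v t))\<^sup>2 \<le> P" for t
    unfolding P_def d_def by (rule bounded_solution_V_norm_bound[OF pos h v])
  \<comment> \<open>The eighth power of \<nu> consists of \<nu>^4 from the square of P and \<nu>^4
    from the absorption.\<close>
  have L: "20736 * P\<^sup>2 / \<nu>^4 \<le> lam (m + 1)"
    using lam unfolding P_def d_def[symmetric]
    by (simp add: power_divide power_mult_distrib mult_ac flip: power_mult power_add)
  define z where "z t = (\<lambda>x. v t x - u t x)" for t
  have z: "z t \<in> V_space D" for t
    unfolding z_def by (intro V_space_diff u v open_D)
  have z0: "coef (z t) j = 0" if "1 \<le> j" "j \<le> m" for t j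
    using modes[OF that] that by (simp add: z_def l2_inner_diff_left V_space_L2 u v w_L2)
  obtain u' where u': "\<And>t. V_has_derivative D UNIV u t (u' t)"
    and equ: "\<And>t \<phi>. \<phi> \<in> V_space D \<Longrightarrow> l2_inner D (u' t) \<phi> + \<nu> * stokes_dual D (u t) \<phi> + \<alpha>\<^sup>2 * stokes_dual D (u' t) \<phi>
        + B_dual D (u t) (u t) \<phi> = l2_inner D h \<phi>"
    using u(2) unfolding nsv_solution_def by blast
  obtain v' where v': "\<And>t. V_has_derivative D UNIV v t (v' t)"
    and eqv: "\<And>t \<phi>. \<phi> \<in> V_space D \<Longrightarrow> l2_inner D (v' t) \<phi> + \<nu> * stokes_dual D (v t) \<phi> + \<alpha>\<^sup>2 * stokes_dual D (v' t) \<phi>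
        + B_dual D (v t) (v t) \<phi> = l2_inner D h \<phi>"
    using v(2) unfolding nsv_solution_def by blast
  have V': "u' t \<in> V_space D" "v' t \<in> V_space D" for t
    using u'[of t] v'[of t] by (auto simp: V_has_derivative_def)
  define z' where "z' t = (\<lambda>x. v' t x - u' t x)" for t
  have zd: "V_has_derivative D UNIV z t (z' t)" for t
    using V_has_derivative_diff[OF v(1) v' u(1) u' open_D] unfolding z_def z'_def .
  \<comment> \<open>From (a + b)^2 <= 2 a^2 + 2 b^2 applied to both norms in the energy.\<close>
  have bd: "energy \<alpha> (z t) \<le> 4 * R" for t
  proof -
    have sq: "(a + b)\<^sup>2 \<le> 2 * a\<^sup>2 + 2 * b\<^sup>2" for a b :: real
      using sum_squares_bound[of a b] by (simp add: power2_sum)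
    have "l2_norm D (z t) \<le> l2_norm D (\<lambda>x. v t x - 0) + l2_norm D (\<lambda>x. 0 - u t x)"
      unfolding z_def by (rule l2_norm_triangle_diff) (intro V_space_L2 u v L2_zero)+
    also have "l2_norm D (\<lambda>x. 0 - u t x) = l2_norm D (\<lambda>x. u t x - 0)"
      by (rule l2_norm_minus_commute)
    finally have "(l2_norm D (z t))\<^sup>2 \<le> (l2_norm D (v t) + l2_norm D (u t))\<^sup>2"
      by (intro power_mono) auto
    moreover have "(V_norm D (z t))\<^sup>2 \<le> (V_norm D (v t) + V_norm D (u t))\<^sup>2"
      unfolding z_def by (intro power_mono V_norm_diff_le u v open_D) auto
    ultimately have "(l2_norm D (z t))\<^sup>2 \<le> 2 * (l2_norm D (v t))\<^sup>2 + 2 * (l2_norm D (u t))\<^sup>2"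
      "(V_norm D (z t))\<^sup>2 \<le> 2 * (V_norm D (v t))\<^sup>2 + 2 * (V_norm D (u t))\<^sup>2"
      using sq order_trans by blast+
    then have "energy \<alpha> (z t) \<le> (2 * (l2_norm D (v t))\<^sup>2 + 2 * (l2_norm D (u t))\<^sup>2)
        + \<alpha>\<^sup>2 * (2 * (V_norm D (v t))\<^sup>2 + 2 * (V_norm D (u t))\<^sup>2)"
      unfolding energy_eq by (intro add_mono mult_left_mono) auto
    also have "\<dots> = 2 * energy \<alpha> (v t) + 2 * energy \<alpha> (u t)"
      by (simp add: energy_eq algebra_simps)
    also have "\<dots> \<le> 4 * R" using u(3)[of t] v(3)[of t] by simp
    finally show ?thesis .
  qed
  have "energy \<alpha> (z t) \<le> 0"
  \<comment> \<open>The forcing cancels in the difference of the equations, so the equilibrium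
    energy is M = 0.\<close>
  proof (rule bounded_solution_le_equilibrium[OF energy_derivative[OF z zd] _ bd])
    show "0 < \<nu> * d" using pos d by simp
    fix s
    let ?Z = "V_norm D (z s)"
    have "l2_inner D (z' s) (z s) + \<alpha>\<^sup>2 * stokes_dual D (z' s) (z s)
        = - \<nu> * stokes_dual D (z s) (z s) - (B_dual D (v s) (v s) (z s) - B_dual D (u s) (u s) (z s))"
      using eqv[OF z, of s s] equ[OF z, of s s]
      by (simp add: z'_def l2_inner_diff_left V_space_L2[OF V'(1)] V_space_L2[OF V'(2)] V_space_L2[OF z]
          stokes_dual_diff_left[OF V'(2) V'(1) z open_D] algebra_simps)
        (simp add: z_def stokes_dual_diff_left[OF v(1) u(1) z[unfolded z_def] open_D] algebra_simps)
    also have "\<dots> = - \<nu> * ?Z\<^sup>2 - B_dual D (z s) (v s) (z s)"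
      using B_dual_diff[OF u(1) v(1) open_D, of s s] by (simp add: z_def stokes_dual_self)
    also have "\<dots> \<le> - \<nu> / 2 * ?Z\<^sup>2"
      using B_dual_high_modes_bound[OF pos(1) z v(1) z0 P L, of s s] by linarith
    finally have "2 * (l2_inner D (z' s) (z s) + \<alpha>\<^sup>2 * stokes_dual D (z' s) (z s)) \<le> - \<nu> * ?Z\<^sup>2"
      by simp
    also have "\<dots> \<le> - \<nu> * (d * energy \<alpha> (z s))"
      using energy_le_V_norm[OF z pos(2), of s] pos by (simp add: d_def)
    finally show "2 * (l2_inner D (z' s) (z s) + \<alpha>\<^sup>2 * stokes_dual D (z' s) (z s))
        \<le> - (\<nu> * d) * (energy \<alpha> (z s) - 0)" by (simp add: mult.assoc)
  qed
  moreover have "(l2_norm D (z t))\<^sup>2 \<le> energy \<alpha> (z t)"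
    by (simp add: energy_eq)
  ultimately have "(l2_norm D (z t))\<^sup>2 \<le> 0" by linarith
  then have "l2_norm D (z t) = 0" by simp
  then have "ae_eq D (z t) (\<lambda>x. 0)"
    by (rule l2_norm_eq_0_imp_ae[OF V_space_L2[OF z]])
  then show ?thesis by (auto simp: ae_eq_def z_def)
qed

end

theorem theorem4p5:
  fixes \<Omega> :: "(real^3) set"
  assumes "bounded_Ck_domain 2 \<Omega>"
  shows "\<exists>C>0. \<forall>r>0. \<forall>D. D = (\<lambda>x. r *\<^sub>R x) ` \<Omega> \<longrightarrow>
    (\<forall>(w :: nat \<Rightarrow> vfield) (lam :: nat \<Rightarrow> real) (\<nu> :: real) (\<alpha> :: real) (d1 :: real)
       (h :: vfield) (\<A> :: vfield set) (m :: nat) (u :: real \<Rightarrow> vfield) (v :: real \<Rightarrow> vfield).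
      stokes_eigensystem D w lam \<longrightarrow>
      \<nu> > 0 \<longrightarrow> \<alpha> > 0 \<longrightarrow>
      h \<in> H_space D \<longrightarrow>
      nsv_global_attractor D \<nu> \<alpha> h \<A> \<longrightarrow>
      d1 = 1/2 * min (1 / \<alpha>\<^sup>2) (lam 1) \<longrightarrow>
      lam (m + 1) \<ge> C * (stokes_norm D w lam (-1) h ^ 4 / (\<alpha> ^ 4 * \<nu> ^ 8 * d1\<^sup>2)) \<longrightarrow>
      nsv_solution D \<nu> \<alpha> h UNIV v \<longrightarrow> (\<forall>t. v t \<in> \<A>) \<longrightarrow>
      nsv_solution D \<nu> \<alpha> h UNIV u \<longrightarrow> (\<forall>t. u t \<in> \<A>) \<longrightarrow>
      (\<forall>t. ae_eq D (mode_proj D w m (u t)) (mode_proj D w m (v t))) \<longrightarrow>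
      (\<forall>t. ae_eq D (v t) (u t)))"
proof (intro exI[of _ 20736] conjI allI impI)
  fix r :: real and D w lam \<nu> \<alpha> d1 h \<A> m u v t
  assume r: "r > 0" and D: "D = (\<lambda>x. r *\<^sub>R x) ` \<Omega>"
    and sys: "stokes_eigensystem D w lam" and pos: "\<nu> > 0" "\<alpha> > 0" and h: "h \<in> H_space D"
    and attr: "nsv_global_attractor D \<nu> \<alpha> h \<A>" and d1: "d1 = 1/2 * min (1 / \<alpha>\<^sup>2) (lam 1)"
    and lam: "20736 * (stokes_norm D w lam (-1) h ^ 4 / (\<alpha> ^ 4 * \<nu> ^ 8 * d1\<^sup>2)) \<le> lam (m + 1)"
    and v: "nsv_solution D \<nu> \<alpha> h UNIV v" "\<forall>t. v t \<in> \<A>"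
    and u: "nsv_solution D \<nu> \<alpha> h UNIV u" "\<forall>t. u t \<in> \<A>"
    and modes: "\<forall>t. ae_eq D (mode_proj D w m (u t)) (mode_proj D w m (v t))"
  have "open \<Omega>" using assms by (simp add: bounded_Ck_domain_def)
  \<comment> \<open>The constant is absolute, so all estimates are made directly on the rescaled
    domain, with nothing transported from \<Omega>.\<close>
  then have "open D" unfolding D using r by (intro open_scaling) auto
  with sys interpret stokes_system D w lam by unfold_locales
  have A: "compactin (V_topology D) \<A>" using attr by (simp add: nsv_global_attractor_def)
  \<comment> \<open>One bound serves both solutions at all times, past and future, since both stay
    in the compact set.\<close>
  obtain R where R: "\<And>a. a \<in> \<A> \<Longrightarrow> energy \<alpha> a \<le> R"
    using compact_energy_bounded[OF A] by blast
  have "\<A> \<subseteq> V_space D" using A topspace_V_topology by (auto simp: compactin_def)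
  then have V: "u t \<in> V_space D" "v t \<in> V_space D" for t using u(2) v(2) by auto
  have c: "coef (u t) j = coef (v t) j" if "1 \<le> j" "j \<le> m" for t j
    using coef_eq_if_mode_proj_eq[OF V_space_L2[OF V(1)] V_space_L2[OF V(2)]] modes that by blast
  show "ae_eq D (v t) (u t)"
    by (rule determining_modes[OF pos h V(1) u(1) _ V(2) v(1) _ c lam[unfolded d1]])
      (use R u(2) v(2) in auto)
qed simp

end
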